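(* Let $G$ be a group with neutral element $e$ and let $S$ be a nonzero $G$-graded ring. Consider the following five assertions: (a) $S$ is not prime. (b) There exist: (i) subgroups $N \lhd H \subseteq G$; (ii) an $H$-invariant ideal $I$ of $S_e$ such that $I^x I = \{0\}$ for every $x \in G \setminus H$; and (iii) nonzero ideals $\tilde{A}, \tilde{B}$ of $S_N$ such that $\tilde{A}, \tilde{B} \subseteq I S_N$ and $\tilde A S_H \tilde B = \{0\}$. (c) There exist: (i) subgroups $N \lhd H \subseteq G$ with $N$ finite; (ii) an $H$-invariant ideal $I$ of $S_e$ such that $I^x I = \{0\}$ for every $x \in G \setminus H$; and (iii) nonzero ideals $\tilde{A}, \tilde{B}$ of $S_N$ such that $\tilde{A}, \tilde{B} \subseteq I S_N$ and $\tilde A S_H \tilde B = \{0\}$. (d) There exist: (i) subgroups $N \lhd H \subseteq G$ with $N$ finite; (ii) an $H$-invariant ideal $I$ of $S_e$ such that $I^x I = \{0\}$ for every $x \in G \setminus H$; and (iii) nonzero $H$-invariant ideals $\tilde{A}, \tilde{B}$ of $S_N$ such that $\tilde{A}, \tilde{B} \subseteq I S_N$ and $\tilde A S_H \tilde B = \{0\}$. (e) There exist: (i) subgroups $N \lhd H \subseteq G$ with $N$ finite; (ii) an $H$-invariant ideal $I$ of $S_e$ such that $I^x I = \{0\}$ for every $x \in G \setminus H$; and (iii) nonzero $H/N$-invariant ideals $\tilde{A}, \tilde{B}$ of $S_N$ such that $\tilde{A}, \tilde{B} \subseteq I S_N$ and $\tilde A \tilde B = \{0\}$. Then the following hold: (1)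 If $S$ is non-degenerately $G$-graded, then (e) $\Rightarrow$ (d) $\Rightarrow$ (c) $\Rightarrow$ (b) $\Rightarrow$ (a). (2) If $S$ is nearly epsilon-strongly $G$-graded, then (a), (b), (c), (d) and (e) are all equivalent.
   Context: Rings are associative but not necessarily unital; ideals are two-sided. For subsets $U,V$ of a ring, $UV$ denotes the set of finite sums of elements $uv$ with $u\in U$, $v\in V$. A proper ideal $P$ of $S$ is prime if for all ideals $A,B$ of $S$, $AB\subseteq P$ implies $A\subseteq P$ or $B\subseteq P$; the ring $S$ is prime if $\{0\}$ is a prime ideal of $S$ (in particular $\{0\}$ is proper). A ring $S$ is $G$-graded if $S=\bigoplus_{x\in G}S_x$ as additive groups for given additive subgroups $S_x$, with $S_xS_y\subseteq S_{xy}$ for all $x,y\in G$. For a subset $K\subseteq G$ put $S_K:=\bigoplus_{x\in K}S_x$ (a subring of $S$ if $K$ is a subgroup). For a subset $I\subseteq S$ and $x\in G$ put $I^x:=S_{x^{-1}} I S_x$. For a subgroup $H$ of $G$, a subset $I\subseteq S$ is $H$-invariant if $I^x\subseteq I$ for every $x\in H$. If $N$ is a normal subgroup of $H$, a subset $I\subseteq S$ is $H/N$-invariant if $S_{x^{-1}N}\, I\, S_{xN}\subseteq I$ for every $x\in H$. $S$ is non-degenerately $G$-graded if for every $x\in G$ and every nonzero $s\in S_x$ we have $sS_{x^{-1}}\neq\{0\}$ and $S_{x^{-1}}s\neq\{0\}$. $S$ is nearly epsilon-strongly $G$-graded if for every $x\in G$ and every $s\in S_x$ there exist $\epsilon_x(s)\in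 S_xS_{x^{-1}}$ and $\epsilon_x'(s)\in S_{x^{-1}}S_x$ such that $\epsilon_x(s)s=s=s\epsilon_x'(s)$. *)

theory Defs
  imports "HOL-Algebra.Coset"
begin

text \<open>
  Rings are associative and not necessarily unital, i.e. types of class \<open>ring\<close>; subrings and
  ideals are subsets of such a type. The grading group is a group in the sense of HOL-Algebra,
  so that the library's subgroups, normal subgroups and cosets can be used.
\<close>

definition sum_mult :: "'a::ring set \<Rightarrow> 'a set \<Rightarrow> 'a set"  (infixl \<open>\<star>\<close> 70) where
  "U \<star> V = {\<Sum>i<n. u i * v i | (n::nat) u v. \<forall>i<n. u i \<in> U \<and> v i \<in> V}"

definition additive_subgroup_set :: "'a::ring set \<Rightarrow> bool" where
  "additive_subgroup_set U \<longleftrightarrow> 0 \<in> U \<and> (\<forall>a\<in>U. \<forall>b\<in>U. a + b \<in> U) \<and> (\<forall>a\<in>U. - a \<in> U)"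

text \<open>\<open>R\<close> is meant to be a subring of the ambient ring (the whole ring being \<open>UNIV\<close>).\<close>

definition ideal_of :: "'a::ring set \<Rightarrow> 'a set \<Rightarrow> bool" where
  "ideal_of R I \<longleftrightarrow> I \<subseteq> R \<and> additive_subgroup_set I \<and>
     (\<forall>r\<in>R. \<forall>a\<in>I. r * a \<in> I \<and> a * r \<in> I)"

definition prime_ideal_of :: "'a::ring set \<Rightarrow> 'a set \<Rightarrow> bool" where
  "prime_ideal_of R P \<longleftrightarrow> ideal_of R P \<and> P \<noteq> R \<and>
     (\<forall>A B. ideal_of R A \<longrightarrow> ideal_of R B \<longrightarrow> A \<star> B \<subseteq> P \<longrightarrow> A \<subseteq> P \<or> B \<subseteq> P)"

definition prime_ring :: "'a::ring set \<Rightarrow> bool" where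
  "prime_ring R \<longleftrightarrow> prime_ideal_of R {0}"

text \<open>
  Finitely supported families \<open>f\<close> with \<open>f x \<in> S x\<close> for \<open>x \<in> K\<close>, extended by zero outside \<open>K\<close>:
  the elements of the external direct sum of the \<open>S x\<close>, \<open>x \<in> K\<close>.
\<close>

definition fin_families :: "('g \<Rightarrow> 'a::ring set) \<Rightarrow> 'g set \<Rightarrow> ('g \<Rightarrow> 'a) set" where
  "fin_families S K = {f. finite {x. f x \<noteq> 0} \<and> {x. f x \<noteq> 0} \<subseteq> K \<and> (\<forall>x\<in>K. f x \<in> S x)}"

definition family_sum :: "('g \<Rightarrow> 'a::ring) \<Rightarrow> 'a" where
  "family_sum f = (\<Sum>x | f x \<noteq> 0. f x)"

definition component_sum :: "('g \<Rightarrow> 'a::ring set) \<Rightarrow> 'g set \<Rightarrow> 'a set" where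
  "component_sum S K = family_sum ` fin_families S K"

text \<open>
  Values of \<open>S\<close> outside \<open>carrier G\<close> are irrelevant. The last conjunct says that the ambient ring
  is the internal direct sum of the \<open>S x\<close>, \<open>x \<in> carrier G\<close>.
\<close>

definition graded_ring :: "('g, 'm) monoid_scheme \<Rightarrow> ('g \<Rightarrow> 'a::ring set) \<Rightarrow> bool" where
  "graded_ring G S \<longleftrightarrow>
     (\<forall>x\<in>carrier G. additive_subgroup_set (S x)) \<and>
     (\<forall>x\<in>carrier G. \<forall>y\<in>carrier G. S x \<star> S y \<subseteq> S (x \<otimes>\<^bsub>G\<^esub> y)) \<and>
     (\<forall>s. \<exists>!f. f \<in> fin_families S (carrier G) \<and> family_sum f = s)"

definition nondegenerately_graded :: "('g, 'm) monoid_scheme \<Rightarrow> ('g \<Rightarrow> 'a::ring set) \<Rightarrow> bool" where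
  "nondegenerately_graded G S \<longleftrightarrow>
     (\<forall>x\<in>carrier G. \<forall>s\<in>S x. s \<noteq> 0 \<longrightarrow>
        {s} \<star> S (inv\<^bsub>G\<^esub> x) \<noteq> {0} \<and> S (inv\<^bsub>G\<^esub> x) \<star> {s} \<noteq> {0})"

definition nearly_epsilon_strongly_graded ::
    "('g, 'm) monoid_scheme \<Rightarrow> ('g \<Rightarrow> 'a::ring set) \<Rightarrow> bool" where
  "nearly_epsilon_strongly_graded G S \<longleftrightarrow>
     (\<forall>x\<in>carrier G. \<forall>s\<in>S x.
        \<exists>\<epsilon> \<in> S x \<star> S (inv\<^bsub>G\<^esub> x). \<exists>\<epsilon>' \<in> S (inv\<^bsub>G\<^esub> x) \<star> S x. \<epsilon> * s = s \<and> s = s * \<epsilon>')"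

definition conj_set ::
    "('g, 'm) monoid_scheme \<Rightarrow> ('g \<Rightarrow> 'a::ring set) \<Rightarrow> 'a set \<Rightarrow> 'g \<Rightarrow> 'a set" where
  "conj_set G S I x = S (inv\<^bsub>G\<^esub> x) \<star> I \<star> S x"

definition subgroup_invariant ::
    "('g, 'm) monoid_scheme \<Rightarrow> ('g \<Rightarrow> 'a::ring set) \<Rightarrow> 'g set \<Rightarrow> 'a set \<Rightarrow> bool" where
  "subgroup_invariant G S H I \<longleftrightarrow> (\<forall>x\<in>H. conj_set G S I x \<subseteq> I)"

definition quotient_invariant ::
    "('g, 'm) monoid_scheme \<Rightarrow> ('g \<Rightarrow> 'a::ring set) \<Rightarrow> 'g set \<Rightarrow> 'g set \<Rightarrow> 'a set \<Rightarrow> bool" where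
  "quotient_invariant G S H N I \<longleftrightarrow>
     (\<forall>x\<in>H. component_sum S (inv\<^bsub>G\<^esub> x <#\<^bsub>G\<^esub> N) \<star> I \<star> component_sum S (x <#\<^bsub>G\<^esub> N) \<subseteq> I)"

text \<open>\<open>N\<close> is a normal subgroup of the subgroup \<open>H\<close> of \<open>G\<close>; it need not be normal in \<open>G\<close>.\<close>

definition normal_pair :: "('g, 'm) monoid_scheme \<Rightarrow> 'g set \<Rightarrow> 'g set \<Rightarrow> bool" where
  "normal_pair G N H \<longleftrightarrow> subgroup H G \<and> N \<lhd> (G\<lparr>carrier := H\<rparr>)"

definition admissible_ideal ::
    "('g, 'm) monoid_scheme \<Rightarrow> ('g \<Rightarrow> 'a::ring set) \<Rightarrow> 'g set \<Rightarrow> 'a set \<Rightarrow> bool" where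
  "admissible_ideal G S H I \<longleftrightarrow>
     ideal_of (S \<one>\<^bsub>G\<^esub>) I \<and> subgroup_invariant G S H I \<and>
     (\<forall>x\<in>carrier G - H. conj_set G S I x \<star> I = {0})"

definition nonzero_ideal_within ::
    "('g \<Rightarrow> 'a::ring set) \<Rightarrow> 'g set \<Rightarrow> 'a set \<Rightarrow> 'a set \<Rightarrow> bool" where
  "nonzero_ideal_within S N I A \<longleftrightarrow>
     ideal_of (component_sum S N) A \<and> A \<noteq> {0} \<and> A \<subseteq> I \<star> component_sum S N"

definition assertion_a :: "('g, 'm) monoid_scheme \<Rightarrow> ('g \<Rightarrow> 'a::ring set) \<Rightarrow> bool" where
  "assertion_a G S \<longleftrightarrow> \<not> prime_ring (UNIV :: 'a set)"

definition assertion_b :: "('g, 'm) monoid_scheme \<Rightarrow> ('g \<Rightarrow> 'a::ring set) \<Rightarrow> bool" where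
  "assertion_b G S \<longleftrightarrow> (\<exists>N H I A B.
     normal_pair G N H \<and> admissible_ideal G S H I \<and>
     nonzero_ideal_within S N I A \<and> nonzero_ideal_within S N I B \<and>
     A \<star> component_sum S H \<star> B = {0})"

definition assertion_c :: "('g, 'm) monoid_scheme \<Rightarrow> ('g \<Rightarrow> 'a::ring set) \<Rightarrow> bool" where
  "assertion_c G S \<longleftrightarrow> (\<exists>N H I A B.
     normal_pair G N H \<and> finite N \<and> admissible_ideal G S H I \<and>
     nonzero_ideal_within S N I A \<and> nonzero_ideal_within S N I B \<and>
     A \<star> component_sum S H \<star> B = {0})"

definition assertion_d :: "('g, 'm) monoid_scheme \<Rightarrow> ('g \<Rightarrow> 'a::ring set) \<Rightarrow> bool" where
  "assertion_d G S \<longleftrightarrow> (\<exists>N H I A B.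
     normal_pair G N H \<and> finite N \<and> admissible_ideal G S H I \<and>
     nonzero_ideal_within S N I A \<and> nonzero_ideal_within S N I B \<and>
     subgroup_invariant G S H A \<and> subgroup_invariant G S H B \<and>
     A \<star> component_sum S H \<star> B = {0})"

definition assertion_e :: "('g, 'm) monoid_scheme \<Rightarrow> ('g \<Rightarrow> 'a::ring set) \<Rightarrow> bool" where
  "assertion_e G S \<longleftrightarrow> (\<exists>N H I A B.
     normal_pair G N H \<and> finite N \<and> admissible_ideal G S H I \<and>
     nonzero_ideal_within S N I A \<and> nonzero_ideal_within S N I B \<and>
     quotient_invariant G S H N A \<and> quotient_invariant G S H N B \<and>
     A \<star> B = {0})"

end

theory Submission
  imports Defs
begin

text \<open>
  Non-primeness descends from \<open>S\<close> to a finite normal subgroup by a \<open>\<Delta>\<close>-method in the style of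
  Passman. Let \<open>A B = 0\<close> with nonzero ideals \<open>A\<close>, \<open>B\<close>, and write \<open>\<Delta>\<close> for the elements of \<open>H\<close> with
  finitely many \<open>H\<close>-conjugates. A pair \<open>a\<close>, \<open>b\<close> of nonzero elements supported in \<open>\<Delta>\<close> with
  \<open>a S\<^sub>H b = 0\<close> yields assertion (e): since \<open>\<Delta>\<close> modulo its torsion subgroup \<open>T\<close> is torsion-free
  abelian, unique products and minimality of the number of \<open>T\<close>-cosets in the supports move \<open>a\<close> and
  \<open>b\<close> into \<open>S\<^sub>T\<close>, and finitely many elements of \<open>T\<close> generate a finite normal subgroup of \<open>H\<close>.

  If no such pair exists, take \<open>\<alpha> \<in> A\<close> whose support meets \<open>\<Delta>\<close>, with as few elements as possible
  outside \<open>\<Delta>\<close>, over all admissible \<open>(H, I)\<close>. Comparing degrees in \<open>\<alpha> s \<beta> = 0\<close> for \<open>\<beta> \<in> B\<close> and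
  \<open>s \<in> S\<^sub>y\<close> shows that the \<open>\<Delta>\<close>-parts annihilate each other unless \<open>y\<close> conjugates a support element
  of \<open>\<alpha>\<close> outside \<open>\<Delta>\<close> into a fixed finite set. Hence some nonzero ideal \<open>J\<close> of \<open>S\<^sub>e\<close> satisfies
  \<open>J S\<^sub>y J = 0\<close> for all \<open>y\<close> outside finitely many cosets of centralisers; after shrinking \<open>J\<close>, these
  \<open>y\<close> include all elements outside a subgroup \<open>L\<close> for which one of the excluded support elements
  has finitely many conjugates, so \<open>J \<alpha> J\<close> contradicts the minimality of \<open>\<alpha>\<close>.
\<close>

section \<open>Groups with finite conjugacy classes\<close>

text \<open>The components \<open>S x\<close> need contain no units, so a translation by a
  homogeneous factor may kill components, and each product has to be kept nonzero by an argument.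
  Two facts replace units. An element \<open>p\<close> of \<open>S x\<close> equals \<epsilon> p
  with \<epsilon> in \<open>S x \<star> S (inv x)\<close>, which lets factors be cancelled. And the
  failure of (e) itself gives \<open>a S\<^sub>h b \<noteq> 0\<close> for some h in H, for all
  nonzero a, b in \<open>I S\<^sub>H\<close> supported in \<Delta>. That the \<Delta>-parts
  annihilate each other in generic degrees y is no contradiction yet, since these y do not run over
  a group. It must become a statement about one ideal of \<open>S\<^sub>e\<close>, and the many
  coefficients of the \<Delta>-part stand in the way. So \<alpha> is replaced by an element
  \<gamma>, obtained from it by translations and commutators, whose \<Delta>-part is as short as
  possible; there one coefficient controls the others. These operations may enlarge the support
  outside \<Delta>, so \<gamma> itself cannot contradict minimality: its origin in \<alpha> is
  recorded, and the final sandwiching is applied to \<alpha>.\<close>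

lemma card_image_factor:
  assumes fin: "finite A" and fac: "\<And>x y. x \<in> A \<Longrightarrow> y \<in> A \<Longrightarrow> g x = g y \<Longrightarrow> f x = f y"
  shows "card (f ` A) \<le> card (g ` A)"
proof -
  have "f x = f (SOME y. y \<in> A \<and> g y = g x)" if x: "x \<in> A" for x
  proof -
    have "(SOME y. y \<in> A \<and> g y = g x) \<in> A \<and> g (SOME y. y \<in> A \<and> g y = g x) = g x"
      by (rule someI[of _ x]) (use x in simp)
    then show ?thesis by (intro fac x) simp_all
  qed
  then have "f ` A = (\<lambda>c. f (SOME y. y \<in> A \<and> g y = c)) ` (g ` A)"
    unfolding image_image by (rule image_cong[OF refl])
  then show ?thesis
    using card_image_le[OF finite_imageI[OF fin], of "\<lambda>c. f (SOME y. y \<in> A \<and> g y = c)" g] by argo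
qed

context group
begin

lemma inv_cancel_left:
  assumes "a \<in> carrier G" "z \<in> carrier G"
  shows "a \<otimes> (inv a \<otimes> z) = z" "inv a \<otimes> (a \<otimes> z) = z"
  using assms by (simp_all add: m_assoc[symmetric])

definition conj_by :: "'a \<Rightarrow> 'a \<Rightarrow> 'a" where
  "conj_by h x = inv h \<otimes> x \<otimes> h"

lemma conj_by_closed [simp, intro]:
  "x \<in> carrier G \<Longrightarrow> h \<in> carrier G \<Longrightarrow> conj_by h x \<in> carrier G"
  by (simp add: conj_by_def)

lemma conj_by_one [simp]: "x \<in> carrier G \<Longrightarrow> conj_by \<one> x = x"
  by (simp add: conj_by_def)

lemma conj_by_of_one [simp]: "h \<in> carrier G \<Longrightarrow> conj_by h \<one> = \<one>"
  by (simp add: conj_by_def)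

lemma conj_by_conj_by:
  assumes "x \<in> carrier G" "h \<in> carrier G" "k \<in> carrier G"
  shows "conj_by k (conj_by h x) = conj_by (h \<otimes> k) x"
  using assms by (simp add: conj_by_def inv_mult_group m_assoc)

lemma conj_by_mult:
  assumes "x \<in> carrier G" "y \<in> carrier G" "h \<in> carrier G"
  shows "conj_by h (x \<otimes> y) = conj_by h x \<otimes> conj_by h y"
proof -
  have "h \<otimes> (inv h \<otimes> z) = z" if "z \<in> carrier G" for z
    using that assms by (metis inv_closed m_assoc r_inv l_one)
  then show ?thesis
    using assms by (simp add: conj_by_def m_assoc)
qed

lemma conj_by_inv:
  assumes "x \<in> carrier G" "h \<in> carrier G"
  shows "conj_by h (inv x) = inv (conj_by h x)"
  using assms by (simp add: conj_by_def inv_mult_group m_assoc)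

lemma conj_by_pow:
  assumes "x \<in> carrier G" "h \<in> carrier G"
  shows "conj_by h (x [^] (n::nat)) = conj_by h x [^] n"
  using assms by (induction n) (simp_all add: conj_by_mult)

lemma conj_by_eq_iff:
  assumes "x \<in> carrier G" "y \<in> carrier G" "h \<in> carrier G"
  shows "conj_by h x = y \<longleftrightarrow> x = conj_by (inv h) y"
proof -
  have "conj_by (inv h) (conj_by h x) = x" "conj_by h (conj_by (inv h) y) = y"
    using assms by (simp_all add: conj_by_conj_by)
  then show ?thesis by metis
qed

lemma conj_by_fixed_iff:
  assumes "x \<in> carrier G" "h \<in> carrier G"
  shows "conj_by h x = x \<longleftrightarrow> x \<otimes> h = h \<otimes> x"
  using assms by (metis conj_by_def inv_solve_left m_assoc inv_closed m_closed)

section \<open>Elements with finitely many conjugates under a subgroup\<close>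

text \<open>The elements range over the whole group, not only over \<open>L\<close>: in the descent
  \<open>L\<close> shrinks while elements of larger subgroups are still tested against it, and the
  set can then only grow.\<close>

definition finite_conj :: "'a set \<Rightarrow> 'a set" where
  "finite_conj L = {x \<in> carrier G. finite ((\<lambda>h. conj_by h x) ` L)}"

lemma finite_conj_carrier: "x \<in> finite_conj L \<Longrightarrow> x \<in> carrier G"
  by (simp add: finite_conj_def)

lemma finite_conj_antimono: "L \<subseteq> H \<Longrightarrow> finite_conj H \<subseteq> finite_conj L"
  unfolding finite_conj_def by (auto intro: finite_subset[OF image_mono])

lemma finite_conj_subgroup:
  assumes L: "L \<subseteq> carrier G"
  shows "subgroup (finite_conj L) G"
proof
  show "finite_conj L \<subseteq> carrier G" by (auto simp: finite_conj_def)
  fix x y assume x: "x \<in> finite_conj L" and y: "y \<in> finite_conj L"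
  have "(\<lambda>h. conj_by h (x \<otimes> y)) ` L
      \<subseteq> (\<lambda>(u, v). u \<otimes> v) ` ((\<lambda>h. conj_by h x) ` L \<times> (\<lambda>h. conj_by h y) ` L)"
    using x y L by (fastforce simp: finite_conj_def conj_by_mult)
  moreover have "finite ((\<lambda>h. conj_by h x) ` L \<times> (\<lambda>h. conj_by h y) ` L)"
    using x y by (simp add: finite_conj_def)
  ultimately show "x \<otimes> y \<in> finite_conj L"
    using x y unfolding finite_conj_def by (blast intro: finite_subset m_closed)
next
  have "(\<lambda>h. conj_by h \<one>) ` L \<subseteq> {\<one>}" using L by auto
  then show "\<one> \<in> finite_conj L"
    by (simp add: finite_conj_def finite_subset)
next
  fix x assume x: "x \<in> finite_conj L"
  have "(\<lambda>h. conj_by h (inv x)) ` L = (\<lambda>u. inv u) ` (\<lambda>h. conj_by h x) ` L"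
    using x L by (force simp: finite_conj_def conj_by_inv image_image intro!: image_cong)
  then show "inv x \<in> finite_conj L"
    using x by (simp add: finite_conj_def)
qed

lemma finite_conj_conj_by:
  assumes H: "subgroup H G" and x: "x \<in> finite_conj H" and h: "h \<in> H"
  shows "conj_by h x \<in> finite_conj H"
proof -
  have xc: "x \<in> carrier G" and hc: "h \<in> carrier G"
    using x h H by (auto simp: finite_conj_def subgroup.mem_carrier)
  have "(\<lambda>k. conj_by k (conj_by h x)) ` H \<subseteq> (\<lambda>k. conj_by k x) ` H"
  proof
    fix z assume "z \<in> (\<lambda>k. conj_by k (conj_by h x)) ` H"
    then obtain k where k: "k \<in> H" "z = conj_by k (conj_by h x)" by auto
    then have "z = conj_by (h \<otimes> k) x"
      using xc hc H by (simp add: conj_by_conj_by subgroup.mem_carrier)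
    moreover have "h \<otimes> k \<in> H" using H h k by (simp add: subgroup.m_closed)
    ultimately show "z \<in> (\<lambda>k. conj_by k x) ` H" by auto
  qed
  then show ?thesis using x xc hc by (auto simp: finite_conj_def intro: finite_subset)
qed

text \<open>The powers of \<open>c\<close> move \<open>b\<close> inside a finite orbit, so two of
  them act alike on \<open>b\<close> and their quotient centralises it.\<close>

lemma finite_conj_commuting_power:
  assumes H: "subgroup H G" and b: "b \<in> finite_conj H" and c: "c \<in> H"
  obtains n :: nat where "n > 0" "c [^] n \<otimes> b = b \<otimes> c [^] n"
proof -
  have cc: "c \<in> carrier G" using H c by (rule subgroup.mem_carrier)
  have bc: "b \<in> carrier G" using b by (rule finite_conj_carrier)
  have pow: "c [^] (n::nat) \<in> H" for n
    using H c by (induction n) (auto simp: subgroup.one_closed subgroup.m_closed)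
  have "finite (range (\<lambda>n::nat. conj_by (c [^] n) b))"
    by (rule finite_subset[of _ "(\<lambda>h. conj_by h b) ` H"])
      (use b pow in \<open>auto simp: finite_conj_def\<close>)
  then have "\<not> inj (\<lambda>n::nat. conj_by (c [^] n) b)"
    using finite_imageD infinite_UNIV_nat by blast
  then obtain i j :: nat where ij: "i < j" "conj_by (c [^] i) b = conj_by (c [^] j) b"
    unfolding inj_def by (metis linorder_neqE_nat)
  have "conj_by (c [^] j) b = conj_by (c [^] i) (conj_by (c [^] (j - i)) b)"
    using ij(1) cc bc by (simp add: conj_by_conj_by nat_pow_mult)
  then have "conj_by (c [^] (j - i)) b = b"
    using ij(2) cc bc by (metis conj_by_closed conj_by_eq_iff nat_pow_closed)
  then have "b \<otimes> c [^] (j - i) = c [^] (j - i) \<otimes> b"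
    using cc bc by (simp add: conj_by_fixed_iff)
  then show ?thesis using ij(1) that[of "j - i"] by simp
qed

section \<open>Dietzmann's lemma and the torsion subgroup\<close>

text \<open>Words are taken without inverses: a finite set of values of such words is already a
  subgroup, because inverses are then powers.\<close>

primrec list_prod :: "'a list \<Rightarrow> 'a" where
  "list_prod [] = \<one>"
| "list_prod (x # xs) = x \<otimes> list_prod xs"

lemma list_prod_closed [simp]: "set xs \<subseteq> carrier G \<Longrightarrow> list_prod xs \<in> carrier G"
  by (induction xs) auto

lemma list_prod_append:
  "set xs \<subseteq> carrier G \<Longrightarrow> set ys \<subseteq> carrier G \<Longrightarrow>
    list_prod (xs @ ys) = list_prod xs \<otimes> list_prod ys"
  by (induction xs) (auto simp: m_assoc)

lemma list_prod_replicate: "x \<in> carrier G \<Longrightarrow> list_prod (replicate n x) = x [^] n"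
  by (induction n) (simp, metis list_prod.simps(2) nat_pow_Suc2 replicate_Suc)

text \<open>Moving \<open>x\<close> to the left past a letter replaces that letter by a conjugate,
  which is again in \<open>X\<close>, and keeps the number of letters. Only \<open>k\<close>
  occurrences are collected, so the remaining word may still contain \<open>x\<close>.\<close>

lemma list_prod_collect:
  assumes X: "X \<subseteq> carrier G" and cl: "\<And>x y. x \<in> X \<Longrightarrow> y \<in> X \<Longrightarrow> conj_by y x \<in> X"
    and x: "x \<in> X"
  shows "set xs \<subseteq> X \<Longrightarrow> k \<le> count_list xs x \<Longrightarrow>
    \<exists>ys. set ys \<subseteq> X \<and> length ys + k = length xs \<and> list_prod xs = x [^] k \<otimes> list_prod ys"
proof (induction xs arbitrary: k)
  case Nil
  then show ?case by simp
next
  case (Cons a xs)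
  have xc: "x \<in> carrier G" and ac: "a \<in> carrier G" using X x Cons.prems by auto
  show ?case
  proof (cases "k = 0")
    case True
    have "list_prod (a # xs) \<in> carrier G" using Cons.prems X by (intro list_prod_closed) auto
    then show ?thesis using True Cons.prems by (intro exI[of _ "a # xs"]) simp
  next
    case False
    show ?thesis
    proof (cases "a = x")
      case True
      then obtain k' where k': "k = Suc k'" "k' \<le> count_list xs x"
        using False Cons.prems by (cases k) auto
      obtain ys where ys: "set ys \<subseteq> X" "length ys + k' = length xs"
        "list_prod xs = x [^] k' \<otimes> list_prod ys"
        using Cons.IH[OF _ k'(2)] Cons.prems by auto
      have "list_prod ys \<in> carrier G" using ys X by (intro list_prod_closed) auto
      then have "list_prod (a # xs) = x [^] k \<otimes> list_prod ys"
        using ys k' True xc by (metis list_prod.simps(2) m_assoc nat_pow_Suc2 nat_pow_closed)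
      then show ?thesis using ys k' by (intro exI[of _ ys]) simp
    next
      case ne: False
      then have "k \<le> count_list xs x" using Cons.prems by simp
      then obtain ys where ys: "set ys \<subseteq> X" "length ys + k = length xs"
        "list_prod xs = x [^] k \<otimes> list_prod ys"
        using Cons.IH[of k] Cons.prems by auto
      have a': "conj_by (x [^] k) a \<in> X" for k :: nat
      proof (induction k)
        case 0
        then show ?case using Cons.prems ac by simp
      next
        case (Suc k)
        then show ?case using cl[OF Suc x] xc ac by (simp add: conj_by_conj_by)
      qed
      have "a \<otimes> x [^] k = x [^] k \<otimes> conj_by (x [^] k) a"
        unfolding conj_by_def using ac xc
        by (metis inv_closed m_assoc m_closed nat_pow_closed r_inv l_one)
      moreover have "list_prod ys \<in> carrier G" using ys X by (intro list_prod_closed) auto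
      ultimately have "list_prod (a # xs) = x [^] k \<otimes> list_prod (conj_by (x [^] k) a # ys)"
        using ys ac xc by (simp add: m_assoc[symmetric])
      then show ?thesis using ys a'[of k] by (intro exI[of _ "conj_by (x [^] k) a # ys"]) simp
    qed
  qed
qed

text \<open>In a word longer than the sum of all \<open>n x\<close>, some letter \<open>x\<close>
  occurs more than \<open>n x\<close> times. Collecting \<open>Suc (n x)\<close> copies and
  rewriting that power with at most \<open>n x\<close> letters shortens the word, so every value is
  attained by a word of bounded length.\<close>

lemma finite_list_prods:
  assumes fin: "finite X" and X: "X \<subseteq> carrier G"
    and cl: "\<And>x y. x \<in> X \<Longrightarrow> y \<in> X \<Longrightarrow> conj_by y x \<in> X"
    and short: "\<And>x. x \<in> X \<Longrightarrow> \<exists>ys. set ys \<subseteq> X \<and> length ys \<le> n x \<and> x [^] Suc (n x) = list_prod ys"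
  shows "finite (list_prod ` {xs. set xs \<subseteq> X})"
proof -
  define b where "b = sum n X"
  have "\<exists>ys. set ys \<subseteq> X \<and> length ys \<le> b \<and> list_prod ys = list_prod xs" if "set xs \<subseteq> X" for xs
    using that
  proof (induction "length xs" arbitrary: xs rule: less_induct)
    case less
    show ?case
    proof (cases "length xs \<le> b")
      case True
      then show ?thesis using less.prems by blast
    next
      case False
      have "sum (count_list xs) X = length xs"
      proof -
        have "sum (count_list xs) X = sum (count_list xs) (set xs)"
          using less.prems fin by (intro sum.mono_neutral_right) (auto simp: count_list_0_iff)
        then show ?thesis by (simp add: sum_count_set)
      qed
      then have "\<not> sum (count_list xs) X \<le> sum n X" using False by (simp add: b_def)
      then obtain x where x: "x \<in> X" "n x < count_list xs x"
        using sum_mono[of X "count_list xs" n] by (meson not_le)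
      then obtain ys where ys: "set ys \<subseteq> X" "length ys + Suc (n x) = length xs"
        "list_prod xs = x [^] Suc (n x) \<otimes> list_prod ys"
        using list_prod_collect[OF X cl x(1) less.prems, of "Suc (n x)"] by auto
      obtain zs where zs: "set zs \<subseteq> X" "length zs \<le> n x" "x [^] Suc (n x) = list_prod zs"
        using short[OF x(1)] by blast
      have "list_prod (zs @ ys) = list_prod xs"
        using ys zs X by (subst list_prod_append) auto
      moreover have "length (zs @ ys) < length xs" using ys(2) zs(2) by simp
      ultimately show ?thesis using less.hyps[of "zs @ ys"] ys(1) zs(1) by auto
    qed
  qed
  then have "list_prod ` {xs. set xs \<subseteq> X} \<subseteq> list_prod ` {xs. set xs \<subseteq> X \<and> length xs \<le> b}"
    by (smt (verit) image_iff mem_Collect_eq subsetI)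
  then show ?thesis
    using finite_lists_length_le[OF fin, of b] by (blast intro: finite_subset)
qed

lemma finite_submonoid_torsion:
  assumes fin: "finite M" and M: "M \<subseteq> carrier G" and x: "x \<in> carrier G"
    and pow: "\<And>k::nat. x [^] k \<in> M"
  obtains k :: nat where "k > 0" "x [^] k = \<one>"
proof -
  have "finite (range (\<lambda>k::nat. x [^] k))"
    by (rule finite_subset[OF _ fin]) (use pow in auto)
  then have "\<not> inj (\<lambda>k::nat. x [^] k)"
    using finite_imageD infinite_UNIV_nat by blast
  then obtain i j :: nat where ij: "i < j" "x [^] i = x [^] j"
    unfolding inj_def by (metis linorder_neqE_nat)
  have "x [^] i \<otimes> x [^] (j - i) = x [^] j"
    using ij(1) x by (simp add: nat_pow_mult)
  then have "x [^] i \<otimes> x [^] (j - i) = x [^] i" using ij(2) by simp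
  then have "x [^] (j - i) = \<one>" using x by (simp add: r_cancel_one)
  then show ?thesis using that[of "j - i"] ij(1) by simp
qed

lemma list_prods_subgroup:
  assumes fin: "finite (list_prod ` {xs. set xs \<subseteq> X})" and X: "X \<subseteq> carrier G"
  shows "subgroup (list_prod ` {xs. set xs \<subseteq> X}) G" (is "subgroup ?M G")
proof -
  have M: "?M \<subseteq> carrier G" using X by auto
  have cl: "x \<otimes> y \<in> ?M" if xy: "x \<in> ?M" "y \<in> ?M" for x y
  proof -
    obtain xs ys where "set xs \<subseteq> X" "x = list_prod xs" "set ys \<subseteq> X" "y = list_prod ys"
      using xy by auto
    then show ?thesis using X by (intro image_eqI[of _ _ "xs @ ys"]) (auto simp: list_prod_append)
  qed
  have one: "\<one> \<in> ?M" by (intro image_eqI[of _ _ "[]"]) auto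
  have inv: "inv x \<in> ?M" if x: "x \<in> ?M" for x
  proof -
    have xc: "x \<in> carrier G" using x M by blast
    have pow: "x [^] (k::nat) \<in> ?M" for k
      by (induction k) (use one cl x in auto)
    obtain k :: nat where k: "k > 0" "x [^] k = \<one>"
      using finite_submonoid_torsion[OF fin M xc pow] .
    then have "x [^] (k - 1) \<otimes> x = \<one>" by (metis Suc_diff_1 nat_pow_Suc)
    then have "inv x = x [^] (k - 1)" using xc by (simp add: inv_equality)
    then show ?thesis using pow by simp
  qed
  show ?thesis by unfold_locales (use M cl one inv in auto)
qed

text \<open>Dietzmann's lemma assumes letters of finite order, that is, a power of each letter
  equals the empty word. Allowing any shorter word in place of the empty one makes it applicable to
  commutators whose finite order is what has to be shown.\<close>

lemma dietzmann:
  assumes H: "subgroup H G" and fin: "finite X" and X: "X \<subseteq> H"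
    and cl: "\<And>x h. x \<in> X \<Longrightarrow> h \<in> H \<Longrightarrow> conj_by h x \<in> X"
    and short: "\<And>x. x \<in> X \<Longrightarrow> \<exists>n ys. set ys \<subseteq> X \<and> length ys \<le> n \<and> x [^] Suc n = list_prod ys"
  obtains N where "finite N" "subgroup N G" "X \<subseteq> N" "N \<subseteq> H"
    "\<And>x h. x \<in> N \<Longrightarrow> h \<in> H \<Longrightarrow> conj_by h x \<in> N"
proof -
  let ?M = "list_prod ` {xs. set xs \<subseteq> X}"
  have Hc: "H \<subseteq> carrier G" using H by (rule subgroup.subset)
  have "\<forall>x\<in>X. \<exists>n ys. set ys \<subseteq> X \<and> length ys \<le> n \<and> x [^] Suc n = list_prod ys"
    using short by blast
  from bchoice[OF this] obtain n where n: "\<And>x. x \<in> X \<Longrightarrow>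
      \<exists>ys. set ys \<subseteq> X \<and> length ys \<le> n x \<and> x [^] Suc (n x) = list_prod ys"
    by blast
  have Xc: "X \<subseteq> carrier G" using X Hc by simp
  have finM: "finite ?M"
    using finite_list_prods[OF fin Xc _ n] cl X by blast
  have "X \<subseteq> ?M"
  proof
    fix x assume "x \<in> X"
    then show "x \<in> ?M" using Xc by (intro image_eqI[of _ _ "[x]"]) auto
  qed
  moreover have "?M \<subseteq> H"
  proof -
    have "list_prod xs \<in> H" if "set xs \<subseteq> X" for xs
      using that X H by (induction xs) (auto simp: subgroup.one_closed subgroup.m_closed)
    then show ?thesis by auto
  qed
  moreover have "conj_by h x \<in> ?M" if x: "x \<in> ?M" and h: "h \<in> H" for x h
  proof -
    have "\<exists>ys. set ys \<subseteq> X \<and> conj_by h (list_prod xs) = list_prod ys" if "set xs \<subseteq> X" for xs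
      using that
    proof (induction xs)
      case Nil
      then show ?case using h Hc by (intro exI[of _ "[]"]) auto
    next
      case (Cons a xs)
      then obtain ys where "set ys \<subseteq> X" "conj_by h (list_prod xs) = list_prod ys" by auto
      moreover have "conj_by h (list_prod (a # xs)) = conj_by h a \<otimes> conj_by h (list_prod xs)"
      proof -
        have "a \<in> carrier G" "list_prod xs \<in> carrier G" "h \<in> carrier G"
          using Cons.prems Xc h Hc by auto
        then show ?thesis by (simp add: conj_by_mult)
      qed
      ultimately show ?case
        using cl[of a h] Cons.prems h by (intro exI[of _ "conj_by h a # ys"]) auto
    qed
    then show ?thesis using x by (elim imageE) blast
  qed
  ultimately show ?thesis
    using that[OF finM list_prods_subgroup[OF finM Xc]] by blast
qed

definition torsion_in :: "'a set \<Rightarrow> 'a set" where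
  "torsion_in K = {x \<in> K. \<exists>n::nat. n > 0 \<and> x [^] n = \<one>}"

text \<open>The \<open>H\<close>-conjugates of \<open>Y\<close> form a finite invariant set of
  torsion elements, and a letter of finite order meets the shortening condition with the empty
  word.\<close>

lemma finite_normal_closure:
  assumes H: "subgroup H G" and fin: "finite Y" and Y: "Y \<subseteq> torsion_in (finite_conj H \<inter> H)"
  obtains N where "finite N" "subgroup N G" "Y \<subseteq> N" "N \<subseteq> H"
    "\<And>x h. x \<in> N \<Longrightarrow> h \<in> H \<Longrightarrow> conj_by h x \<in> N"
proof -
  have Hc: "H \<subseteq> carrier G" using H by (rule subgroup.subset)
  define X where "X = (\<Union>y\<in>Y. (\<lambda>h. conj_by h y) ` H)"
  have Yc: "Y \<subseteq> carrier G" using Y by (auto simp: torsion_in_def finite_conj_def)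
  have "finite X" unfolding X_def using fin Y by (auto simp: torsion_in_def finite_conj_def)
  moreover have "X \<subseteq> H"
    unfolding X_def using Y H by (auto simp: torsion_in_def conj_by_def intro!: subgroup.m_closed subgroup.m_inv_closed)
  moreover have "conj_by h x \<in> X" if "x \<in> X" "h \<in> H" for x h
  proof -
    obtain y k where yk: "y \<in> Y" "k \<in> H" "x = conj_by k y" using \<open>x \<in> X\<close> by (auto simp: X_def)
    then have "conj_by h x = conj_by (k \<otimes> h) y"
      using Yc Hc that by (subst yk(3), subst conj_by_conj_by) auto
    then show ?thesis using yk that H unfolding X_def by (auto intro!: subgroup.m_closed)
  qed
  moreover have "\<exists>n ys. set ys \<subseteq> X \<and> length ys \<le> n \<and> x [^] Suc n = list_prod ys" if "x \<in> X" for x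
  proof -
    obtain y k where yk: "y \<in> Y" "k \<in> H" "x = conj_by k y" using \<open>x \<in> X\<close> by (auto simp: X_def)
    obtain n :: nat where n: "n > 0" "y [^] n = \<one>" using yk(1) Y by (auto simp: torsion_in_def)
    have "x [^] n = \<one>"
      using yk n Yc Hc by (metis conj_by_of_one conj_by_pow subsetD)
    then have "x [^] Suc (n - 1) = \<one>" using n(1) by simp
    then show ?thesis by (intro exI[of _ "n - 1"] exI[of _ "[]"]) simp
  qed
  ultimately obtain N where N: "finite N" "subgroup N G" "X \<subseteq> N" "N \<subseteq> H"
    "\<And>x h. x \<in> N \<Longrightarrow> h \<in> H \<Longrightarrow> conj_by h x \<in> N"
    using dietzmann[OF H, of X] by metis
  moreover have "Y \<subseteq> X"
  proof
    fix y assume "y \<in> Y"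
    then show "y \<in> X" unfolding X_def using Yc H
      by (auto intro!: bexI[of _ y] image_eqI[of _ _ \<one>] subgroup.one_closed)
  qed
  ultimately show ?thesis using that by blast
qed

lemma finite_subgroup_torsion:
  assumes "finite N" "subgroup N G" "x \<in> N"
  obtains k :: nat where "k > 0" "x [^] k = \<one>"
proof (rule finite_submonoid_torsion[OF assms(1)])
  show "N \<subseteq> carrier G" "x \<in> carrier G" using assms by (auto dest: subgroup.subset)
  show "x [^] k \<in> N" for k :: nat
    using assms by (induction k) (auto simp: subgroup.one_closed subgroup.m_closed)
qed

text \<open>Torsion elements of a group need not be closed under products; here any two of them lie
  in a common finite subgroup.\<close>

lemma torsion_subgroup:
  assumes H: "subgroup H G"
  shows "subgroup (torsion_in (finite_conj H \<inter> H)) G" (is "subgroup ?T G")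
proof -
  have Hc: "H \<subseteq> carrier G" using H by (rule subgroup.subset)
  have D: "subgroup (finite_conj H \<inter> H) G"
    using finite_conj_subgroup[OF Hc] H by (rule subgroups_Inter_pair)
  show ?thesis
  proof
    show "?T \<subseteq> carrier G" by (auto simp: torsion_in_def finite_conj_def)
    show "\<one> \<in> ?T"
      using subgroup.one_closed[OF D] unfolding torsion_in_def by (auto intro!: exI[of _ 1])
  next
    fix x y assume xy: "x \<in> ?T" "y \<in> ?T"
    then obtain N where N: "finite N" "subgroup N G" "{x, y} \<subseteq> N"
      using finite_normal_closure[OF H, of "{x, y}"] by (metis empty_subsetI finite.simps insert_subset)
    then have "x \<otimes> y \<in> N" by (auto intro: subgroup.m_closed)
    then obtain k :: nat where "k > 0" "(x \<otimes> y) [^] k = \<one>"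
      using finite_subgroup_torsion[OF N(1,2)] by blast
    moreover have "x \<otimes> y \<in> finite_conj H \<inter> H"
      using xy D unfolding torsion_in_def by (auto dest: subgroup.m_closed)
    ultimately show "x \<otimes> y \<in> ?T" by (auto simp: torsion_in_def)
  next
    fix x assume x: "x \<in> ?T"
    then obtain n :: nat where n: "n > 0" "x [^] n = \<one>" by (auto simp: torsion_in_def)
    have xc: "x \<in> carrier G" using x by (auto simp: torsion_in_def finite_conj_def)
    have "inv x [^] n = \<one>" using n xc by (simp add: nat_pow_inv)
    moreover have "inv x \<in> finite_conj H \<inter> H"
      using x D unfolding torsion_in_def by (auto dest: subgroup.m_inv_closed)
    ultimately show "inv x \<in> ?T" using n by (auto simp: torsion_in_def)
  qed
qed

lemma torsion_conj_by:
  assumes H: "subgroup H G" and x: "x \<in> torsion_in (finite_conj H \<inter> H)" and h: "h \<in> H"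
  shows "conj_by h x \<in> torsion_in (finite_conj H \<inter> H)"
proof -
  have xc: "x \<in> carrier G" using x by (auto simp: torsion_in_def finite_conj_def)
  have hc: "h \<in> carrier G" using H h by (rule subgroup.mem_carrier)
  obtain n :: nat where n: "n > 0" "x [^] n = \<one>" using x by (auto simp: torsion_in_def)
  then have "conj_by h x [^] n = \<one>" using xc hc by (metis conj_by_of_one conj_by_pow)
  moreover have "conj_by h x \<in> finite_conj H"
    using x h by (intro finite_conj_conj_by[OF H]) (auto simp: torsion_in_def)
  moreover have "conj_by h x \<in> H"
    using x h H by (auto simp: torsion_in_def conj_by_def intro!: subgroup.m_closed subgroup.m_inv_closed)
  ultimately show ?thesis using n by (auto simp: torsion_in_def)
qed

text \<open>The commutators of conjugates of \<open>a\<close> with elements of \<open>?D\<close>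
  form a finite set, since such a commutator is a quotient of two conjugates of \<open>a\<close>.
  They generate a finite group because a power of each is a shorter product of others; this is the
  computation behind Schur's theorem that a group with centre of finite index has finite derived
  subgroup.\<close>

lemma commutator_torsion:
  assumes H: "subgroup H G" and a: "a \<in> finite_conj H \<inter> H" and b: "b \<in> finite_conj H \<inter> H"
  shows "inv a \<otimes> conj_by b a \<in> torsion_in (finite_conj H \<inter> H)"
proof -
  let ?D = "finite_conj H \<inter> H"
  have Hc: "H \<subseteq> carrier G" using H by (rule subgroup.subset)
  have D: "subgroup ?D G"
    using finite_conj_subgroup[OF Hc] H by (rule subgroups_Inter_pair)
  have Dc: "?D \<subseteq> carrier G" using Hc by auto
  have Dconj: "conj_by h x \<in> ?D" if "x \<in> ?D" "h \<in> H" for x h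
    using that H finite_conj_conj_by[OF H, of x h]
    by (auto simp: conj_by_def intro!: subgroup.m_closed subgroup.m_inv_closed)
  define X where "X = {inv a' \<otimes> conj_by b' a' | a' b'. a' \<in> (\<lambda>h. conj_by h a) ` H \<and> b' \<in> ?D}"
  have orb: "(\<lambda>h. conj_by h a) ` H \<subseteq> ?D" using a Dconj by auto
  have XD: "X \<subseteq> ?D"
  proof
    fix x assume "x \<in> X"
    then obtain a' b' where "a' \<in> ?D" "b' \<in> ?D" "x = inv a' \<otimes> conj_by b' a'"
      using orb unfolding X_def by (elim CollectE exE conjE) (rule that, auto)
    moreover then have "conj_by b' a' \<in> ?D" by (intro Dconj) auto
    ultimately show "x \<in> ?D" using D by (simp only: subgroup.m_closed subgroup.m_inv_closed)
  qed
  have "X \<subseteq> (\<lambda>(u, v). inv u \<otimes> v) ` ((\<lambda>h. conj_by h a) ` H \<times> (\<lambda>h. conj_by h a) ` H)"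
  proof
    fix x assume "x \<in> X"
    then obtain h b' where hb: "h \<in> H" "b' \<in> H" "x = inv (conj_by h a) \<otimes> conj_by b' (conj_by h a)"
      by (auto simp: X_def)
    moreover have "conj_by b' (conj_by h a) = conj_by (h \<otimes> b') a"
      using hb a Dc Hc by (intro conj_by_conj_by) auto
    moreover have "h \<otimes> b' \<in> H" using H hb by (simp add: subgroup.m_closed)
    ultimately show "x \<in> (\<lambda>(u, v). inv u \<otimes> v) ` ((\<lambda>h. conj_by h a) ` H \<times> (\<lambda>h. conj_by h a) ` H)"
      by (intro image_eqI[of _ _ "(conj_by h a, conj_by (h \<otimes> b') a)"]) auto
  qed
  moreover have "finite ((\<lambda>h. conj_by h a) ` H)" using a by (simp add: finite_conj_def)
  ultimately have finX: "finite X" by (meson finite_SigmaI finite_imageI finite_subset)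
  have cl: "conj_by h x \<in> X" if "x \<in> X" "h \<in> H" for x h
  proof -
    obtain k b' where kb: "k \<in> H" "b' \<in> ?D" "x = inv (conj_by k a) \<otimes> conj_by b' (conj_by k a)"
      using \<open>x \<in> X\<close> by (auto simp: X_def)
    have c: "a \<in> carrier G" "k \<in> carrier G" "b' \<in> carrier G" "h \<in> carrier G"
      using kb a that Hc Dc by auto
    have "b' \<otimes> h = h \<otimes> conj_by h b'"
      using c by (simp add: conj_by_def) (metis inv_closed m_assoc m_closed r_inv l_one)
    then have "conj_by h x = inv (conj_by (k \<otimes> h) a) \<otimes> conj_by (conj_by h b') (conj_by (k \<otimes> h) a)"
      using c kb(3) by (simp add: conj_by_mult conj_by_inv conj_by_conj_by m_assoc)
    moreover have "k \<otimes> h \<in> H" using H kb that by (simp add: subgroup.m_closed)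
    ultimately show ?thesis
      unfolding X_def using Dconj[OF kb(2) \<open>h \<in> H\<close>]
      by (intro CollectI exI[of _ "conj_by (k \<otimes> h) a"] exI[of _ "conj_by h b'"] conjI imageI)
  qed
  have short: "\<exists>n ys. set ys \<subseteq> X \<and> length ys \<le> n \<and> c [^] Suc n = list_prod ys" if cX: "c \<in> X" for c
  proof -
    obtain a' b' where ab: "a' \<in> (\<lambda>h. conj_by h a) ` H" "b' \<in> ?D" "c = inv a' \<otimes> conj_by b' a'"
      using cX by (auto simp: X_def)
    have ac: "a' \<in> carrier G" and bc: "b' \<in> carrier G" using ab orb Dc by auto
    have cc: "c \<in> carrier G" using ab ac bc by simp
    have bH: "b' \<in> H" using ab by simp
    obtain n :: nat where n: "n > 0" "c [^] n \<otimes> b' = b' \<otimes> c [^] n"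
      using finite_conj_commuting_power[OF H, of b' c] ab(2) cX XD by blast
    obtain m where m: "n = Suc m" using n(1) by (cases n) auto
    \<comment> \<open>The commutator of \<open>a'\<close> with the square of \<open>b'\<close>. It
      lies in \<open>X\<close> because the second argument there ranges over all of
      \<open>?D\<close> and not only over conjugates of \<open>b\<close>.\<close>
    define d where "d = inv a' \<otimes> conj_by (b' \<otimes> b') a'"
    have "b' \<otimes> b' \<in> ?D" using D ab(2) by (simp only: subgroup.m_closed)
    then have "d \<in> X"
      unfolding X_def d_def using ab(1) by (intro CollectI exI[of _ a'] exI[of _ "b' \<otimes> b'"] conjI refl)
    have dc: "d \<in> carrier G" using ac bc by (simp add: d_def)
    have binv: "b' \<otimes> (inv b' \<otimes> z) = z" "inv b' \<otimes> (b' \<otimes> z) = z"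
        "a' \<otimes> (inv a' \<otimes> z) = z" if "z \<in> carrier G" for z
      using that bc ac by (metis inv_closed m_assoc r_inv l_inv l_one)+
    txt \<open>\<open>c\<^sup>n\<^sup>+\<^sup>1 = [a', b'\<^sup>2] (b'\<^sup>-\<^sup>1 c b')\<^sup>n\<^sup>-\<^sup>1\<close> for \<open>c = [a', b']\<close>, because \<open>c\<^sup>n\<close> commutes with \<open>b'\<close>.\<close>
    have "c [^] Suc n = c \<otimes> c [^] n" using cc by (rule nat_pow_Suc2)
    also have "\<dots> = inv a' \<otimes> inv b' \<otimes> a' \<otimes> (b' \<otimes> c [^] n)"
      using ac bc cc ab(3) by (simp add: conj_by_def m_assoc)
    also have "\<dots> = inv a' \<otimes> inv b' \<otimes> a' \<otimes> (c \<otimes> c [^] m \<otimes> b')"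
      using n(2) cc m by (simp only: nat_pow_Suc2)
    also have "\<dots> = inv a' \<otimes> inv b' \<otimes> a' \<otimes> (inv a' \<otimes> (inv b' \<otimes> a' \<otimes> b') \<otimes> c [^] m \<otimes> b')"
      using ab(3) by (simp add: conj_by_def)
    also have "\<dots> = d \<otimes> conj_by b' (c [^] m)"
      using ac bc cc by (simp add: d_def conj_by_def m_assoc binv inv_mult_group)
    also have "\<dots> = list_prod (d # replicate m (conj_by b' c))"
      using bc cc by (simp add: list_prod_replicate conj_by_pow)
    finally have "c [^] Suc n = list_prod (d # replicate m (conj_by b' c))" .
    moreover have "set (d # replicate m (conj_by b' c)) \<subseteq> X"
      using \<open>d \<in> X\<close> cl[OF cX bH] by auto
    moreover have "length (d # replicate m (conj_by b' c)) \<le> n" using m by simp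
    ultimately show ?thesis by blast
  qed
  obtain N where N: "finite N" "subgroup N G" "X \<subseteq> N"
  proof (rule dietzmann[OF H finX])
    show "X \<subseteq> H" using XD by blast
  qed (use cl short in blast)+
  have "a \<in> (\<lambda>h. conj_by h a) ` H"
    using a Dc H by (auto intro!: image_eqI[of _ _ \<one>] simp: subgroup.one_closed)
  then have in_X: "inv a \<otimes> conj_by b a \<in> X"
    unfolding X_def using b by (intro CollectI exI[of _ a] exI[of _ b] conjI refl)
  then obtain k :: nat where "k > 0" "(inv a \<otimes> conj_by b a) [^] k = \<one>"
    using finite_subgroup_torsion[OF N(1,2)] N(3) by blast
  then show ?thesis using in_X XD unfolding torsion_in_def by blast
qed

section \<open>Cones in torsion-free abelian groups and unique products\<close>

text \<open>The elements above \<open>\<one>\<close> in a partial order compatible with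
  multiplication, when the group is abelian.\<close>

definition positive_cone :: "'a set \<Rightarrow> bool" where
  "positive_cone P \<longleftrightarrow> P \<subseteq> carrier G \<and> \<one> \<in> P \<and> (\<forall>x\<in>P. \<forall>y\<in>P. x \<otimes> y \<in> P) \<and>
    (\<forall>x\<in>P. inv x \<in> P \<longrightarrow> x = \<one>)"

lemma positive_coneD:
  assumes "positive_cone P"
  shows "P \<subseteq> carrier G" "\<one> \<in> P" "x \<in> P \<Longrightarrow> y \<in> P \<Longrightarrow> x \<otimes> y \<in> P"
    "x \<in> P \<Longrightarrow> inv x \<in> P \<Longrightarrow> x = \<one>"
  using assms by (simp_all add: positive_cone_def)

text \<open>A total order would call for Zorn's lemma, but comparing finitely many elements takes
  only finitely many extensions of the trivial cone. Adjoining \<open>q\<close> fails only if a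
  positive power of \<open>inv q\<close> is already in the cone, and adjoining \<open>inv q\<close>
  only if a positive power of \<open>q\<close> is. If both fail, some power of \<open>q\<close> and
  its inverse are in the cone, so \<open>q\<close> has finite order and is trivial; but then
  adjoining it changes nothing.\<close>

lemma exists_cone:
  assumes G: "comm_group G"
    and tf: "\<And>x n. x \<in> carrier G \<Longrightarrow> n > 0 \<Longrightarrow> x [^] (n::nat) = \<one> \<Longrightarrow> x = \<one>"
    and fin: "finite F" and F: "F \<subseteq> carrier G"
  shows "\<exists>P. positive_cone P \<and> (\<forall>x\<in>F. x \<in> P \<or> inv x \<in> P)"
  using fin F
proof (induction F)
  case empty
  show ?case by (intro exI[of _ "{\<one>}"]) (simp add: positive_cone_def)
next
  case (insert q F)
  interpret comm_group G by (rule G)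
  have q: "q \<in> carrier G" and F': "F \<subseteq> carrier G" using insert.prems by simp_all
  obtain P where P0: "positive_cone P" and P5: "\<forall>x\<in>F. x \<in> P \<or> inv x \<in> P"
    using insert.IH[OF F'] by blast
  note P = positive_coneD[OF P0]
  have Pc: "x \<in> carrier G" if "x \<in> P" for x using that P(1) by blast
  have powP: "x [^] (n::nat) \<in> P" if "x \<in> P" for x n
    by (induction n) (use that P(2,3) in auto)
  define ext where "ext r = {x \<otimes> r [^] (n::nat) | x n. x \<in> P}" for r
  have ext: "ext r \<subseteq> carrier G" "P \<subseteq> ext r" "r \<in> ext r"
    "\<And>x y. x \<in> ext r \<Longrightarrow> y \<in> ext r \<Longrightarrow> x \<otimes> y \<in> ext r" if r: "r \<in> carrier G" for r
  proof -
    show "ext r \<subseteq> carrier G" using Pc r by (auto simp: ext_def)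
    show "P \<subseteq> ext r"
    proof
      fix x assume "x \<in> P"
      then show "x \<in> ext r" unfolding ext_def using Pc by (intro CollectI exI[of _ x] exI[of _ 0]) simp
    qed
    show "r \<in> ext r" unfolding ext_def using P(2) r by (intro CollectI exI[of _ \<one>] exI[of _ 1]) simp
  next
    fix x y assume "x \<in> ext r" "y \<in> ext r"
    then obtain u v :: 'a and m n :: nat where uv: "u \<in> P" "v \<in> P"
      and xy: "x = u \<otimes> r [^] m" "y = v \<otimes> r [^] n" unfolding ext_def by blast
    have "x \<otimes> y = (u \<otimes> v) \<otimes> r [^] (m + n)"
      using Pc[OF uv(1)] Pc[OF uv(2)] r by (simp add: xy nat_pow_mult[symmetric] m_ac)
    then show "x \<otimes> y \<in> ext r" unfolding ext_def using P(3)[OF uv] by blast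
  qed
  have bad: "\<exists>m>0. inv r [^] (m::nat) \<in> P" if r: "r \<in> carrier G"
    and x: "x \<in> ext r" "inv x \<in> ext r" "x \<noteq> \<one>" for r x
  proof -
    obtain u v :: 'a and m n :: nat where uv: "u \<in> P" "v \<in> P"
      and xy: "x = u \<otimes> r [^] m" "inv x = v \<otimes> r [^] n" using x(1,2) unfolding ext_def by blast
    have c: "u \<in> carrier G" "v \<in> carrier G" using Pc uv by auto
    have "\<one> = x \<otimes> inv x" using xy(1) c r by simp
    also have "\<dots> = (u \<otimes> v) \<otimes> r [^] (m + n)"
      unfolding xy(2) unfolding xy(1) using c r by (simp add: nat_pow_mult[symmetric] m_ac)
    finally have one: "(u \<otimes> v) \<otimes> r [^] (m + n) = \<one>" by simp
    then have eq: "u \<otimes> v = inv r [^] (m + n)"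
      using c r by (simp add: inv_equality[symmetric] nat_pow_inv)
    have "m + n \<noteq> 0"
    proof
      assume "m + n = 0"
      then have "u \<otimes> v = \<one>" "x = u" using one c xy by auto
      then have "inv u = v" using c by (metis inv_equality m_comm)
      then show False using P(4)[OF uv(1)] uv(2) \<open>x = u\<close> x(3) by simp
    qed
    then show ?thesis using eq P(3)[OF uv] by (intro exI[of _ "m + n"]) simp
  qed
  have "\<exists>r. (r = q \<or> r = inv q) \<and> (\<forall>x\<in>ext r. inv x \<in> ext r \<longrightarrow> x = \<one>)"
  proof (rule ccontr)
    assume "\<not> ?thesis"
    then obtain x y where x: "x \<in> ext q" "inv x \<in> ext q" "x \<noteq> \<one>"
      and y: "y \<in> ext (inv q)" "inv y \<in> ext (inv q)" "y \<noteq> \<one>" by blast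
    obtain m n :: nat where m: "m > 0" "inv q [^] m \<in> P" and n: "n > 0" "q [^] n \<in> P"
      using bad[OF q x] bad[OF inv_closed[OF q] y] q by auto
    have "inv (q [^] (n * m)) = (inv q [^] m) [^] n"
      using q by (simp add: nat_pow_inv[symmetric] nat_pow_pow mult.commute)
    moreover have "q [^] (n * m) = (q [^] n) [^] m" using q by (simp add: nat_pow_pow)
    ultimately have "q [^] (n * m) = \<one>" using P(4)[of "q [^] (n * m)"] powP m n by metis
    then have "q = \<one>" using tf[OF q, of "n * m"] m(1) n(1) by simp
    then have "q \<in> P" using P(2) by simp
    then have "ext q \<subseteq> P" using P(3) powP unfolding ext_def by blast
    then show False using P(4)[of x] x by blast
  qed
  then obtain r where r: "r = q \<or> r = inv q" "\<And>x. x \<in> ext r \<Longrightarrow> inv x \<in> ext r \<Longrightarrow> x = \<one>" by blast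
  have rc: "r \<in> carrier G" using r(1) q by auto
  have "q \<in> ext r \<or> inv q \<in> ext r" using ext(3)[OF rc] r(1) q by auto
  then have "\<forall>x\<in>insert q F. x \<in> ext r \<or> inv x \<in> ext r" using P5 ext(2)[OF rc] by blast
  moreover have "positive_cone (ext r)"
    unfolding positive_cone_def using ext[OF rc] r(2) P(2) by blast
  ultimately show ?case by blast
qed

text \<open>With respect to a total order compatible with the group operation, the product of the
  largest elements of \<open>X\<close> and \<open>Y\<close> is attained only once.\<close>

lemma unique_product:
  assumes G: "comm_group G"
    and tf: "\<And>x n. x \<in> carrier G \<Longrightarrow> n > 0 \<Longrightarrow> x [^] (n::nat) = \<one> \<Longrightarrow> x = \<one>"
    and X: "finite X" "X \<noteq> {}" "X \<subseteq> carrier G" and Y: "finite Y" "Y \<noteq> {}" "Y \<subseteq> carrier G"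
  obtains x y where "x \<in> X" "y \<in> Y"
    "\<And>x' y'. x' \<in> X \<Longrightarrow> y' \<in> Y \<Longrightarrow> x' \<otimes> y' = x \<otimes> y \<Longrightarrow> x' = x \<and> y' = y"
proof -
  interpret comm_group G by (rule G)
  \<comment> \<open>The argument compares only elements of \<open>X\<close> and \<open>Y\<close>, so
    it is enough to decide the signs of these finitely many quotients.\<close>
  define F where "F = (\<lambda>(a, b). a \<otimes> inv b) ` ((X \<union> Y) \<times> (X \<union> Y))"
  have XY: "x \<in> carrier G" if "x \<in> X \<union> Y" for x using that X Y by blast
  have "finite F" unfolding F_def using X Y by simp
  moreover have "F \<subseteq> carrier G" unfolding F_def using XY by (auto simp del: Un_iff)
  ultimately have "\<exists>P. positive_cone P \<and> (\<forall>x\<in>F. x \<in> P \<or> inv x \<in> P)"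
    by (rule exists_cone[OF G, rotated 1]) (erule (2) tf)
  then obtain P where P0: "positive_cone P"
    and P5: "\<forall>x\<in>F. x \<in> P \<or> inv x \<in> P" by blast
  note P = positive_coneD[OF P0]
  have greatest: "\<exists>m\<in>Z. \<forall>z\<in>Z. m \<otimes> inv z \<in> P"
    if "finite Z" "Z \<noteq> {}" "Z \<subseteq> X \<union> Y" for Z
    using that
  proof (induction Z rule: finite_ne_induct)
    case (singleton z)
    then have "z \<in> carrier G" using X Y by auto
    then show ?case using P(2) by simp
  next
    case (insert a Z)
    then obtain m where m: "m \<in> Z" "\<And>z. z \<in> Z \<Longrightarrow> m \<otimes> inv z \<in> P" by auto
    have c: "a \<in> carrier G" "m \<in> carrier G" "\<And>z. z \<in> Z \<Longrightarrow> z \<in> carrier G"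
      using insert.prems m(1) X Y by auto
    have "a \<otimes> inv m \<in> F" unfolding F_def using insert.prems m(1) by auto
    then consider "a \<otimes> inv m \<in> P" | "inv (a \<otimes> inv m) \<in> P" using P5 by blast
    then show ?case
    proof cases
      case 1
      have "a \<otimes> inv z \<in> P" if "z \<in> Z" for z
      proof -
        have "a \<otimes> inv z = (a \<otimes> inv m) \<otimes> (m \<otimes> inv z)"
          using c that by (simp add: m_assoc) (metis inv_closed l_inv l_one m_assoc)
        then show ?thesis using P(3)[OF 1 m(2)[OF that]] by simp
      qed
      then show ?thesis using c P(2) by (intro bexI[of _ a]) auto
    next
      case 2
      then have "m \<otimes> inv a \<in> P" using c by (simp add: inv_mult_group)
      then show ?thesis using m by (intro bexI[of _ m]) auto
    qed
  qed
  obtain x where x: "x \<in> X" "\<And>z. z \<in> X \<Longrightarrow> x \<otimes> inv z \<in> P" using greatest[of X] X by auto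
  obtain y where y: "y \<in> Y" "\<And>z. z \<in> Y \<Longrightarrow> y \<otimes> inv z \<in> P" using greatest[of Y] Y by auto
  have "x' = x \<and> y' = y" if "x' \<in> X" "y' \<in> Y" "x' \<otimes> y' = x \<otimes> y" for x' y'
  proof -
    have c: "x \<in> carrier G" "x' \<in> carrier G" "y \<in> carrier G" "y' \<in> carrier G"
      using that x(1) y(1) X Y by auto
    \<comment> \<open>As \<open>x\<close> and \<open>y\<close> are largest, the quotients of
      \<open>x\<close> by \<open>x'\<close> and of \<open>y\<close> by \<open>y'\<close> are both in
      the cone; being inverse to each other they are trivial.\<close>
    have "inv (x \<otimes> inv x') = y \<otimes> inv y'"
    proof -
      have "inv (x \<otimes> inv x') = x' \<otimes> inv x" using c by (simp add: inv_mult_group)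
      also have "\<dots> = (x' \<otimes> y') \<otimes> inv y' \<otimes> inv x" using c by (simp add: m_assoc)
      also have "\<dots> = (x \<otimes> y) \<otimes> inv y' \<otimes> inv x" by (simp only: that(3))
      also have "\<dots> = (inv x \<otimes> x) \<otimes> (y \<otimes> inv y')" using c by (simp only: m_ac m_closed inv_closed)
      also have "\<dots> = y \<otimes> inv y'" using c by simp
      finally show ?thesis .
    qed
    then have one: "x \<otimes> inv x' = \<one>" using P(4)[OF x(2)] y(2) that by metis
    then have "x = x'" using c by (metis inv_equality inv_inv inv_closed)
    moreover then have "y = y'" using that(3) c by simp
    ultimately show ?thesis by simp
  qed
  then show ?thesis using that x(1) y(1) by blast
qed

section \<open>Relative normality, cosets, and unique products modulo torsion\<close>

text \<open>Normality in \<open>H\<close> without changing the carrier, so that all products,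
  inverses and cosets are those of \<open>G\<close>.\<close>

definition normal_in :: "'a set \<Rightarrow> 'a set \<Rightarrow> bool" where
  "normal_in N H \<longleftrightarrow> subgroup N G \<and> N \<subseteq> H \<and> (\<forall>h\<in>H. \<forall>n\<in>N. conj_by h n \<in> N)"

lemma normal_in_iff:
  assumes H: "subgroup H G"
  shows "normal_in N H \<longleftrightarrow> N \<lhd> (G\<lparr>carrier := H\<rparr>)"
proof -
  have grp: "group (G\<lparr>carrier := H\<rparr>)" using H by (rule subgroup_imp_group)
  have sub: "subgroup N (G\<lparr>carrier := H\<rparr>) \<longleftrightarrow> subgroup N G \<and> N \<subseteq> H"
  proof
    assume N: "subgroup N (G\<lparr>carrier := H\<rparr>)"
    have "N \<subseteq> H" using subgroup.subset[OF N] by simp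
    then show "subgroup N G \<and> N \<subseteq> H" using incl_subgroup[OF H N] by simp
  next
    assume "subgroup N G \<and> N \<subseteq> H"
    then show "subgroup N (G\<lparr>carrier := H\<rparr>)" using subgroup_incl[OF _ H] by blast
  qed
  have inv: "inv\<^bsub>G\<lparr>carrier := H\<rparr>\<^esub> h = inv h" if "h \<in> H" for h
    using m_inv_consistent[OF H that] by simp
  have conj: "(\<forall>h\<in>H. \<forall>n\<in>N. h \<otimes> n \<otimes> inv h \<in> N) \<longleftrightarrow> (\<forall>h\<in>H. \<forall>n\<in>N. conj_by h n \<in> N)"
  proof -
    have "inv h \<in> H" "h \<in> carrier G" if "h \<in> H" for h
      using H that by (auto simp: subgroup.m_inv_closed subgroup.mem_carrier)
    then show ?thesis unfolding conj_by_def by (metis inv_inv)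
  qed
  show ?thesis
    using group.normal_inv_iff[OF grp, of N] sub conj inv by (auto simp: normal_in_def)
qed

lemma normal_pair_iff: "normal_pair G N H \<longleftrightarrow> subgroup H G \<and> normal_in N H"
  using normal_in_iff by (auto simp: normal_pair_def)

lemma coset_mult:
  assumes H: "subgroup H G" and N: "normal_in N H" and u: "u \<in> H" and v: "v \<in> H"
    and x: "x \<in> u <# N" and y: "y \<in> v <# N"
  shows "x \<otimes> y \<in> (u \<otimes> v) <# N"
proof -
  obtain n m where nm: "n \<in> N" "m \<in> N" "x = u \<otimes> n" "y = v \<otimes> m"
    using x y by (auto simp: l_coset_def)
  have NG: "subgroup N G" using N by (simp add: normal_in_def)
  have c: "u \<in> carrier G" "v \<in> carrier G" "n \<in> carrier G" "m \<in> carrier G"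
    using u v H nm NG by (auto simp: subgroup.mem_carrier)
  have "v \<otimes> (inv v \<otimes> z) = z" if "z \<in> carrier G" for z
    using that c by (metis inv_closed m_assoc r_inv l_one)
  then have "x \<otimes> y = (u \<otimes> v) \<otimes> (conj_by v n \<otimes> m)"
    using c nm by (simp add: conj_by_def m_assoc)
  moreover have "conj_by v n \<otimes> m \<in> N"
    using N v nm NG by (auto simp: normal_in_def intro: subgroup.m_closed)
  ultimately show ?thesis unfolding l_coset_def by blast
qed

lemma l_coset_one: "N \<subseteq> carrier G \<Longrightarrow> \<one> <# N = N"
  by (force simp: l_coset_def)

text \<open>The hypotheses \<open>comm\<close> and \<open>tf\<close> say through representatives
  that \<open>G Mod T\<close> is abelian and torsion-free. The unique product is found among the
  images of \<open>X\<close> and \<open>Y\<close> there, hence uniqueness only up to cosets.\<close>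

lemma unique_product_mod:
  assumes T: "T \<lhd> G"
    and comm: "\<And>x y. x \<in> carrier G \<Longrightarrow> y \<in> carrier G \<Longrightarrow> x \<otimes> y \<in> (y \<otimes> x) <# T"
    and tf: "\<And>x n. x \<in> carrier G \<Longrightarrow> n > 0 \<Longrightarrow> x [^] (n::nat) \<in> T \<Longrightarrow> x \<in> T"
    and X: "finite X" "X \<noteq> {}" "X \<subseteq> carrier G" and Y: "finite Y" "Y \<noteq> {}" "Y \<subseteq> carrier G"
  obtains x y where "x \<in> X" "y \<in> Y"
    "\<And>x' y'. x' \<in> X \<Longrightarrow> y' \<in> Y \<Longrightarrow> x' \<otimes> y' \<in> (x \<otimes> y) <# T \<Longrightarrow> x' \<in> x <# T \<and> y' \<in> y <# T"
proof -
  interpret T: normal T G by (rule T)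
  have TG: "subgroup T G" by (rule T.subgroup_axioms)
  let ?Q = "G Mod T"
  have lr: "T #> x = x <# T" if "x \<in> carrier G" for x using T.coset_eq that by blast
  have eq_iff: "T #> x = T #> y \<longleftrightarrow> x \<in> y <# T" if "x \<in> carrier G" "y \<in> carrier G" for x y
    using repr_independence[OF _ that(2) TG, of x] rcos_self[OF that(1) TG] lr[OF that(2)] by metis
  have grp: "group ?Q" by (rule T.factorgroup_is_group)
  have pow: "(T #> x) [^]\<^bsub>?Q\<^esub> (n::nat) = T #> (x [^] n)" if x: "x \<in> carrier G" for x n
  proof (induction n)
    case 0
    show ?case using TG by (simp add: coset_join2 subgroup.one_closed)
  next
    case (Suc n)
    then show ?case using x by (simp add: T.rcos_sum)
  qed
  have cQ: "comm_group ?Q"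
  proof (rule group.group_comm_groupI[OF grp])
    fix a b assume "a \<in> carrier ?Q" "b \<in> carrier ?Q"
    then obtain x y where xy: "x \<in> carrier G" "y \<in> carrier G" "a = T #> x" "b = T #> y"
      by (auto simp: carrier_FactGroup)
    then show "a \<otimes>\<^bsub>?Q\<^esub> b = b \<otimes>\<^bsub>?Q\<^esub> a"
      using eq_iff[of "x \<otimes> y" "y \<otimes> x"] comm[of x y] by (simp add: T.rcos_sum)
  qed
  have tQ: "a = \<one>\<^bsub>?Q\<^esub>" if a: "a \<in> carrier ?Q" and n: "n > 0" "a [^]\<^bsub>?Q\<^esub> (n::nat) = \<one>\<^bsub>?Q\<^esub>" for a n
  proof -
    obtain x where x: "x \<in> carrier G" "a = T #> x" using a by (auto simp: carrier_FactGroup)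
    have "T #> (x [^] n) = T" using n pow[OF x(1)] x(2) by simp
    then have "x [^] n \<in> T" using rcos_self[of "x [^] n", OF _ TG] x(1) by simp
    then have "x \<in> T" using tf x(1) n(1) by blast
    then show ?thesis using x TG by (simp add: coset_join2)
  qed
  define \<kappa> where "\<kappa> = (\<lambda>x. T #> x)"
  have sub: "\<kappa> ` X \<subseteq> carrier ?Q" "\<kappa> ` Y \<subseteq> carrier ?Q"
    using X Y unfolding \<kappa>_def by (auto simp: carrier_FactGroup)
  obtain a b where ab: "a \<in> \<kappa> ` X" "b \<in> \<kappa> ` Y"
    "\<And>a' b'. a' \<in> \<kappa> ` X \<Longrightarrow> b' \<in> \<kappa> ` Y \<Longrightarrow> a' \<otimes>\<^bsub>?Q\<^esub> b' = a \<otimes>\<^bsub>?Q\<^esub> b \<Longrightarrow> a' = a \<and> b' = b"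
    by (rule group.unique_product[OF grp cQ tQ _ _ sub(1) _ _ sub(2)]) (use X Y in auto)
  obtain x y where xy: "x \<in> X" "y \<in> Y" "a = \<kappa> x" "b = \<kappa> y" using ab by blast
  have "x' \<in> x <# T \<and> y' \<in> y <# T" if "x' \<in> X" "y' \<in> Y" "x' \<otimes> y' \<in> (x \<otimes> y) <# T" for x' y'
  proof -
    have c: "x \<in> carrier G" "y \<in> carrier G" "x' \<in> carrier G" "y' \<in> carrier G"
      using that xy X Y by auto
    then have "\<kappa> x' \<otimes>\<^bsub>?Q\<^esub> \<kappa> y' = a \<otimes>\<^bsub>?Q\<^esub> b"
      using that(3) eq_iff[of "x' \<otimes> y'" "x \<otimes> y"] xy(3,4) by (simp add: \<kappa>_def T.rcos_sum)
    then have "\<kappa> x' = a \<and> \<kappa> y' = b" using ab(3) that by blast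
    then show ?thesis using eq_iff c xy by (simp add: \<kappa>_def)
  qed
  then show ?thesis using that xy by blast
qed

lemma torsion_normal_in:
  assumes H: "subgroup H G" shows "normal_in (torsion_in (finite_conj H \<inter> H)) H"
  using torsion_subgroup[OF H] torsion_conj_by[OF H] by (auto simp: normal_in_def torsion_in_def)

text \<open>\<open>D\<close> modulo \<open>T\<close> is abelian because commutators of elements of
  \<open>D\<close> are torsion, and torsion-free because an element with a torsion power is
  torsion.\<close>

lemma unique_product_mod_torsion:
  assumes H: "subgroup H G" and D: "D = finite_conj H \<inter> H" and T: "T = torsion_in D"
    and X: "finite X" "X \<noteq> {}" "X \<subseteq> D" and Y: "finite Y" "Y \<noteq> {}" "Y \<subseteq> D"
  obtains x y where "x \<in> X" "y \<in> Y"
    "\<And>x' y'. x' \<in> X \<Longrightarrow> y' \<in> Y \<Longrightarrow> x' \<otimes> y' \<in> (x \<otimes> y) <# T \<Longrightarrow> x' \<in> x <# T \<and> y' \<in> y <# T"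
proof -
  have Hc: "H \<subseteq> carrier G" using H by (rule subgroup.subset)
  have DG: "subgroup D G" unfolding D
    using finite_conj_subgroup[OF Hc] H by (rule subgroups_Inter_pair)
  have Dc: "D \<subseteq> carrier G" using DG by (rule subgroup.subset)
  let ?K = "G\<lparr>carrier := D\<rparr>"
  have grp: "group ?K" using DG by (rule subgroup_imp_group)
  have TD: "T \<subseteq> D" by (auto simp: T torsion_in_def)
  have nT: "normal_in T H" using torsion_normal_in[OF H] by (simp add: T D)
  then have "normal_in T D" using TD by (auto simp: normal_in_def D)
  then have norm: "T \<lhd> ?K" using normal_in_iff[OF DG] by simp
  have l: "x <#\<^bsub>?K\<^esub> T = x <# T" for x by (simp add: l_coset_def)
  have pow: "x [^]\<^bsub>?K\<^esub> (n::nat) = x [^] n" for x n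
    by (simp add: nat_pow_def)
  have cl: "x \<otimes> y \<in> D" if "x \<in> D" "y \<in> D" for x y using DG that by (rule subgroup.m_closed)
  show ?thesis
  proof (rule group.unique_product_mod[OF grp norm])
    fix x y assume "x \<in> carrier ?K" "y \<in> carrier ?K"
    then have xy: "x \<in> D" "y \<in> D" by simp_all
    have c: "x \<in> carrier G" "y \<in> carrier G" using xy Dc by auto
    have "inv x \<otimes> conj_by y x \<in> T" using commutator_torsion[OF H] xy by (simp add: T D)
    moreover have "x \<otimes> y = (y \<otimes> x) \<otimes> (inv x \<otimes> conj_by y x)"
    proof -
      have *: "a \<otimes> (inv a \<otimes> z) = z" if "a \<in> carrier G" "z \<in> carrier G" for a z
        using that by (metis inv_closed m_assoc r_inv l_one)
      show ?thesis using c by (simp add: conj_by_def m_assoc *)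
    qed
    ultimately show "x \<otimes>\<^bsub>?K\<^esub> y \<in> (y \<otimes>\<^bsub>?K\<^esub> x) <#\<^bsub>?K\<^esub> T"
      unfolding l by (auto simp: l_coset_def)
  next
    fix x and n :: nat assume x: "x \<in> carrier ?K" and n: "n > 0" "x [^]\<^bsub>?K\<^esub> n \<in> T"
    then obtain m :: nat where m: "m > 0" "(x [^] n) [^] m = \<one>"
      unfolding pow T torsion_in_def by auto
    have "x \<in> carrier G" using x Dc by auto
    then have "x [^] (n * m) = \<one>" using m by (simp add: nat_pow_pow)
    then show "x \<in> T" using x n m by (auto simp: T torsion_in_def intro!: exI[of _ "n * m"])
  next
    fix x y assume *: "x \<in> X" "y \<in> Y"
      "\<And>x' y'. x' \<in> X \<Longrightarrow> y' \<in> Y \<Longrightarrow> x' \<otimes>\<^bsub>?K\<^esub> y' \<in> (x \<otimes>\<^bsub>?K\<^esub> y) <#\<^bsub>?K\<^esub> T \<Longrightarrow>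
        x' \<in> x <#\<^bsub>?K\<^esub> T \<and> y' \<in> y <#\<^bsub>?K\<^esub> T"
    show ?thesis by (rule that[of x y]) (use * l in auto)
  qed (use X Y in auto)
qed

lemma mem_l_coset_self: "x \<in> carrier G \<Longrightarrow> subgroup N G \<Longrightarrow> x \<in> x <# N"
  unfolding l_coset_def using subgroup.one_closed[of N G] by (intro UN_I[of \<one>]) auto

lemma l_coset_eq_iff:
  assumes "x \<in> carrier G" "y \<in> carrier G" "subgroup N G"
  shows "x <# N = y <# N \<longleftrightarrow> y \<in> x <# N"
  using l_repr_independence[of y x N] mem_l_coset_self[of y N] assms by metis

lemma inv_mem_l_coset:
  assumes H: "subgroup H G" and N: "normal_in N H" and u: "u \<in> H" and x: "x \<in> u <# N"
  shows "inv x \<in> inv u <# N"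
proof -
  obtain n where n: "n \<in> N" "x = u \<otimes> n" using x by (auto simp: l_coset_def)
  have NG: "subgroup N G" using N by (simp add: normal_in_def)
  have uc: "u \<in> carrier G" and nc: "n \<in> carrier G"
    using u n H NG by (auto simp: subgroup.mem_carrier)
  have inv_n: "inv n \<in> \<one> <# N"
    using n NG by (simp add: l_coset_one subgroup.subset subgroup.m_inv_closed)
  have "inv n \<otimes> inv u \<in> (\<one> \<otimes> inv u) <# N"
    by (rule coset_mult[OF H N _ _ inv_n])
      (use H u uc NG in \<open>auto simp: subgroup.one_closed subgroup.m_inv_closed mem_l_coset_self\<close>)
  then show ?thesis using n uc nc by (simp add: inv_mult_group)
qed

end

section \<open>Additive spans and homogeneous components\<close>

text \<open>Finite sums without negatives, because the products \<open>U \<star> V\<close> are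
  formed for arbitrary subsets, where negatives need not be available. Identities in such products
  reduce to generators by induction.\<close>

inductive_set additive_hull :: "'a::ring set \<Rightarrow> 'a set" for X where
  zero: "0 \<in> additive_hull X"
| add: "x \<in> X \<Longrightarrow> a \<in> additive_hull X \<Longrightarrow> x + a \<in> additive_hull X"

lemma hull_base: "x \<in> X \<Longrightarrow> x \<in> additive_hull X"
  using additive_hull.add[OF _ additive_hull.zero] by simp

lemma hull_add: "a \<in> additive_hull X \<Longrightarrow> b \<in> additive_hull X \<Longrightarrow> a + b \<in> additive_hull X"
  by (induction rule: additive_hull.induct) (auto simp: add.assoc intro: additive_hull.add)

lemma hull_minus:
  assumes "\<And>x. x \<in> X \<Longrightarrow> - x \<in> X"
  shows "a \<in> additive_hull X \<Longrightarrow> - a \<in> additive_hull X"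
proof (induction rule: additive_hull.induct)
  case (add x a)
  have "- (x + a) = - x + - a" by simp
  then show ?case using add assms by (metis additive_hull.add)
qed (simp add: additive_hull.zero)

lemma hull_map:
  assumes "f 0 = 0" "\<And>a b. f (a + b) = f a + f b" "\<And>x. x \<in> X \<Longrightarrow> f x \<in> additive_hull Y"
  shows "a \<in> additive_hull X \<Longrightarrow> f a \<in> additive_hull Y"
  by (induction rule: additive_hull.induct) (auto simp: assms additive_hull.zero hull_add)

lemma hull_subset:
  assumes "0 \<in> W" "\<And>a b. a \<in> W \<Longrightarrow> b \<in> W \<Longrightarrow> a + b \<in> W" "X \<subseteq> W"
  shows "additive_hull X \<subseteq> W"
proof
  fix a assume "a \<in> additive_hull X"
  then show "a \<in> W" by induction (use assms in auto)
qed

lemma hull_mono: "X \<subseteq> Y \<Longrightarrow> additive_hull X \<subseteq> additive_hull Y"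
  by (rule hull_subset) (auto intro: hull_base additive_hull.zero hull_add)

lemma hull_vanish:
  assumes "f 0 = (0::'b::ring)" "\<And>a b. f (a + b) = f a + f b" "\<And>x. x \<in> X \<Longrightarrow> f x = 0"
  shows "a \<in> additive_hull X \<Longrightarrow> f a = 0"
  by (induction rule: additive_hull.induct) (auto simp: assms)

lemma sum_in_hull: "(\<And>i. i \<in> A \<Longrightarrow> f i \<in> additive_hull X) \<Longrightarrow> sum f A \<in> additive_hull X"
  by (induction A rule: infinite_finite_induct) (auto simp: additive_hull.zero hull_add)

lemma hull_mult_vanish:
  assumes "\<And>x y. x \<in> X \<Longrightarrow> y \<in> Y \<Longrightarrow> x * y = 0"
    and a: "a \<in> additive_hull X" and b: "b \<in> additive_hull Y"
  shows "a * b = 0"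
proof -
  have "x * b = 0" if "x \<in> X" for x
    using b by (rule hull_vanish[rotated -1]) (use assms(1) that in \<open>auto simp: distrib_left\<close>)
  then show ?thesis
    using hull_vanish[of "\<lambda>x. x * b" X a] a by (simp add: distrib_right)
qed

lemma sum_mult_eq_hull: "U \<star> V = additive_hull {u * v | u v. u \<in> U \<and> v \<in> V}" (is "_ = additive_hull ?X")
proof
  show "U \<star> V \<subseteq> additive_hull ?X"
  proof
    fix a assume "a \<in> U \<star> V"
    then obtain n :: nat and u v where "a = (\<Sum>i<n. u i * v i)" "\<And>i. i < n \<Longrightarrow> u i \<in> U \<and> v i \<in> V"
      unfolding sum_mult_def by auto
    then show "a \<in> additive_hull ?X"
      by (simp only:) (rule sum_in_hull, rule hull_base, use lessThan_iff in blast)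
  qed
next
  show "additive_hull ?X \<subseteq> U \<star> V"
  proof
    fix a assume "a \<in> additive_hull ?X"
    then show "a \<in> U \<star> V"
    proof induction
      case zero
      show ?case unfolding sum_mult_def by (auto intro!: exI[of _ "0::nat"])
    next
      case (add x a)
      then obtain n :: nat and u v where a: "a = (\<Sum>i<n. u i * v i)"
        and uv: "\<And>i. i < n \<Longrightarrow> u i \<in> U \<and> v i \<in> V"
        unfolding sum_mult_def by auto
      obtain p q where pq: "x = p * q" "p \<in> U" "q \<in> V" using add by auto
      have "(\<Sum>i<Suc n. (u(n := p)) i * (v(n := q)) i) = x + a"
        unfolding a pq by (simp add: add.commute)
      then show ?case unfolding sum_mult_def using uv pq(2,3)
        by (intro CollectI exI[of _ "Suc n"] exI[of _ "u(n := p)"] exI[of _ "v(n := q)"])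
          (auto simp: less_Suc_eq)
    qed
  qed
qed

lemma mult_in_sum_mult: "u \<in> U \<Longrightarrow> v \<in> V \<Longrightarrow> u * v \<in> U \<star> V"
  unfolding sum_mult_eq_hull by (rule hull_base) blast

lemma sum_mult_subset:
  assumes "0 \<in> W" "\<And>a b. a \<in> W \<Longrightarrow> b \<in> W \<Longrightarrow> a + b \<in> W"
    and "\<And>u v. u \<in> U \<Longrightarrow> v \<in> V \<Longrightarrow> u * v \<in> W"
  shows "U \<star> V \<subseteq> W"
  unfolding sum_mult_eq_hull by (rule hull_subset) (use assms in auto)

lemma sum_mult3_subset:
  assumes "0 \<in> W" "\<And>a b. a \<in> W \<Longrightarrow> b \<in> W \<Longrightarrow> a + b \<in> W"
    and "\<And>u v w. u \<in> U \<Longrightarrow> v \<in> V \<Longrightarrow> w \<in> Z \<Longrightarrow> u * v * w \<in> W"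
  shows "U \<star> V \<star> Z \<subseteq> W"
proof (rule sum_mult_subset)
  fix x w assume x: "x \<in> U \<star> V" and w: "w \<in> Z"
  have "U \<star> V \<subseteq> {x. x * w \<in> W}"
    by (rule sum_mult_subset) (use assms w in \<open>auto simp: distrib_right\<close>)
  then show "x * w \<in> W" using x by blast
qed (use assms in auto)

lemma sum_mult_eq_zero_iff: "U \<star> V = {0} \<longleftrightarrow> (\<forall>u\<in>U. \<forall>v\<in>V. u * v = 0)"
proof
  assume "U \<star> V = {0}" then show "\<forall>u\<in>U. \<forall>v\<in>V. u * v = 0"
    using mult_in_sum_mult by blast
next
  assume "\<forall>u\<in>U. \<forall>v\<in>V. u * v = 0"
  then have "U \<star> V \<subseteq> {0}" by (intro sum_mult_subset) auto
  moreover have "0 \<in> U \<star> V" unfolding sum_mult_eq_hull by (rule additive_hull.zero)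
  ultimately show "U \<star> V = {0}" by blast
qed

lemma sum_mult3_eq_zero_iff:
  "U \<star> V \<star> Z = {0} \<longleftrightarrow> (\<forall>u\<in>U. \<forall>v\<in>V. \<forall>w\<in>Z. u * v * w = 0)"
proof
  assume *: "U \<star> V \<star> Z = {0}"
  show "\<forall>u\<in>U. \<forall>v\<in>V. \<forall>w\<in>Z. u * v * w = 0"
  proof (intro ballI)
    fix u v w assume "u \<in> U" "v \<in> V" "w \<in> Z"
    then have "u * v * w \<in> U \<star> V \<star> Z" by (intro mult_in_sum_mult)
    then show "u * v * w = 0" using * by simp
  qed
next
  assume "\<forall>u\<in>U. \<forall>v\<in>V. \<forall>w\<in>Z. u * v * w = 0"
  then have "U \<star> V \<star> Z \<subseteq> {0}" by (intro sum_mult3_subset) auto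
  moreover have "0 \<in> U \<star> V \<star> Z" unfolding sum_mult_eq_hull by (rule additive_hull.zero)
  ultimately show "U \<star> V \<star> Z = {0}" by blast
qed

lemma sum_mult_zero: "0 \<in> U \<star> V"
  unfolding sum_mult_eq_hull by (rule additive_hull.zero)

lemma sum_mult_add: "a \<in> U \<star> V \<Longrightarrow> b \<in> U \<star> V \<Longrightarrow> a + b \<in> U \<star> V"
  unfolding sum_mult_eq_hull by (rule hull_add)

lemma sum_mult_minus:
  assumes "\<And>u. u \<in> U \<Longrightarrow> - u \<in> U" shows "a \<in> U \<star> V \<Longrightarrow> - a \<in> U \<star> V"
  unfolding sum_mult_eq_hull
proof (rule hull_minus)
  fix x assume "x \<in> {u * v | u v. u \<in> U \<and> v \<in> V}"
  then obtain u v where "x = u * v" "u \<in> U" "v \<in> V" by auto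
  then show "- x \<in> {u * v | u v. u \<in> U \<and> v \<in> V}"
    using assms by (intro CollectI exI[of _ "- u"] exI[of _ v]) auto
qed

lemma additive_subgroupD:
  assumes "additive_subgroup_set U"
  shows "0 \<in> U" "a \<in> U \<Longrightarrow> b \<in> U \<Longrightarrow> a + b \<in> U" "a \<in> U \<Longrightarrow> - a \<in> U"
    "a \<in> U \<Longrightarrow> b \<in> U \<Longrightarrow> a - b \<in> U"
proof -
  show "0 \<in> U" and p: "\<And>a b. a \<in> U \<Longrightarrow> b \<in> U \<Longrightarrow> a + b \<in> U" and m: "\<And>a. a \<in> U \<Longrightarrow> - a \<in> U"
    using assms by (simp_all only: additive_subgroup_set_def)
  show "a \<in> U \<Longrightarrow> b \<in> U \<Longrightarrow> a - b \<in> U"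
    using p[of a "- b"] m[of b] by simp
qed

lemma ideal_ofD:
  assumes "ideal_of R I"
  shows "I \<subseteq> R" "additive_subgroup_set I"
    "r \<in> R \<Longrightarrow> a \<in> I \<Longrightarrow> r * a \<in> I" "r \<in> R \<Longrightarrow> a \<in> I \<Longrightarrow> a * r \<in> I"
  using assms by (auto simp: ideal_of_def)

lemma ideal_diff: "ideal_of R J \<Longrightarrow> a \<in> J \<Longrightarrow> b \<in> J \<Longrightarrow> a - b \<in> J"
  using ideal_ofD(2) additive_subgroupD(4) by blast

lemma hull_ideal:
  assumes XR: "X \<subseteq> R" and R: "additive_subgroup_set R"
    and neg: "\<And>x. x \<in> X \<Longrightarrow> - x \<in> X"
    and left: "\<And>r x. r \<in> R \<Longrightarrow> x \<in> X \<Longrightarrow> r * x \<in> X"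
    and right: "\<And>r x. r \<in> R \<Longrightarrow> x \<in> X \<Longrightarrow> x * r \<in> X"
  shows "ideal_of R (additive_hull X)"
proof -
  have "additive_hull X \<subseteq> R"
    by (rule hull_subset) (use XR additive_subgroupD[OF R] in auto)
  moreover have "additive_subgroup_set (additive_hull X)"
    unfolding additive_subgroup_set_def
    using hull_minus[of X, OF neg] by (auto intro: additive_hull.zero hull_add)
  moreover have "r * a \<in> additive_hull X" if "r \<in> R" "a \<in> additive_hull X" for r a
    using that(2) by (rule hull_map[rotated -1]) (auto simp: distrib_left intro: hull_base left that)
  moreover have "a * r \<in> additive_hull X" if "r \<in> R" "a \<in> additive_hull X" for r a
    using that(2) by (rule hull_map[rotated -1]) (auto simp: distrib_right intro: hull_base right that)
  ultimately show ?thesis unfolding ideal_of_def by blast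
qed

locale graded = group G for G (structure) +
  fixes S :: "'a \<Rightarrow> 'r::ring set"
  assumes graded: "graded_ring G S"
begin

lemma S_additive: "x \<in> carrier G \<Longrightarrow> additive_subgroup_set (S x)"
  using graded by (simp add: graded_ring_def)

lemma S_zero [simp]: "x \<in> carrier G \<Longrightarrow> 0 \<in> S x"
  using S_additive additive_subgroupD(1) by blast

lemma S_add: "x \<in> carrier G \<Longrightarrow> a \<in> S x \<Longrightarrow> b \<in> S x \<Longrightarrow> a + b \<in> S x"
  using S_additive additive_subgroupD(2) by blast

lemma S_minus: "x \<in> carrier G \<Longrightarrow> a \<in> S x \<Longrightarrow> - a \<in> S x"
  using S_additive additive_subgroupD(3) by blast

lemma S_mult:
  assumes "x \<in> carrier G" "y \<in> carrier G" "a \<in> S x" "b \<in> S y"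
  shows "a * b \<in> S (x \<otimes> y)"
proof -
  have "S x \<star> S y \<subseteq> S (x \<otimes> y)" using graded assms by (simp add: graded_ring_def)
  then show ?thesis using mult_in_sum_mult[OF assms(3,4)] by blast
qed

lemma S_mult': "x \<in> carrier G \<Longrightarrow> y \<in> carrier G \<Longrightarrow> a \<in> S x \<Longrightarrow> b \<in> S y \<Longrightarrow> x \<otimes> y = z \<Longrightarrow> a * b \<in> S z"
  using S_mult by blast

section \<open>Homogeneous components and supports\<close>

definition component :: "'r \<Rightarrow> 'a \<Rightarrow> 'r" where
  "component s = (THE f. f \<in> fin_families S (carrier G) \<and> family_sum f = s)"

definition support :: "'r \<Rightarrow> 'a set" where
  "support s = {x. component s x \<noteq> 0}"

lemma component_family: "component s \<in> fin_families S (carrier G)" "family_sum (component s) = s"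
proof -
  have "\<exists>!f. f \<in> fin_families S (carrier G) \<and> family_sum f = s"
    using graded by (simp add: graded_ring_def)
  from theI'[OF this]
  show "component s \<in> fin_families S (carrier G)" "family_sum (component s) = s"
    unfolding component_def by auto
qed

lemma component_unique:
  assumes "f \<in> fin_families S (carrier G)" "family_sum f = s"
  shows "component s = f"
proof -
  have "\<exists>!f. f \<in> fin_families S (carrier G) \<and> family_sum f = s"
    using graded by (simp add: graded_ring_def)
  then show ?thesis using assms component_family[of s] by blast
qed

lemma finite_support [simp]: "finite (support s)"
  using component_family[of s] by (simp add: fin_families_def support_def)

lemma support_carrier: "support s \<subseteq> carrier G"
  using component_family[of s] by (simp add: fin_families_def support_def)

lemma component_outside: "x \<notin> carrier G \<Longrightarrow> component s x = 0"
  using support_carrier[of s] by (auto simp: support_def)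

lemma component_in [simp]: "x \<in> carrier G \<Longrightarrow> component s x \<in> S x"
  using component_family[of s] by (simp add: fin_families_def)

lemma not_in_support: "x \<notin> support s \<Longrightarrow> component s x = 0"
  by (simp add: support_def)

lemma sum_components:
  assumes "finite F" "support s \<subseteq> F" shows "(\<Sum>x\<in>F. component s x) = s"
proof -
  have "(\<Sum>x\<in>F. component s x) = (\<Sum>x\<in>support s. component s x)"
    using assms by (intro sum.mono_neutral_right) (auto simp: support_def)
  also have "\<dots> = s" using component_family(2)[of s] by (simp add: family_sum_def support_def)
  finally show ?thesis .
qed

lemma component_eqI:
  assumes fin: "finite F" and F: "F \<subseteq> carrier G" and f: "\<And>x. x \<in> F \<Longrightarrow> f x \<in> S x"
    and s: "s = sum f F" and z: "\<And>x. x \<notin> F \<Longrightarrow> f x = 0"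
  shows "component s = f"
proof (rule component_unique)
  have sub: "{x. f x \<noteq> 0} \<subseteq> F" using z by blast
  have "f x \<in> S x" if "x \<in> carrier G" for x
    using f z that by (cases "x \<in> F") auto
  then show "f \<in> fin_families S (carrier G)"
    unfolding fin_families_def using sub fin F finite_subset[OF sub] by auto
  show "family_sum f = s"
    unfolding family_sum_def s using sub fin by (intro sum.mono_neutral_left) auto
qed

lemma component_zero [simp]: "component 0 x = 0"
proof -
  have "component 0 = (\<lambda>_. 0)" by (rule component_eqI[of "{}"]) auto
  then show ?thesis by simp
qed

lemma component_add [simp]: "component (a + b) x = component a x + component b x"
proof -
  let ?F = "support a \<union> support b"
  have "component (a + b) = (\<lambda>x. component a x + component b x)"
  proof (rule component_eqI[of ?F])
    show "?F \<subseteq> carrier G" using support_carrier by blast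
    then show "component a x + component b x \<in> S x" if "x \<in> ?F" for x
      using that by (intro S_add) auto
    show "a + b = (\<Sum>x\<in>?F. component a x + component b x)"
      by (simp add: sum.distrib sum_components)
  qed (use finite_support[of a] finite_support[of b] in \<open>auto simp: support_def\<close>)
  then show ?thesis by simp
qed

lemma component_minus [simp]: "component (- a) x = - component a x"
proof -
  have "component (- a) x + component a x = 0"
    unfolding component_add[symmetric] by simp
  then show ?thesis by (simp add: eq_neg_iff_add_eq_0)
qed

lemma component_diff [simp]: "component (a - b) x = component a x - component b x"
  using component_add[of a "- b" x] by simp

lemma component_sum_fun: "component (sum f A) x = (\<Sum>i\<in>A. component (f i) x)"
  by (induction A rule: infinite_finite_induct) auto

lemma component_homogeneous:
  assumes "x \<in> carrier G" "s \<in> S x"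
  shows "component s y = (if y = x then s else 0)"
proof -
  have "component s = (\<lambda>y. if y = x then s else 0)"
    by (rule component_eqI[of "{x}"]) (use assms in auto)
  then show ?thesis by simp
qed

lemma component_ext: "(\<And>x. x \<in> carrier G \<Longrightarrow> component a x = component b x) \<Longrightarrow> a = b"
proof -
  assume h: "\<And>x. x \<in> carrier G \<Longrightarrow> component a x = component b x"
  have "component a = component b"
    using h component_outside by (metis ext)
  then show "a = b" using component_family(2) by metis
qed

lemma eq_zero_iff_component: "a = 0 \<longleftrightarrow> (\<forall>x\<in>carrier G. component a x = 0)"
  using component_ext[of a 0] by auto

lemma nonzero_support: "a \<noteq> 0 \<Longrightarrow> \<exists>x\<in>carrier G. component a x \<noteq> 0"
  using eq_zero_iff_component by blast

lemma component_homogeneous_mult: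
  assumes x: "x \<in> carrier G" and t: "t \<in> S x" and z: "z \<in> carrier G"
  shows "component (t * a) z = t * component a (inv x \<otimes> z)"
proof -
  have sc: "y \<in> support a \<Longrightarrow> y \<in> carrier G" for y using support_carrier by blast
  have "t * a = (\<Sum>y\<in>support a. t * component a y)"
    by (simp add: sum_distrib_left[symmetric] sum_components)
  then have "component (t * a) z = (\<Sum>y\<in>support a. component (t * component a y) z)"
    by (simp add: component_sum_fun)
  also have "\<dots> = (\<Sum>y\<in>support a. if y = inv x \<otimes> z then t * component a y else 0)"
  proof (rule sum.cong[OF refl])
    fix y assume "y \<in> support a"
    then have y: "y \<in> carrier G" by (rule sc)
    have "z = x \<otimes> y \<longleftrightarrow> y = inv x \<otimes> z" using x y z by (metis inv_solve_left)
    then show "component (t * component a y) z = (if y = inv x \<otimes> z then t * component a y else 0)"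
      using component_homogeneous[of "x \<otimes> y" "t * component a y" z] x y S_mult[OF x y t] by auto
  qed
  also have "\<dots> = t * component a (inv x \<otimes> z)" by (simp add: not_in_support)
  finally show ?thesis .
qed

lemma component_mult_homogeneous:
  assumes x: "x \<in> carrier G" and t: "t \<in> S x" and z: "z \<in> carrier G"
  shows "component (a * t) z = component a (z \<otimes> inv x) * t"
proof -
  have sc: "y \<in> support a \<Longrightarrow> y \<in> carrier G" for y using support_carrier by blast
  have "a * t = (\<Sum>y\<in>support a. component a y * t)"
    by (simp add: sum_distrib_right[symmetric] sum_components)
  then have "component (a * t) z = (\<Sum>y\<in>support a. component (component a y * t) z)"
    by (simp add: component_sum_fun)
  also have "\<dots> = (\<Sum>y\<in>support a. if y = z \<otimes> inv x then component a y * t else 0)"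
  proof (rule sum.cong[OF refl])
    fix y assume "y \<in> support a"
    then have y: "y \<in> carrier G" by (rule sc)
    have "z = y \<otimes> x \<longleftrightarrow> y = z \<otimes> inv x" using x y z by (metis inv_solve_right)
    then show "component (component a y * t) z = (if y = z \<otimes> inv x then component a y * t else 0)"
      using component_homogeneous[of "y \<otimes> x" "component a y * t" z] x y S_mult[OF y x _ t] by auto
  qed
  also have "\<dots> = component a (z \<otimes> inv x) * t" by (simp add: not_in_support)
  finally show ?thesis .
qed

lemma component_mult:
  assumes z: "z \<in> carrier G" and F: "finite F" "support a \<subseteq> F" "F \<subseteq> carrier G"
  shows "component (a * b) z = (\<Sum>x\<in>F. component a x * component b (inv x \<otimes> z))"
proof -
  have "a * b = (\<Sum>x\<in>F. component a x * b)"
    using F by (simp add: sum_distrib_right[symmetric] sum_components)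
  then have "component (a * b) z = (\<Sum>x\<in>F. component (component a x * b) z)"
    by (simp add: component_sum_fun)
  also have "\<dots> = (\<Sum>x\<in>F. component a x * component b (inv x \<otimes> z))"
    using F z by (intro sum.cong refl component_homogeneous_mult) auto
  finally show ?thesis .
qed

text \<open>Intersecting with the support keeps the sum finite for arbitrary
  \<open>K\<close>.\<close>

definition proj :: "'a set \<Rightarrow> 'r \<Rightarrow> 'r" where
  "proj K a = (\<Sum>x\<in>support a \<inter> K. component a x)"

lemma component_proj [simp]: "component (proj K a) x = (if x \<in> K then component a x else 0)"
proof -
  have "component (component a y) x = (if y = x then component a y else 0)" if "y \<in> support a" for y
    using component_homogeneous[of y "component a y" x] that support_carrier[of a] by auto
  then have "component (proj K a) x = (\<Sum>y\<in>support a \<inter> K. if y = x then component a y else 0)"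
    unfolding proj_def component_sum_fun by (intro sum.cong refl) auto
  then show ?thesis by (simp add: not_in_support)
qed

lemma support_proj [simp]: "support (proj K a) = support a \<inter> K"
  by (auto simp: support_def)

lemma component_sum_eq:
  assumes "K \<subseteq> carrier G" shows "component_sum S K = {a. support a \<subseteq> K}"
proof
  show "component_sum S K \<subseteq> {a. support a \<subseteq> K}"
  proof
    fix a assume "a \<in> component_sum S K"
    then obtain f where f: "f \<in> fin_families S K" "a = family_sum f" by (auto simp: component_sum_def)
    have "f x \<in> S x" if "x \<in> carrier G" for x
      using f that by (cases "x \<in> K") (auto simp: fin_families_def dest!: subsetD)
    then have "f \<in> fin_families S (carrier G)" using f assms by (auto simp: fin_families_def)
    then have "component a = f" using f by (intro component_unique) auto
    then show "a \<in> {a. support a \<subseteq> K}" using f by (auto simp: support_def fin_families_def)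
  qed
next
  show "{a. support a \<subseteq> K} \<subseteq> component_sum S K"
  proof
    fix a assume "a \<in> {a. support a \<subseteq> K}"
    then have "component a \<in> fin_families S K" using assms component_family(1)[of a]
      by (auto simp: fin_families_def support_def)
    then show "a \<in> component_sum S K" unfolding component_sum_def
      using component_family(2)[of a] by (metis image_eqI)
  qed
qed

lemma in_S_iff: "x \<in> carrier G \<Longrightarrow> a \<in> S x \<longleftrightarrow> support a \<subseteq> {x}"
proof
  assume x: "x \<in> carrier G" and a: "support a \<subseteq> {x}"
  then have "(\<Sum>y\<in>{x}. component a y) = a" by (intro sum_components) auto
  then show "a \<in> S x" using x component_in[of x a] by simp
qed (auto simp: support_def component_homogeneous split: if_splits)

lemma homogeneous_support: "x \<in> carrier G \<Longrightarrow> a \<in> S x \<Longrightarrow> support a \<subseteq> {x}"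
  using in_S_iff by blast

lemma support_mult:
  assumes "support a \<subseteq> K" "support b \<subseteq> L" "z \<in> support (a * b)"
  shows "\<exists>x\<in>K. \<exists>y\<in>L. z = x \<otimes> y"
proof -
  have z: "z \<in> carrier G" using assms(3) support_carrier by blast
  have "component (a * b) z \<noteq> 0" using assms(3) by (simp add: support_def)
  then have "(\<Sum>x\<in>support a. component a x * component b (inv x \<otimes> z)) \<noteq> 0"
    using component_mult[OF z finite_support subset_refl support_carrier] by simp
  then obtain x where x: "x \<in> support a" "component a x * component b (inv x \<otimes> z) \<noteq> 0"
    by (meson sum.neutral)
  then have "inv x \<otimes> z \<in> support b" by (auto simp: support_def)
  moreover have "x \<in> carrier G" using x support_carrier by blast
  then have "z = x \<otimes> (inv x \<otimes> z)" using z by (simp add: m_assoc[symmetric])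
  ultimately show ?thesis using x assms by blast
qed

lemma support_add: "support (a + b) \<subseteq> support a \<union> support b"
  by (auto simp: support_def)

lemma support_zero [simp]: "support 0 = {}"
  by (auto simp: support_def)

lemma mult_vanish_homogeneous:
  assumes "\<And>x. x \<in> support s \<Longrightarrow> a * component s x * b = 0"
  shows "a * s * b = 0"
proof -
  have "a * s * b = a * (\<Sum>x\<in>support s. component s x) * b" by (simp add: sum_components)
  also have "\<dots> = (\<Sum>x\<in>support s. a * component s x * b)"
    by (simp add: sum_distrib_left sum_distrib_right)
  finally show ?thesis using assms by simp
qed

lemma S_one_mult:
  assumes "x \<in> carrier G" "b \<in> S x" "a \<in> S \<one>"
  shows "a * b \<in> S x" "b * a \<in> S x"
  using S_mult[of \<one> x a b] S_mult[of x \<one> b a] assms by auto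

lemma S_inv_mult_S:
  assumes "x \<in> carrier G" "a \<in> S x" "b \<in> S (inv x)"
  shows "a * b \<in> S \<one>" "b * a \<in> S \<one>"
  using assms S_mult[of x "inv x" a b] S_mult[of "inv x" x b a] by simp_all

lemma support_minus [simp]: "support (- a) = support a"
  by (simp add: support_def)

lemma proj_zero [simp]: "proj K 0 = 0"
  by (simp add: proj_def)

lemma support_mult_homogeneous:
  assumes h: "h \<in> carrier G" and s: "s \<in> S h" and z: "z \<in> support (a * s * b)"
  obtains x y where "x \<in> support a" "y \<in> support b" "z = x \<otimes> h \<otimes> y"
proof -
  obtain w y where w: "w \<in> support (a * s)" "y \<in> support b" "z = w \<otimes> y"
    using support_mult[OF subset_refl subset_refl z] by blast
  moreover obtain x where "x \<in> support a" "w = x \<otimes> h"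
    using support_mult[OF subset_refl homogeneous_support[OF h s] w(1)] by blast
  ultimately show ?thesis using that by blast
qed

lemma in_support_iff: "x \<in> support s \<longleftrightarrow> component s x \<noteq> 0"
  by (simp add: support_def)

text \<open>Meant for ideals of \<open>S \<one>\<close> such as \<open>S (inv h) e S h J\<close>:
  the left factor only has to absorb elements from the left and the right factor only from the
  right.\<close>

lemma product_hull_ideal:
  assumes left: "\<And>p r. p \<in> P \<Longrightarrow> r \<in> S \<one> \<Longrightarrow> r * p \<in> P" and neg: "\<And>p. p \<in> P \<Longrightarrow> - p \<in> P"
    and right: "\<And>q r. q \<in> Q \<Longrightarrow> r \<in> S \<one> \<Longrightarrow> q * r \<in> Q"
    and PQ: "\<And>p q. p \<in> P \<Longrightarrow> q \<in> Q \<Longrightarrow> p * q \<in> S \<one>"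
  shows "ideal_of (S \<one>) (additive_hull {p * q | p q. p \<in> P \<and> q \<in> Q})"
proof (rule hull_ideal[OF _ S_additive[OF one_closed]])
  show "{p * q | p q. p \<in> P \<and> q \<in> Q} \<subseteq> S \<one>" using PQ by blast
  fix x assume "x \<in> {p * q | p q. p \<in> P \<and> q \<in> Q}"
  then obtain p q where x: "x = p * q" "p \<in> P" "q \<in> Q" by blast
  have "- x = (- p) * q" by (simp add: x)
  then show "- x \<in> {p * q | p q. p \<in> P \<and> q \<in> Q}" using neg x by blast
  fix r assume r: "r \<in> S \<one>"
  have "r * x = (r * p) * q" "x * r = p * (q * r)" by (simp_all add: x mult.assoc)
  then show "r * x \<in> {p * q | p q. p \<in> P \<and> q \<in> Q}" "x * r \<in> {p * q | p q. p \<in> P \<and> q \<in> Q}"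
    using left right x r by blast+
qed

text \<open>The degrees \<open>y\<close> with \<open>J S y J \<noteq> 0\<close>. An admissible pair
  allows none of them outside its subgroup, so finding a smaller subgroup amounts to controlling
  this set for a smaller ideal.\<close>

definition linked :: "'r set \<Rightarrow> 'a \<Rightarrow> bool" where
  "linked J y \<longleftrightarrow> (\<exists>a\<in>J. \<exists>s\<in>S y. \<exists>b\<in>J. a * s * b \<noteq> 0)"

lemma linkedI: "a \<in> J \<Longrightarrow> s \<in> S y \<Longrightarrow> b \<in> J \<Longrightarrow> a * s * b \<noteq> 0 \<Longrightarrow> linked J y"
  unfolding linked_def by blast

lemma linked_mono: "J \<subseteq> K \<Longrightarrow> linked J y \<Longrightarrow> linked K y"
  unfolding linked_def by blast

end

section \<open>Non-degenerate gradings\<close>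

context graded
begin

lemma nonzero_ideal_withinD:
  assumes "nonzero_ideal_within S N I A"
  shows "A \<subseteq> component_sum S N" "additive_subgroup_set A" "0 \<in> A" "A \<noteq> {0}"
    "A \<subseteq> I \<star> component_sum S N"
proof -
  have *: "ideal_of (component_sum S N) A" "A \<noteq> {0}" "A \<subseteq> I \<star> component_sum S N"
    using assms by (simp_all add: nonzero_ideal_within_def)
  then show "A \<noteq> {0}" "A \<subseteq> I \<star> component_sum S N" by simp_all
  show "A \<subseteq> component_sum S N" "additive_subgroup_set A" using ideal_ofD(1,2)[OF *(1)] by simp_all
  then show "0 \<in> A" by (simp add: additive_subgroupD(1))
qed

text \<open>Vanishing outside \<open>H\<close> is stated as \<open>I S x I = 0\<close> rather than
  for the conjugate of \<open>I\<close>, since this is the form in which products are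
  computed.\<close>

definition admissible :: "'a set \<Rightarrow> 'r set \<Rightarrow> bool" where
  "admissible H I \<longleftrightarrow> subgroup H G \<and> ideal_of (S \<one>) I \<and>
    (\<forall>x\<in>H. \<forall>s\<in>S (inv x). \<forall>i\<in>I. \<forall>t\<in>S x. s * i * t \<in> I) \<and>
    (\<forall>x\<in>carrier G - H. \<forall>i\<in>I. \<forall>s\<in>S x. \<forall>j\<in>I. i * s * j = 0)"

lemma subgroup_invariant_iff:
  assumes "additive_subgroup_set I"
  shows "subgroup_invariant G S H I \<longleftrightarrow> (\<forall>x\<in>H. \<forall>s\<in>S (inv x). \<forall>i\<in>I. \<forall>t\<in>S x. s * i * t \<in> I)"
proof
  assume *: "subgroup_invariant G S H I"
  show "\<forall>x\<in>H. \<forall>s\<in>S (inv x). \<forall>i\<in>I. \<forall>t\<in>S x. s * i * t \<in> I"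
  proof (intro ballI)
    fix x s i t assume "x \<in> H" "s \<in> S (inv x)" "i \<in> I" "t \<in> S x"
    then have "s * i * t \<in> conj_set G S I x" unfolding conj_set_def by (intro mult_in_sum_mult)
    then show "s * i * t \<in> I" using * \<open>x \<in> H\<close> unfolding subgroup_invariant_def by blast
  qed
next
  assume "\<forall>x\<in>H. \<forall>s\<in>S (inv x). \<forall>i\<in>I. \<forall>t\<in>S x. s * i * t \<in> I"
  then show "subgroup_invariant G S H I"
    unfolding subgroup_invariant_def conj_set_def
    using additive_subgroupD[OF assms] by (intro ballI sum_mult3_subset) auto
qed

lemma quotient_invariant_iff:
  assumes "additive_subgroup_set I"
  shows "quotient_invariant G S H N I \<longleftrightarrow>
    (\<forall>x\<in>H. \<forall>s\<in>component_sum S (inv x <# N). \<forall>i\<in>I. \<forall>t\<in>component_sum S (x <# N). s * i * t \<in> I)"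
proof
  assume *: "quotient_invariant G S H N I"
  show "\<forall>x\<in>H. \<forall>s\<in>component_sum S (inv x <# N). \<forall>i\<in>I. \<forall>t\<in>component_sum S (x <# N). s * i * t \<in> I"
  proof (intro ballI)
    fix x s i t
    assume "x \<in> H" "s \<in> component_sum S (inv x <# N)" "i \<in> I" "t \<in> component_sum S (x <# N)"
    then have "s * i * t \<in> component_sum S (inv x <# N) \<star> I \<star> component_sum S (x <# N)"
      by (intro mult_in_sum_mult)
    then show "s * i * t \<in> I" using * \<open>x \<in> H\<close> unfolding quotient_invariant_def by blast
  qed
next
  assume "\<forall>x\<in>H. \<forall>s\<in>component_sum S (inv x <# N). \<forall>i\<in>I. \<forall>t\<in>component_sum S (x <# N). s * i * t \<in> I"
  then show "quotient_invariant G S H N I"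
    unfolding quotient_invariant_def
    using additive_subgroupD[OF assms] by (intro ballI sum_mult3_subset) auto
qed

lemma nondegenerateD:
  assumes "nondegenerately_graded G S" "x \<in> carrier G" "s \<in> S x" "s \<noteq> 0"
  shows "\<exists>t\<in>S (inv x). s * t \<noteq> 0" "\<exists>t\<in>S (inv x). t * s \<noteq> 0"
proof -
  have "{s} \<star> S (inv x) \<noteq> {0}" "S (inv x) \<star> {s} \<noteq> {0}"
    using assms by (auto simp: nondegenerately_graded_def)
  then show "\<exists>t\<in>S (inv x). s * t \<noteq> 0" "\<exists>t\<in>S (inv x). t * s \<noteq> 0"
    by (simp_all add: sum_mult_eq_zero_iff)
qed

text \<open>A product from \<open>I S x I\<close> is homogeneous of degree \<open>x\<close>. If the
  conjugate of \<open>I\<close> by \<open>x\<close> annihilates \<open>I\<close>, then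
  \<open>S (inv x)\<close> annihilates this product from the left, and non-degeneracy makes it
  zero.\<close>

lemma admissible_iff:
  assumes nd: "nondegenerately_graded G S"
  shows "admissible H I \<longleftrightarrow> subgroup H G \<and> admissible_ideal G S H I"
proof -
  have "(\<forall>x\<in>carrier G - H. \<forall>i\<in>I. \<forall>s\<in>S x. \<forall>j\<in>I. i * s * j = 0) \<longleftrightarrow>
    (\<forall>x\<in>carrier G - H. conj_set G S I x \<star> I = {0})" if I: "ideal_of (S \<one>) I"
  proof
    assume L: "\<forall>x\<in>carrier G - H. \<forall>i\<in>I. \<forall>s\<in>S x. \<forall>j\<in>I. i * s * j = 0"
    show "\<forall>x\<in>carrier G - H. conj_set G S I x \<star> I = {0}"
    proof (intro ballI)
      fix x assume x: "x \<in> carrier G - H"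
      have "c * j = 0" if "c \<in> conj_set G S I x" "j \<in> I" for c j
      proof -
        have "conj_set G S I x \<subseteq> {c. c * j = 0}"
          unfolding conj_set_def
        proof (rule sum_mult3_subset)
          fix u i s assume "u \<in> S (inv x)" "i \<in> I" "s \<in> S x"
          then have "i * s * j = 0" using L x \<open>j \<in> I\<close> by blast
          then show "u * i * s \<in> {c. c * j = 0}" by (simp add: mult.assoc)
        qed (auto simp: distrib_right)
        then show ?thesis using that by blast
      qed
      then show "conj_set G S I x \<star> I = {0}" by (simp add: sum_mult_eq_zero_iff)
    qed
  next
    assume R: "\<forall>x\<in>carrier G - H. conj_set G S I x \<star> I = {0}"
    show "\<forall>x\<in>carrier G - H. \<forall>i\<in>I. \<forall>s\<in>S x. \<forall>j\<in>I. i * s * j = 0"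
    proof (intro ballI, rule ccontr)
      fix x i s j assume x: "x \<in> carrier G - H" and *: "i \<in> I" "s \<in> S x" "j \<in> I" "i * s * j \<noteq> 0"
      have "i \<in> S \<one>" "j \<in> S \<one>" using * ideal_ofD(1)[OF I] by auto
      then have "i * s \<in> S x" "i * s * j \<in> S x" using * x by (auto intro: S_one_mult)
      then obtain t where t: "t \<in> S (inv x)" "t * (i * s * j) \<noteq> 0"
        using nondegenerateD(2)[OF nd, of x] * x by auto
      have "t * i * s \<in> conj_set G S I x" unfolding conj_set_def using t * by (intro mult_in_sum_mult)
      then have "t * i * s * j = 0" using R x * by (auto simp: sum_mult_eq_zero_iff)
      then show False using t by (simp add: mult.assoc)
    qed
  qed
  then show ?thesis
    unfolding admissible_def admissible_ideal_def
    using subgroup_invariant_iff[of I H] ideal_ofD(2)[of "S \<one>" I] by blast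
qed

lemma support_mult_coset:
  assumes H: "subgroup H G" and N: "normal_in N H" and u: "u \<in> H" and v: "v \<in> H"
    and p: "support p \<subseteq> u <# N" and q: "support q \<subseteq> v <# N"
  shows "support (p * q) \<subseteq> (u \<otimes> v) <# N"
proof
  fix z assume "z \<in> support (p * q)"
  from support_mult[OF p q this] obtain x y where "x \<in> u <# N" "y \<in> v <# N" "z = x \<otimes> y" by blast
  then show "z \<in> (u \<otimes> v) <# N" using coset_mult[OF H N u v] by blast
qed

lemma l_coset_carrier: "subgroup H G \<Longrightarrow> normal_in N H \<Longrightarrow> u \<in> H \<Longrightarrow> u <# N \<subseteq> carrier G"
  by (rule l_coset_subset_G) (auto simp: normal_in_def dest: subgroup.subset)

section \<open>The implications from (e) down to (a)\<close>

text \<open>If \<open>a s b\<close> were nonzero for some \<open>s\<close> of degree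
  \<open>h\<close> in \<open>H\<close>, it would have a nonzero component in a degree
  \<open>z\<close> of the coset \<open>h <# N\<close>, and some \<open>t\<close> in
  \<open>S (inv z)\<close> would keep it nonzero. The degree of \<open>t\<close> lies in
  \<open>inv h <# N\<close>, so \<open>t a s\<close> is in \<open>A\<close> by invariance and
  \<open>t a s b\<close> is in \<open>A B = 0\<close>.\<close>

lemma assertion_e_imp_d:
  assumes nd: "nondegenerately_graded G S" and e: "assertion_e G S"
  shows "assertion_d G S"
proof -
  obtain N H I A B where *: "normal_pair G N H" "finite N" "admissible_ideal G S H I"
    "nonzero_ideal_within S N I A" "nonzero_ideal_within S N I B"
    "quotient_invariant G S H N A" "quotient_invariant G S H N B" "A \<star> B = {0}"
    using e unfolding assertion_e_def by blast
  have H: "subgroup H G" and N: "normal_in N H" using *(1) by (auto simp: normal_pair_iff)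
  have NG: "subgroup N G" using N by (simp add: normal_in_def)
  have Hc: "h \<in> H \<Longrightarrow> h \<in> carrier G" for h using H by (simp add: subgroup.mem_carrier)
  have Hi: "h \<in> H \<Longrightarrow> inv h \<in> H" for h using H by (simp add: subgroup.m_inv_closed)
  have addA: "additive_subgroup_set A" and addB: "additive_subgroup_set B"
    using *(4,5) by (auto dest: nonzero_ideal_withinD(2))
  have rep: "u \<in> u <# N" if "u \<in> H" for u
    unfolding l_coset_def using that Hc subgroup.one_closed[OF NG] by (intro UN_I[of \<one>]) auto
  have hom: "S u \<subseteq> component_sum S (u <# N)" if "u \<in> H" for u
    using homogeneous_support[OF Hc[OF that]] rep[OF that]
    by (subst component_sum_eq[OF l_coset_carrier[OF H N that]]) blast
  have inv: "subgroup_invariant G S H C"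
    if "additive_subgroup_set C" "quotient_invariant G S H N C" for C
    unfolding subgroup_invariant_iff[OF that(1)]
  proof (intro ballI)
    fix x s i t assume "x \<in> H" "s \<in> S (inv x)" "i \<in> C" "t \<in> S x"
    then show "s * i * t \<in> C"
      using that(2) hom[of x] hom[of "inv x"] Hi unfolding quotient_invariant_iff[OF that(1)] by blast
  qed
  have "a * s * b = 0" if a: "a \<in> A" and b: "b \<in> B" and s: "s \<in> component_sum S H" for a s b
  proof (rule mult_vanish_homogeneous, rule ccontr)
    fix h assume h: "h \<in> support s" and ne: "a * component s h * b \<noteq> 0"
    have hH: "h \<in> H" using h s component_sum_eq[OF subgroup.subset[OF H]] by auto
    have supp: "support a \<subseteq> \<one> <# N" "support b \<subseteq> \<one> <# N"
      using a b nonzero_ideal_withinD(1)[OF *(4)] nonzero_ideal_withinD(1)[OF *(5)]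
        component_sum_eq[OF subgroup.subset[OF NG]] l_coset_one[OF subgroup.subset[OF NG]] by auto
    have sS: "component s h \<in> S h" using Hc[OF hH] by simp
    have sh: "support (component s h) \<subseteq> h <# N"
      using homogeneous_support[OF Hc[OF hH] sS] rep[OF hH] by blast
    have "support (a * component s h * b) \<subseteq> (\<one> \<otimes> h \<otimes> \<one>) <# N"
      using hH H subgroup.one_closed[OF H]
      by (intro support_mult_coset[OF H N] supp sh subgroup.m_closed)
    then have cos: "support (a * component s h * b) \<subseteq> h <# N" using Hc[OF hH] by simp
    obtain z where z: "z \<in> carrier G" "component (a * component s h * b) z \<noteq> 0"
      using nonzero_support[OF ne] by blast
    obtain t where t: "t \<in> S (inv z)" "t * component (a * component s h * b) z \<noteq> 0"
      using nondegenerateD(2)[OF nd z(1) component_in[OF z(1)] z(2)] by blast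
    obtain n where n: "n \<in> N" "z = h \<otimes> n"
      using cos z by (auto simp: support_def l_coset_def)
    have nc: "n \<in> carrier G" using n NG by (simp add: subgroup.mem_carrier)
    have "inv z = inv n \<otimes> inv h" using n nc Hc[OF hH] by (simp add: inv_mult_group)
    moreover have "inv n \<in> \<one> <# N"
      using n NG l_coset_one[OF subgroup.subset[OF NG]] by (simp add: subgroup.m_inv_closed)
    ultimately have "inv z \<in> (\<one> \<otimes> inv h) <# N"
      using coset_mult[OF H N subgroup.one_closed[OF H] Hi[OF hH]] rep[OF Hi[OF hH]] by simp
    then have "support t \<subseteq> inv h <# N"
      using homogeneous_support[OF _ t(1)] z(1) Hc[OF hH] by auto
    then have "t \<in> component_sum S (inv h <# N)" "component s h \<in> component_sum S (h <# N)"
      using component_sum_eq[OF l_coset_carrier[OF H N]] hH Hi sh by auto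
    then have "t * a * component s h \<in> A"
      using *(6) hH a unfolding quotient_invariant_iff[OF addA] by blast
    then have "t * (a * component s h * b) = 0"
      using *(8) b by (auto simp: sum_mult_eq_zero_iff mult.assoc)
    moreover have "component (t * (a * component s h * b)) \<one> = t * component (a * component s h * b) z"
      using component_homogeneous_mult[OF _ t(1), of \<one>] z(1) by simp
    ultimately show False using t(2) by simp
  qed
  then have "A \<star> component_sum S H \<star> B = {0}" by (simp add: sum_mult3_eq_zero_iff)
  then show ?thesis
    unfolding assertion_d_def using * inv[OF addA *(6)] inv[OF addB *(7)] by blast
qed

lemma assertion_d_imp_c: "assertion_d G S \<Longrightarrow> assertion_c G S"
  unfolding assertion_d_def assertion_c_def by blast

lemma assertion_c_imp_b: "assertion_c G S \<Longrightarrow> assertion_b G S"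
  unfolding assertion_c_def assertion_b_def by blast

text \<open>A ring without identity may satisfy \<open>S a S = 0\<close> with \<open>a\<close>
  nonzero. Non-degeneracy excludes this: a left factor moves a nonzero component to degree
  \<open>\<one>\<close>, and a right factor of degree \<open>\<one>\<close> keeps it
  nonzero.\<close>

lemma two_sided_nonzero:
  assumes nd: "nondegenerately_graded G S" and a: "a \<noteq> (0 :: 'r)"
  obtains p q where "p * a * q \<noteq> 0"
proof -
  obtain x where x: "x \<in> carrier G" "component a x \<noteq> 0" using nonzero_support[OF a] by blast
  obtain t where t: "t \<in> S (inv x)" "t * component a x \<noteq> 0"
    using nondegenerateD(2)[OF nd x(1) component_in[OF x(1)] x(2)] by blast
  have 1: "component (t * a) \<one> \<noteq> 0"
    using component_homogeneous_mult[OF _ t(1), of \<one> a] x t by simp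
  then obtain q where q: "q \<in> S (inv \<one>)" "component (t * a) \<one> * q \<noteq> 0"
    using nondegenerateD(1)[OF nd, of \<one> "component (t * a) \<one>"] by auto
  then have "component (t * a * q) \<one> \<noteq> 0"
    using component_mult_homogeneous[of \<one> q \<one> "t * a"] by simp
  then have "t * a * q \<noteq> 0" by auto
  then show ?thesis by (rule that)
qed

lemma additive_UNIV: "additive_subgroup_set (UNIV :: 'r set)"
  by (simp add: additive_subgroup_set_def)

text \<open>It suffices that \<open>A S x B = 0\<close> in every degree \<open>x\<close>. For
  \<open>x\<close> in \<open>H\<close> this is given. For other \<open>x\<close>, both ideals start
  with a factor from \<open>I\<close>, and between these factors stands an element of degree
  \<open>n \<otimes> x\<close> with \<open>n\<close> in \<open>N\<close>, which is again outside
  \<open>H\<close>.\<close>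

lemma assertion_b_imp_a:
  assumes nd: "nondegenerately_graded G S" and b: "assertion_b G S"
  shows "assertion_a G S"
proof -
  obtain N H I A B where *: "normal_pair G N H" "admissible_ideal G S H I"
    "nonzero_ideal_within S N I A" "nonzero_ideal_within S N I B"
    "A \<star> component_sum S H \<star> B = {0}"
    using b unfolding assertion_b_def by blast
  have H: "subgroup H G" and N: "normal_in N H" using *(1) by (auto simp: normal_pair_iff)
  have NG: "subgroup N G" and NH: "N \<subseteq> H" using N by (simp_all add: normal_in_def)
  have Nc: "N \<subseteq> carrier G" using NG by (rule subgroup.subset)
  have adm: "admissible H I" using admissible_iff[OF nd] *(2) H by blast
  have I0: "i * s * j = 0" if "x \<in> carrier G" "x \<notin> H" "i \<in> I" "s \<in> S x" "j \<in> I" for x i s j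
    using adm that unfolding admissible_def by blast
  have hom: "a * s * b = 0" if a: "a \<in> A" and b: "b \<in> B" and x: "x \<in> carrier G" and s: "s \<in> S x" for a b s x
  proof (cases "x \<in> H")
    case True
    then have "s \<in> component_sum S H"
      using homogeneous_support[OF x s] component_sum_eq[OF subgroup.subset[OF H]] by auto
    then show ?thesis using *(5) a b by (auto simp: sum_mult3_eq_zero_iff)
  next
    case False
    have "a \<in> I \<star> component_sum S N" "b \<in> I \<star> component_sum S N"
      using *(3,4) a b nonzero_ideal_withinD(5) by blast+
    moreover have "I \<star> component_sum S N \<subseteq> {a. a * s * b = 0}" if "b \<in> I \<star> component_sum S N" for b
    proof (rule sum_mult_subset)
      fix i u assume i: "i \<in> I" and u: "u \<in> component_sum S N"
      have "I \<star> component_sum S N \<subseteq> {b. i * u * s * b = 0}"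
      proof (rule sum_mult_subset)
        fix j v assume j: "j \<in> I"
        have "i * u * (s * j) = 0"
        proof (rule mult_vanish_homogeneous)
          fix n assume "n \<in> support u"
          then have n: "n \<in> N" using u component_sum_eq[OF Nc] by auto
          have nc: "n \<in> carrier G" "n \<in> H" using n Nc NH by auto
          have "n \<otimes> x \<notin> H"
          proof
            assume "n \<otimes> x \<in> H"
            then have "inv n \<otimes> (n \<otimes> x) \<in> H"
              by (rule subgroup.m_closed[OF H subgroup.m_inv_closed[OF H nc(2)]])
            then show False using False nc x by (simp add: m_assoc[symmetric])
          qed
          moreover have "component u n * s \<in> S (n \<otimes> x)" using nc x s by (intro S_mult) auto
          ultimately have "i * (component u n * s) * j = 0" using i j nc x by (intro I0) auto
          then show "i * component u n * (s * j) = 0" by (simp add: mult.assoc)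
        qed
        then show "j * v \<in> {b. i * u * s * b = 0}" by (metis (mono_tags, lifting) mem_Collect_eq mult.assoc mult_zero_left)
      qed (auto simp: distrib_left)
      then show "i * u \<in> {a. a * s * b = 0}" using that by blast
    qed (auto simp: distrib_right)
    ultimately show ?thesis by blast
  qed
  have van: "a * s * b = 0" if "a \<in> A" "b \<in> B" for a b s
    by (rule mult_vanish_homogeneous) (use hom that support_carrier in \<open>blast intro: component_in\<close>)
  \<comment> \<open>The span of \<open>S C S\<close> is an ideal of the whole ring even when it does
    not contain \<open>C\<close>; without identity it is easier to handle than the ideal generated
    by \<open>C\<close>.\<close>
  define gen where "gen C = additive_hull {p * a * q | p a q. a \<in> C}" for C :: "'r set"
  have gen: "ideal_of UNIV (gen C)" for C
    unfolding gen_def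
  proof (rule hull_ideal)
    fix x assume "x \<in> {p * a * q | p a q. a \<in> C}"
    then obtain p a q where x: "x = p * a * q" "a \<in> C" by blast
    then have "- x = (- p) * a * q" by simp
    then show "- x \<in> {p * a * q | p a q. a \<in> C}" using x by blast
    show "r * x \<in> {p * a * q | p a q. a \<in> C}" for r
      using x by (intro CollectI exI[of _ "r * p"] exI[of _ a] exI[of _ q]) (simp add: mult.assoc)
    show "x * r \<in> {p * a * q | p a q. a \<in> C}" for r
      using x by (intro CollectI exI[of _ p] exI[of _ a] exI[of _ "q * r"]) (simp add: mult.assoc)
  qed (auto simp: additive_UNIV)
  have ne: "\<not> gen C \<subseteq> {0}" if C: "C \<noteq> {0}" "0 \<in> C" for C
  proof -
    obtain a where a: "a \<in> C" "a \<noteq> 0" using C by blast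
    obtain p q where pq: "p * a * q \<noteq> 0" using two_sided_nonzero[OF nd a(2)] by blast
    have "p * a * q \<in> gen C" unfolding gen_def using a by (intro hull_base) blast
    then show ?thesis using pq by blast
  qed
  have "gen A \<star> gen B = {0}"
    unfolding sum_mult_eq_zero_iff
  proof (intro ballI)
    fix x y assume x: "x \<in> gen A" and y: "y \<in> gen B"
    have base: "x * y = 0" if "a \<in> A" "x = p * a * q" for x p a q
      using y unfolding gen_def
    proof (rule hull_vanish[rotated -1])
      fix z assume "z \<in> {p * a * q | p a q. a \<in> B}"
      then obtain p' b q' where z: "z = p' * b * q'" "b \<in> B" by blast
      have "x * z = p * (a * (q * p') * b) * q'" unfolding that(2) z(1) by (simp add: mult.assoc)
      then show "x * z = 0" using van[OF that(1) z(2)] by simp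
    qed (auto simp: distrib_left)
    show "x * y = 0"
      using x unfolding gen_def
    proof (rule hull_vanish[rotated -1])
      fix z assume "z \<in> {p * a * q | p a q. a \<in> A}"
      then show "z * y = 0" using base by blast
    qed (auto simp: distrib_right)
  qed
  moreover have "0 \<in> A" "0 \<in> B" "A \<noteq> {0}" "B \<noteq> {0}"
    using *(3,4) by (auto dest: nonzero_ideal_withinD)
  ultimately show ?thesis
    unfolding assertion_a_def prime_ring_def prime_ideal_of_def
    using gen[of A] gen[of B] ne[of A] ne[of B] by (metis subset_refl)
qed

end

section \<open>Nearly epsilon-strong gradings\<close>

locale nearly_epsilon_strong = graded G S for G (structure) and S :: "'a \<Rightarrow> 'r::ring set" +
  assumes nearly_epsilon: "nearly_epsilon_strongly_graded G S"
begin

section \<open>Cancellation and local units\<close>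

lemma epsilon_left:
  assumes "x \<in> carrier G" "p \<in> S x"
  obtains \<epsilon> where "\<epsilon> \<in> S x \<star> S (inv x)" "\<epsilon> * p = p"
  using nearly_epsilon assms unfolding nearly_epsilon_strongly_graded_def by metis

lemma epsilon_right:
  assumes "x \<in> carrier G" "p \<in> S x"
  obtains \<epsilon> where "\<epsilon> \<in> S (inv x) \<star> S x" "p * \<epsilon> = p"
  using nearly_epsilon assms unfolding nearly_epsilon_strongly_graded_def by metis

text \<open>Stronger than non-degeneracy in that \<open>b\<close> need not be homogeneous:
  \<open>p * b\<close> is a multiple of itself by an element of
  \<open>S x \<star> S (inv x)\<close>, and the inner factor already kills it.\<close>

lemma left_cancel:
  assumes x: "x \<in> carrier G" and p: "p \<in> S x" and z: "\<And>q. q \<in> S (inv x) \<Longrightarrow> q * (p * b) = 0"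
  shows "p * b = 0"
proof -
  obtain e where e: "e \<in> S x \<star> S (inv x)" "e * p = p" using epsilon_left[OF x p] .
  have "S x \<star> S (inv x) \<subseteq> {e. e * (p * b) = 0}"
    by (rule sum_mult_subset) (auto simp: distrib_right mult.assoc z)
  then have "e * (p * b) = 0" using e(1) by blast
  then show ?thesis using e(2) by (simp add: mult.assoc[symmetric])
qed

lemma right_cancel:
  assumes x: "x \<in> carrier G" and p: "p \<in> S x" and z: "\<And>q. q \<in> S (inv x) \<Longrightarrow> b * p * q = 0"
  shows "b * p = 0"
proof -
  obtain e where e: "e \<in> S (inv x) \<star> S x" "p * e = p" using epsilon_right[OF x p] .
  have "S (inv x) \<star> S x \<subseteq> {e. b * p * e = 0}"
    by (rule sum_mult_subset) (auto simp: distrib_left mult.assoc[symmetric] z)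
  then have "b * p * e = 0" using e(1) by blast
  then show ?thesis using e(2) by (simp add: mult.assoc)
qed

lemma unit_left:
  assumes x: "x \<in> carrier G" and p: "p \<in> S x"
  obtains u where "u \<in> S \<one>" "u * p = p"
proof -
  obtain e where e: "e \<in> S x \<star> S (inv x)" "e * p = p" using epsilon_left[OF x p] .
  have "S x \<star> S (inv x) \<subseteq> S \<one>"
    by (rule sum_mult_subset) (use x S_inv_mult_S in \<open>auto intro: S_add\<close>)
  then show ?thesis using that e by blast
qed

lemma unit_right:
  assumes x: "x \<in> carrier G" and p: "p \<in> S x"
  obtains u where "u \<in> S \<one>" "p * u = p"
proof -
  obtain e where e: "e \<in> S (inv x) \<star> S x" "p * e = p" using epsilon_right[OF x p] .
  have "S (inv x) \<star> S x \<subseteq> S \<one>"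
    by (rule sum_mult_subset) (use x S_inv_mult_S in \<open>auto intro: S_add\<close>)
  then show ?thesis using that e by blast
qed

lemma nondegenerate: "nondegenerately_graded G S"
  unfolding nondegenerately_graded_def
proof (intro ballI impI conjI)
  fix x s assume x: "x \<in> carrier G" and s: "s \<in> S x" "s \<noteq> 0"
  obtain u where u: "u * s = s" using unit_left[OF x s(1)] by blast
  obtain v where v: "s * v = s" using unit_right[OF x s(1)] by blast
  show "{s} \<star> S (inv x) \<noteq> {0}"
    using right_cancel[OF x s(1), of u] s u by (auto simp: sum_mult_eq_zero_iff)
  show "S (inv x) \<star> {s} \<noteq> {0}"
    using left_cancel[OF x s(1), of v] s v by (auto simp: sum_mult_eq_zero_iff)
qed

lemmas nondegD = nondegenerateD[OF nondegenerate]

lemma admissibleD: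
  assumes "admissible H I"
  shows "subgroup H G" "ideal_of (S \<one>) I"
    "x \<in> H \<Longrightarrow> s \<in> S (inv x) \<Longrightarrow> i \<in> I \<Longrightarrow> t \<in> S x \<Longrightarrow> s * i * t \<in> I"
    "x \<in> carrier G \<Longrightarrow> x \<notin> H \<Longrightarrow> i \<in> I \<Longrightarrow> s \<in> S x \<Longrightarrow> j \<in> I \<Longrightarrow> i * s * j = 0"
    "i \<in> I \<Longrightarrow> i \<in> S \<one>" "h \<in> H \<Longrightarrow> h \<in> carrier G" "h \<in> H \<Longrightarrow> inv h \<in> H"
  using assms ideal_ofD(1)[of "S \<one>" I]
  by (auto simp: admissible_def subgroup.mem_carrier subgroup.m_inv_closed)

section \<open>The ideal generated by I in the subring of degrees H\<close>

text \<open>Invariance only concerns conjugates. Writing \<open>s * i\<close> as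
  \<open>s * i * e\<close> with \<open>e\<close> in \<open>S (inv h) \<star> S h\<close>, invariance
  under \<open>inv h\<close> absorbs the part \<open>s * i * q\<close> into \<open>I\<close> and
  leaves a factor of \<open>S h\<close> on the right.\<close>

lemma admissible_swap:
  assumes adm: "admissible H I" and h: "h \<in> H" and s: "s \<in> S h" and i: "i \<in> I"
  shows "s * i \<in> I \<star> S h"
proof -
  note A = admissibleD[OF adm]
  have hc: "h \<in> carrier G" using A h by blast
  have "s * i \<in> S h" using S_one_mult(2)[OF hc s A(5)[OF i]] .
  then obtain e where e: "e \<in> S (inv h) \<star> S h" "s * i * e = s * i" using epsilon_right[OF hc] by metis
  have "S (inv h) \<star> S h \<subseteq> {e. s * i * e \<in> I \<star> S h}"
  proof (rule sum_mult_subset)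
    fix q r assume q: "q \<in> S (inv h)" and r: "r \<in> S h"
    have "s * i * q \<in> I" using A(3)[of "inv h" s i q] A(7)[OF h] s i q hc by simp
    then have "s * i * q * r \<in> I \<star> S h" using r by (rule mult_in_sum_mult)
    then show "q * r \<in> {e. s * i * e \<in> I \<star> S h}" by (simp add: mult.assoc)
  qed (auto simp: distrib_left sum_mult_zero sum_mult_add)
  then show ?thesis using e by auto
qed

text \<open>The set \<open>I S\<^sub>H\<close>, described by components. It is a two-sided ideal of
  \<open>S\<^sub>H\<close>, on the left because elements of \<open>I\<close> can be moved past
  homogeneous factors of degree in \<open>H\<close>. Keeping all elements here guarantees that the
  ideals built from them lie in \<open>I S\<^sub>N\<close>.\<close>

definition reduced :: "'a set \<Rightarrow> 'r set \<Rightarrow> 'r set" where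
  "reduced H I = {a. support a \<subseteq> H \<and> (\<forall>x\<in>H. component a x \<in> I \<star> S x)}"

lemma reduced_zero: "0 \<in> reduced H I"
  by (simp add: reduced_def sum_mult_zero)

lemma reduced_add: "a \<in> reduced H I \<Longrightarrow> b \<in> reduced H I \<Longrightarrow> a + b \<in> reduced H I"
  unfolding reduced_def using support_add[of a b] by (auto simp: sum_mult_add)

lemma reduced_minus:
  assumes "admissible H I" "a \<in> reduced H I" shows "- a \<in> reduced H I"
proof -
  have "additive_subgroup_set I" using admissibleD(2)[OF assms(1)] by (rule ideal_ofD(2))
  then have "- c \<in> I \<star> S x" if "c \<in> I \<star> S x" for c x
    using that by (auto intro: sum_mult_minus additive_subgroupD(3))
  then show ?thesis using assms(2) by (auto simp: reduced_def support_def)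
qed

lemma reduced_sum: "(\<And>i. i \<in> A \<Longrightarrow> f i \<in> reduced H I) \<Longrightarrow> sum f A \<in> reduced H I"
  by (induction A rule: infinite_finite_induct) (auto simp: reduced_zero reduced_add)

lemma reduced_proj: "a \<in> reduced H I \<Longrightarrow> proj K a \<in> reduced H I"
  unfolding reduced_def by (auto simp: sum_mult_zero)

lemma reduced_mult_left1:
  assumes adm: "admissible H I" and h: "h \<in> H" and s: "s \<in> S h" and a: "a \<in> reduced H I"
  shows "s * a \<in> reduced H I"
proof -
  note A = admissibleD[OF adm]
  have hc: "h \<in> carrier G" using A h by blast
  have "support s \<subseteq> {h}" using homogeneous_support[OF hc s] .
  moreover have "support a \<subseteq> H" using a by (simp add: reduced_def)
  ultimately have "support (s * a) \<subseteq> H"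
    using support_mult[of s "{h}" a H] h A(1) by (auto dest: subgroup.m_closed)
  moreover have "component (s * a) z \<in> I \<star> S z" if z: "z \<in> H" for z
  proof -
    have zc: "z \<in> carrier G" using A z by blast
    have "inv h \<otimes> z \<in> H" using A(1) A(7)[OF h] z by (rule subgroup.m_closed)
    then have "component a (inv h \<otimes> z) \<in> I \<star> S (inv h \<otimes> z)" using a by (simp add: reduced_def)
    moreover have "I \<star> S (inv h \<otimes> z) \<subseteq> {c. s * c \<in> I \<star> S z}"
    proof (rule sum_mult_subset)
      fix i r assume i: "i \<in> I" and r: "r \<in> S (inv h \<otimes> z)"
      have "I \<star> S h \<subseteq> {c. c * r \<in> I \<star> S z}"
      proof (rule sum_mult_subset)
        fix i' s' assume "i' \<in> I" "s' \<in> S h"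
        moreover have "s' * r \<in> S z" if "s' \<in> S h" for s'
          by (rule S_mult'[OF hc _ that r]) (use hc zc in \<open>auto simp: m_assoc[symmetric]\<close>)
        ultimately have "i' * (s' * r) \<in> I \<star> S z" by (intro mult_in_sum_mult) auto
        then show "i' * s' \<in> {c. c * r \<in> I \<star> S z}" by (simp add: mult.assoc)
      qed (auto simp: distrib_right sum_mult_zero sum_mult_add)
      then have "s * i * r \<in> I \<star> S z" using admissible_swap[OF adm h s i] by blast
      then show "i * r \<in> {c. s * c \<in> I \<star> S z}" by (simp add: mult.assoc)
    qed (auto simp: distrib_left sum_mult_zero sum_mult_add)
    ultimately show ?thesis using component_homogeneous_mult[OF hc s zc, of a] by auto
  qed
  ultimately show ?thesis by (simp add: reduced_def)
qed

lemma reduced_mult_right1: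
  assumes adm: "admissible H I" and h: "h \<in> H" and s: "s \<in> S h" and a: "a \<in> reduced H I"
  shows "a * s \<in> reduced H I"
proof -
  note A = admissibleD[OF adm]
  have hc: "h \<in> carrier G" using A h by blast
  have "support s \<subseteq> {h}" using homogeneous_support[OF hc s] .
  moreover have "support a \<subseteq> H" using a by (simp add: reduced_def)
  ultimately have "support (a * s) \<subseteq> H"
    using support_mult[of a H s "{h}"] h A(1) by (auto dest: subgroup.m_closed)
  moreover have "component (a * s) z \<in> I \<star> S z" if z: "z \<in> H" for z
  proof -
    have zc: "z \<in> carrier G" using A z by blast
    have "z \<otimes> inv h \<in> H" using A(1) z A(7)[OF h] by (rule subgroup.m_closed)
    then have "component a (z \<otimes> inv h) \<in> I \<star> S (z \<otimes> inv h)" using a by (simp add: reduced_def)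
    moreover have "I \<star> S (z \<otimes> inv h) \<subseteq> {c. c * s \<in> I \<star> S z}"
    proof (rule sum_mult_subset)
      fix i r assume i: "i \<in> I" and r: "r \<in> S (z \<otimes> inv h)"
      have "r * s \<in> S z" by (rule S_mult'[OF _ hc r s]) (use hc zc in \<open>auto simp: m_assoc\<close>)
      then have "i * (r * s) \<in> I \<star> S z" using i by (intro mult_in_sum_mult)
      then show "i * r \<in> {c. c * s \<in> I \<star> S z}" by (simp add: mult.assoc)
    qed (auto simp: distrib_right sum_mult_zero sum_mult_add)
    ultimately show ?thesis using component_mult_homogeneous[OF hc s zc, of a] by auto
  qed
  ultimately show ?thesis by (simp add: reduced_def)
qed

lemma reduced_mult_left:
  assumes adm: "admissible H I" and s: "support s \<subseteq> H" and a: "a \<in> reduced H I"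
  shows "s * a \<in> reduced H I"
proof -
  have "s * a = (\<Sum>x\<in>support s. component s x * a)"
    by (simp add: sum_distrib_right[symmetric] sum_components)
  also have "\<dots> \<in> reduced H I"
    using s support_carrier[of s] by (intro reduced_sum reduced_mult_left1[OF adm _ _ a]) auto
  finally show ?thesis .
qed

lemma reduced_mult_right:
  assumes adm: "admissible H I" and s: "support s \<subseteq> H" and a: "a \<in> reduced H I"
  shows "a * s \<in> reduced H I"
proof -
  have "a * s = (\<Sum>x\<in>support s. a * component s x)"
    by (simp add: sum_distrib_left[symmetric] sum_components)
  also have "\<dots> \<in> reduced H I"
    using s support_carrier[of s] by (intro reduced_sum reduced_mult_right1[OF adm _ _ a]) auto
  finally show ?thesis .
qed

lemma support_mult_subgroup:
  assumes "subgroup H G" "support a \<subseteq> H" "support b \<subseteq> H"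
  shows "support (a * b) \<subseteq> H"
  using support_mult[OF assms(2,3)] assms(1) by (auto dest: subgroup.m_closed)

lemma reduced_in_sum_mult:
  assumes a: "a \<in> reduced H I" and N: "support a \<subseteq> N" "N \<subseteq> H" "N \<subseteq> carrier G"
  shows "a \<in> I \<star> component_sum S N"
proof -
  have "component a x \<in> I \<star> component_sum S N" if x: "x \<in> support a" for x
  proof -
    have xc: "x \<in> carrier G" "x \<in> N" "x \<in> H" using x N by auto
    have "I \<star> S x \<subseteq> I \<star> component_sum S N"
    proof (rule sum_mult_subset)
      fix i s assume "i \<in> I" "s \<in> S x"
      moreover then have "s \<in> component_sum S N"
        using homogeneous_support[OF xc(1)] xc(2) component_sum_eq[OF N(3)] by blast
      ultimately show "i * s \<in> I \<star> component_sum S N" by (intro mult_in_sum_mult)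
    qed (auto simp: sum_mult_zero sum_mult_add)
    then show ?thesis using a xc by (auto simp: reduced_def)
  qed
  then have "(\<Sum>x\<in>support a. component a x) \<in> I \<star> component_sum S N"
    unfolding sum_mult_eq_hull by (intro sum_in_hull) auto
  then show ?thesis by (simp add: sum_components)
qed

lemma two_sided_nonzero_one:
  assumes a: "a \<noteq> 0"
  obtains p q where "p \<in> S \<one>" "q \<in> S \<one>" "p * a * q \<noteq> 0"
proof -
  obtain x where x: "x \<in> carrier G" "component a x \<noteq> 0" using nonzero_support[OF a] by blast
  obtain p where p: "p \<in> S \<one>" "p * component a x = component a x"
    using unit_left[OF x(1) component_in[OF x(1)]] by blast
  obtain q where q: "q \<in> S \<one>" "component a x * q = component a x"
    using unit_right[OF x(1) component_in[OF x(1)]] by blast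
  have "component (p * a * q) x = component a x"
    using component_mult_homogeneous[OF _ q(1), of x "p * a"] component_homogeneous_mult[OF _ p(1), of x a]
      x p q by simp
  then have "p * a * q \<noteq> 0" using x by auto
  then show ?thesis using that p q by blast
qed

section \<open>From an annihilating pair to assertion (e)\<close>

text \<open>For \<open>c\<close> equal to \<open>a\<close> or \<open>b\<close>, the products
  \<open>p c q\<close> with the degrees of \<open>p\<close> in \<open>inv h <# N\<close> and of
  \<open>q\<close> in \<open>h <# N\<close>, over all \<open>h\<close> in \<open>H\<close>, span an
  \<open>H/N\<close>-invariant ideal of \<open>S\<^sub>N\<close>, nonzero by local units. In a
  product of the two ideals, what stands between \<open>a\<close> and \<open>b\<close> is supported
  in \<open>H\<close>, where the hypothesis \<open>zero\<close> applies.\<close>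

lemma finite_normal_imp_assertion_e:
  assumes adm: "admissible H I" and N: "normal_in N H" and fin: "finite N"
    and a: "a \<in> reduced H I" "support a \<subseteq> N" "a \<noteq> 0"
    and b: "b \<in> reduced H I" "support b \<subseteq> N" "b \<noteq> 0"
    and zero: "\<And>s. support s \<subseteq> H \<Longrightarrow> a * s * b = 0"
  shows "assertion_e G S"
proof -
  note A = admissibleD[OF adm]
  have H: "subgroup H G" by (rule A(1))
  have Hc: "H \<subseteq> carrier G" using H by (rule subgroup.subset)
  have NG: "subgroup N G" and NH: "N \<subseteq> H" using N by (simp_all add: normal_in_def)
  have Nc: "N \<subseteq> carrier G" using NG by (rule subgroup.subset)
  have cos: "component_sum S (h <# N) = {p. support p \<subseteq> h <# N}" if "h \<in> H" for h
    using component_sum_eq[OF l_coset_carrier[OF H N that]] .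
  have one: "\<one> <# N = N" using Nc by (rule l_coset_one)
  have oneH: "\<one> \<in> H" using H by (rule subgroup.one_closed)
  have cosH: "h <# N \<subseteq> H" if "h \<in> H" for h
    using that NH H by (auto simp: l_coset_def intro: subgroup.m_closed)
  define X where "X c = {p * c * q | p q h. h \<in> H \<and> support p \<subseteq> inv h <# N \<and> support q \<subseteq> h <# N}" for c
  have X_mult: "s * x * t \<in> X c" if k: "k \<in> H" and s: "support s \<subseteq> inv k <# N" and t: "support t \<subseteq> k <# N"
    and x: "x \<in> X c" for k s t x c
  proof -
    obtain p q h where h: "h \<in> H" "support p \<subseteq> inv h <# N" "support q \<subseteq> h <# N" "x = p * c * q"
      using x unfolding X_def by blast
    have hk: "h \<otimes> k \<in> H" using H h k by (simp add: subgroup.m_closed)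
    have "inv k \<otimes> inv h = inv (h \<otimes> k)" using h k A(6) by (simp add: inv_mult_group)
    then have "support (s * p) \<subseteq> inv (h \<otimes> k) <# N"
      using support_mult_coset[OF H N A(7)[OF k] A(7)[OF h(1)] s h(2)] by simp
    moreover have "support (q * t) \<subseteq> (h \<otimes> k) <# N"
      using support_mult_coset[OF H N h(1) k h(3) t] .
    moreover have "s * x * t = (s * p) * c * (q * t)" by (simp add: h mult.assoc)
    ultimately show ?thesis unfolding X_def using hk by blast
  qed
  have X_left: "r * x \<in> X c" if r: "support r \<subseteq> N" and x: "x \<in> X c" for r x c
  proof -
    obtain p q h where h: "h \<in> H" "support p \<subseteq> inv h <# N" "support q \<subseteq> h <# N" "x = p * c * q"
      using x unfolding X_def by blast
    have "support (r * p) \<subseteq> (\<one> \<otimes> inv h) <# N"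
      by (rule support_mult_coset[OF H N oneH A(7)[OF h(1)] _ h(2)]) (simp add: one r)
    then have "support (r * p) \<subseteq> inv h <# N" using h A(6) by simp
    moreover have "r * x = (r * p) * c * q" by (simp add: h mult.assoc)
    ultimately show ?thesis unfolding X_def using h by blast
  qed
  have X_right: "x * r \<in> X c" if r: "support r \<subseteq> N" and x: "x \<in> X c" for r x c
  proof -
    obtain p q h where h: "h \<in> H" "support p \<subseteq> inv h <# N" "support q \<subseteq> h <# N" "x = p * c * q"
      using x unfolding X_def by blast
    have "support (q * r) \<subseteq> (h \<otimes> \<one>) <# N"
      by (rule support_mult_coset[OF H N h(1) oneH h(3)]) (simp add: one r)
    then have "support (q * r) \<subseteq> h <# N" using h A(6) by simp
    moreover have "x * r = p * c * (q * r)" by (simp add: h mult.assoc)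
    ultimately show ?thesis unfolding X_def using h by blast
  qed
  have X_minus: "- x \<in> X c" if x: "x \<in> X c" for x c
  proof -
    obtain p q h where h: "h \<in> H" "support p \<subseteq> inv h <# N" "support q \<subseteq> h <# N" "x = p * c * q"
      using x unfolding X_def by blast
    have "support (- p) \<subseteq> inv h <# N" using h(2) by (simp add: support_def)
    moreover have "- x = (- p) * c * q" by (simp add: h)
    ultimately show ?thesis unfolding X_def using h by blast
  qed
  have X_supp: "support x \<subseteq> N" if c: "support c \<subseteq> N" and x: "x \<in> X c" for x c
  proof -
    obtain p q h where h: "h \<in> H" "support p \<subseteq> inv h <# N" "support q \<subseteq> h <# N" "x = p * c * q"
      using x unfolding X_def by blast
    have "support (p * c * q) \<subseteq> (inv h \<otimes> \<one> \<otimes> h) <# N"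
      using h(1) A(7)[OF h(1)] oneH H c one
      by (intro support_mult_coset[OF H N] h(2,3) subgroup.m_closed[OF H]) auto
    then show ?thesis using h A(6)[OF h(1)] one by simp
  qed
  have X_red: "x \<in> reduced H I" if c: "c \<in> reduced H I" and x: "x \<in> X c" for x c
  proof -
    obtain p q h where h: "h \<in> H" "support p \<subseteq> inv h <# N" "support q \<subseteq> h <# N" "x = p * c * q"
      using x unfolding X_def by blast
    then show ?thesis
      using reduced_mult_right[OF adm _ reduced_mult_left[OF adm _ c]] cosH[OF h(1)] cosH[OF A(7)[OF h(1)]]
      by (meson subset_trans)
  qed
  define gen where "gen c = additive_hull (X c)" for c
  have SN: "component_sum S N = {a. support a \<subseteq> N}" using Nc by (rule component_sum_eq)
  have addN: "additive_subgroup_set (component_sum S N)"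
    unfolding SN additive_subgroup_set_def using support_add by auto blast
  have within: "nonzero_ideal_within S N I (gen c)"
    if c: "c \<in> reduced H I" "support c \<subseteq> N" "c \<noteq> 0" for c
  proof -
    have "ideal_of (component_sum S N) (gen c)"
      unfolding gen_def
      by (rule hull_ideal[OF _ addN]) (use X_supp[OF c(2)] X_minus X_left X_right in \<open>auto simp: SN\<close>)
    moreover have "gen c \<noteq> {0}"
    proof -
      obtain p q where pq: "p \<in> S \<one>" "q \<in> S \<one>" "p * c * q \<noteq> 0"
        using two_sided_nonzero_one[OF c(3)] by blast
      have "\<one> \<in> N" using NG by (rule subgroup.one_closed)
      then have "support p \<subseteq> inv \<one> <# N" "support q \<subseteq> \<one> <# N"
        using homogeneous_support[OF one_closed pq(1)] homogeneous_support[OF one_closed pq(2)] one by auto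
      then have "p * c * q \<in> X c" unfolding X_def using oneH by blast
      then have "p * c * q \<in> gen c" unfolding gen_def by (rule hull_base)
      then show ?thesis using pq by blast
    qed
    moreover have "gen c \<subseteq> I \<star> component_sum S N"
      unfolding gen_def
    proof (rule hull_subset)
      show "X c \<subseteq> I \<star> component_sum S N"
        using reduced_in_sum_mult[OF X_red[OF c(1)] X_supp[OF c(2)] NH Nc] by blast
    qed (auto simp: sum_mult_zero sum_mult_add)
    ultimately show ?thesis by (simp add: nonzero_ideal_within_def)
  qed
  have inv: "quotient_invariant G S H N (gen c)"
    if c: "c \<in> reduced H I" "support c \<subseteq> N" "c \<noteq> 0" for c
    unfolding quotient_invariant_iff[OF nonzero_ideal_withinD(2)[OF within[OF c]]]
  proof (intro ballI)
    fix k s i t assume k: "k \<in> H" and s: "s \<in> component_sum S (inv k <# N)"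
      and i: "i \<in> gen c" and t: "t \<in> component_sum S (k <# N)"
    show "s * i * t \<in> gen c"
      using i unfolding gen_def
    proof (rule hull_map[rotated -1])
      fix x assume "x \<in> X c"
      then have "s * x * t \<in> X c" using X_mult[OF k] s t cos[OF k] cos[OF A(7)[OF k]] by blast
      then show "s * x * t \<in> additive_hull (X c)" by (rule hull_base)
    qed (auto simp: distrib_left distrib_right)
  qed
  have XX: "x * y = 0" if x: "x \<in> X a" and y: "y \<in> X b" for x y
  proof -
    obtain p q h where h: "h \<in> H" "support p \<subseteq> inv h <# N" "support q \<subseteq> h <# N" "x = p * a * q"
      using x unfolding X_def by blast
    obtain p' q' h' where h': "h' \<in> H" "support p' \<subseteq> inv h' <# N" "support q' \<subseteq> h' <# N" "y = p' * b * q'"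
      using y unfolding X_def by blast
    have "support (q * p') \<subseteq> H"
      using h(3) h'(2) cosH[OF h(1)] cosH[OF A(7)[OF h'(1)]] by (intro support_mult_subgroup[OF H]) auto
    then have "a * (q * p') * b = 0" by (rule zero)
    moreover have "x * y = p * (a * (q * p') * b) * q'" by (simp add: h(4) h'(4) mult.assoc)
    ultimately show ?thesis by simp
  qed
  have "gen a \<star> gen b = {0}"
    unfolding sum_mult_eq_zero_iff gen_def using hull_mult_vanish[OF XX] by blast
  moreover have "normal_pair G N H" using H N by (simp add: normal_pair_iff)
  moreover have "admissible_ideal G S H I" using adm admissible_iff[OF nondegenerate] by blast
  ultimately show ?thesis
    unfolding assertion_e_def using fin within[OF a] within[OF b] inv[OF a] inv[OF b] by blast
qed

definition annihilating_pair :: "'a set \<Rightarrow> 'r set \<Rightarrow> 'r \<Rightarrow> 'r \<Rightarrow> bool" where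
  "annihilating_pair H I a b \<longleftrightarrow> a \<in> reduced H I \<and> b \<in> reduced H I \<and>
    support a \<subseteq> finite_conj H \<and> support b \<subseteq> finite_conj H \<and> a \<noteq> 0 \<and> b \<noteq> 0 \<and>
    (\<forall>s. support s \<subseteq> H \<longrightarrow> a * s * b = 0)"

text \<open>As \<open>b\<close> is supported in a single coset, parts of \<open>a\<close> from
  different cosets contribute to different cosets of the product. Cutting \<open>a\<close> to a
  coset therefore cuts the product to a coset.\<close>

lemma proj_left_coset:
  assumes H: "subgroup H G" and T: "normal_in T H" and x: "x \<in> H" and h: "h \<in> H" and y: "y \<in> H"
    and a: "support a \<subseteq> H" and s: "s \<in> S h" and b: "support b \<subseteq> y <# T"
  shows "proj (x <# T) a * s * b = proj ((x \<otimes> h \<otimes> y) <# T) (a * s * b)"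
proof (rule component_ext)
  fix z assume z: "z \<in> carrier G"
  have Hc: "H \<subseteq> carrier G" using H by (rule subgroup.subset)
  have TG: "subgroup T G" using T by (simp add: normal_in_def)
  have xc: "x \<in> carrier G" and hc: "h \<in> carrier G" and yc: "y \<in> carrier G" using x h y Hc by auto
  let ?a0 = "proj (x <# T) a" and ?a1 = "proj (- (x <# T)) a" and ?c = "(x \<otimes> h \<otimes> y) <# T"
  have sh: "support s \<subseteq> h <# T"
    using homogeneous_support[OF hc s] mem_l_coset_self[OF hc TG] by blast
  have a: "a = ?a0 + ?a1" by (rule component_ext) auto
  have "support (?a0 * s * b) \<subseteq> ?c"
    using x h y b sh by (intro support_mult_coset[OF H T] subgroup.m_closed[OF H]) auto
  moreover have "z \<notin> support (?a1 * s * b)" if "z \<in> ?c"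
  proof
    assume "z \<in> support (?a1 * s * b)"
    then obtain u w where u: "u \<in> support ?a1" and w: "w \<in> support (s * b)" "z = u \<otimes> w"
      using support_mult[OF subset_refl subset_refl, of z ?a1 "s * b"] by (auto simp: mult.assoc)
    have uc: "u \<in> carrier G" using u support_carrier by blast
    have wc: "w \<in> (h \<otimes> y) <# T" using w support_mult_coset[OF H T h y sh b] by blast
    have hy: "h \<otimes> y \<in> H" using H h y by (simp add: subgroup.m_closed)
    have wcar: "w \<in> carrier G" using wc l_coset_carrier[OF H T hy] by blast
    have "z \<otimes> inv w \<in> (x \<otimes> h \<otimes> y \<otimes> inv (h \<otimes> y)) <# T"
      using H x h y hy that by (intro coset_mult[OF H T] inv_mem_l_coset[OF H T hy wc])
        (auto intro: subgroup.m_closed subgroup.m_inv_closed)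
    moreover have "z \<otimes> inv w = u" using w uc wcar by (simp add: m_assoc)
    moreover have "x \<otimes> h \<otimes> y \<otimes> inv (h \<otimes> y) = x" using xc hc yc by (simp add: m_assoc)
    ultimately show False using u by simp
  qed
  moreover have "component (a * s * b) z = component (?a0 * s * b) z + component (?a1 * s * b) z"
    by (subst a) (simp add: distrib_right)
  ultimately show "component (?a0 * s * b) z = component (proj ?c (a * s * b)) z"
    by (auto simp: support_def)
qed

lemma proj_right_coset:
  assumes H: "subgroup H G" and T: "normal_in T H" and x: "x \<in> H" and h: "h \<in> H" and y: "y \<in> H"
    and b: "support b \<subseteq> H" and s: "s \<in> S h" and a: "support a \<subseteq> x <# T"
  shows "a * s * proj (y <# T) b = proj ((x \<otimes> h \<otimes> y) <# T) (a * s * b)"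
proof (rule component_ext)
  fix z assume z: "z \<in> carrier G"
  have Hc: "H \<subseteq> carrier G" using H by (rule subgroup.subset)
  have TG: "subgroup T G" using T by (simp add: normal_in_def)
  have xc: "x \<in> carrier G" and hc: "h \<in> carrier G" and yc: "y \<in> carrier G" using x h y Hc by auto
  let ?b0 = "proj (y <# T) b" and ?b1 = "proj (- (y <# T)) b" and ?c = "(x \<otimes> h \<otimes> y) <# T"
  have sh: "support s \<subseteq> h <# T"
    using homogeneous_support[OF hc s] mem_l_coset_self[OF hc TG] by blast
  have b: "b = ?b0 + ?b1" by (rule component_ext) auto
  have "support (a * s * ?b0) \<subseteq> ?c"
    using x h y a sh by (intro support_mult_coset[OF H T] subgroup.m_closed[OF H]) auto
  moreover have "z \<notin> support (a * s * ?b1)" if "z \<in> ?c"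
  proof
    assume "z \<in> support (a * s * ?b1)"
    then obtain w u where u: "u \<in> support ?b1" and w: "w \<in> support (a * s)" "z = w \<otimes> u"
      using support_mult[OF subset_refl subset_refl, of z "a * s" ?b1] by auto
    have uc: "u \<in> carrier G" using u support_carrier by blast
    have wc: "w \<in> (x \<otimes> h) <# T" using w support_mult_coset[OF H T x h a sh] by blast
    have xh: "x \<otimes> h \<in> H" using H x h by (simp add: subgroup.m_closed)
    have wcar: "w \<in> carrier G" using wc l_coset_carrier[OF H T xh] by blast
    have "inv w \<otimes> z \<in> (inv (x \<otimes> h) \<otimes> (x \<otimes> h \<otimes> y)) <# T"
      using H x h y xh that by (intro coset_mult[OF H T] inv_mem_l_coset[OF H T xh wc])
        (auto intro: subgroup.m_closed subgroup.m_inv_closed)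
    moreover have "inv w \<otimes> z = u" using w uc wcar by (simp add: m_assoc[symmetric])
    moreover have "inv (x \<otimes> h) \<otimes> (x \<otimes> h \<otimes> y) = y"
      using xc hc yc by (metis inv_closed l_inv l_one m_assoc m_closed)
    ultimately show False using u by simp
  qed
  moreover have "component (a * s * b) z = component (a * s * ?b0) z + component (a * s * ?b1) z"
    by (subst b) (simp add: distrib_left)
  ultimately show "component (a * s * ?b0) z = component (proj ?c (a * s * b)) z"
    by (auto simp: support_def)
qed

text \<open>For a pair with the fewest \<open>T\<close>-cosets in the two supports, one coset part
  of \<open>a\<close> annihilates a suitable element only if all of \<open>a\<close> does
  (\<open>left\<close>), and likewise for \<open>b\<close> (\<open>right\<close>). Unique products
  provide one pair of coset parts with zero product, and the two properties spread this to all pairs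
  (\<open>parts\<close>). Finally one part of each is translated into degrees from
  \<open>T\<close>.\<close>

lemma annihilating_pair_imp_assertion_e:
  assumes adm: "admissible H I" and ex: "annihilating_pair H I a\<^sub>0 b\<^sub>0"
  shows "assertion_e G S"
proof -
  note A = admissibleD[OF adm]
  have H: "subgroup H G" by (rule A(1))
  have Hc: "H \<subseteq> carrier G" using H by (rule subgroup.subset)
  define D where "D = finite_conj H \<inter> H"
  define T where "T = torsion_in D"
  have DG: "subgroup D G" unfolding D_def
    using finite_conj_subgroup[OF Hc] H by (rule subgroups_Inter_pair)
  have T: "normal_in T H" unfolding T_def D_def by (rule torsion_normal_in[OF H])
  have TG: "subgroup T G" and TH: "T \<subseteq> H" using T by (simp_all add: normal_in_def)
  have TD: "T \<subseteq> D" by (auto simp: T_def torsion_in_def)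
  have DH: "D \<subseteq> H" by (simp add: D_def)
  have mH: "x \<otimes> y \<in> H" if "x \<in> H" "y \<in> H" for x y using H that by (rule subgroup.m_closed)
  have cosD: "u <# T \<subseteq> D" if "u \<in> D" for u
    using that TD DG by (auto simp: l_coset_def intro: subgroup.m_closed)
  have cosH: "u <# T \<subseteq> H" if "u \<in> H" for u
    using that TH H by (auto simp: l_coset_def intro: subgroup.m_closed)
  have self: "u \<in> u <# T" if "u \<in> H" for u using mem_l_coset_self[OF A(6)[OF that] TG] .
  have coset_eq: "x <# T = y <# T \<longleftrightarrow> y \<in> x <# T" if "x \<in> H" "y \<in> H" for x y
    using l_coset_eq_iff[OF A(6)[OF that(1)] A(6)[OF that(2)] TG] .
  have hom: "support s \<subseteq> h <# T" if "h \<in> H" "s \<in> S h" for h s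
    using homogeneous_support[OF A(6)[OF that(1)] that(2)] self[OF that(1)] by blast
  define n where "n c = card ((\<lambda>x. x <# T) ` support c)" for c
  obtain a b where ab: "annihilating_pair H I a b"
    and min: "\<And>a' b'. annihilating_pair H I a' b' \<Longrightarrow> n a + n b \<le> n a' + n b'"
    using ex_has_least_nat[of "\<lambda>(a, b). annihilating_pair H I a b" "(a\<^sub>0, b\<^sub>0)" "\<lambda>(a, b). n a + n b"] ex
    by auto
  have aR: "a \<in> reduced H I" and bR: "b \<in> reduced H I" and a0: "a \<noteq> 0" and b0: "b \<noteq> 0"
    and zero: "\<And>s. support s \<subseteq> H \<Longrightarrow> a * s * b = 0"
    using ab by (auto simp: annihilating_pair_def)
  have aD: "support a \<subseteq> D" and bD: "support b \<subseteq> D"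
    using ab by (auto simp: annihilating_pair_def D_def reduced_def)
  have aH: "support a \<subseteq> H" and bH: "support b \<subseteq> H" using aD bD DH by auto

  \<comment> \<open>Otherwise \<open>a s b' t\<close>, with \<open>t\<close> chosen to keep a
    component nonzero in degree \<open>\<one>\<close>, forms an annihilating pair with
    \<open>b\<close>. The coset \<open>x <# T\<close> contributes nothing to it, so it meets fewer
    cosets than \<open>a\<close>.\<close>
  have left: "a * s * b' = 0"
    if h: "h \<in> H" and s: "s \<in> S h" and y: "y \<in> D" and b': "support b' \<subseteq> y <# T"
      and x: "x \<in> support a" and van: "proj (x <# T) a * s * b' = 0" for h s y b' x
  proof (rule ccontr)
    assume ne: "a * s * b' \<noteq> 0"
    have yH: "y \<in> H" using y DH by auto
    have xH: "x \<in> H" using x aH by auto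
    obtain z where z: "z \<in> carrier G" "component (a * s * b') z \<noteq> 0" using nonzero_support[OF ne] by blast
    then have "z \<in> support (a * s * b')" by (simp add: support_def)
    then obtain x1 y1 where xy1: "x1 \<in> support a" "y1 \<in> support b'" "z = x1 \<otimes> h \<otimes> y1"
      using support_mult_homogeneous[OF A(6)[OF h] s] by blast
    have x1H: "x1 \<in> H" using xy1 aH by auto
    have y1: "y1 \<in> y <# T" using xy1 b' by auto
    have zH: "z \<in> H" using xy1 x1H h y1 cosH[OF yH] by (auto intro!: mH)
    have izH: "inv z \<in> H" using A(7)[OF zH] .
    obtain t where t: "t \<in> S (inv z)" "component (a * s * b') z * t \<noteq> 0"
      using nondegD(1)[OF z(1) component_in[OF z(1)] z(2)] by blast
    define c where "c = a * s * b' * t"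
    have "component c \<one> = component (a * s * b') z * t"
      unfolding c_def using component_mult_homogeneous[OF _ t(1), of \<one>] z(1) by simp
    then have c0: "c \<noteq> 0" using t by auto
    \<comment> \<open>The factor \<open>s b' t\<close> is supported in the single coset of
      \<open>m\<close>. Since \<open>z\<close> is \<open>x1 \<otimes> h \<otimes> y1\<close>, this
      is the coset of \<open>inv x1\<close>; so the new element is supported in \<open>D\<close>
      although \<open>h\<close> may lie outside it.\<close>
    define m where "m = h \<otimes> y \<otimes> inv z"
    have mH': "m \<in> H" unfolding m_def using h yH izH by (intro mH)
    have supp_m: "support (s * b' * t) \<subseteq> m <# T"
      unfolding m_def using h yH izH
      by (intro support_mult_coset[OF H T] hom b' t s mH)
    have "z \<in> (x1 \<otimes> h \<otimes> y) <# T"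
      unfolding xy1(3) using x1H h yH by (intro coset_mult[OF H T] self y1 mH)
    then have "inv z \<in> inv (x1 \<otimes> h \<otimes> y) <# T"
      using x1H h yH by (intro inv_mem_l_coset[OF H T] mH)
    then have "m \<in> (h \<otimes> y \<otimes> inv (x1 \<otimes> h \<otimes> y)) <# T"
      unfolding m_def using x1H h yH by (intro coset_mult[OF H T] self mH A(7))
    moreover have "h \<otimes> y \<otimes> inv (x1 \<otimes> h \<otimes> y) = inv x1"
      using A(6)[OF x1H] A(6)[OF h] A(6)[OF yH]
      by (simp add: inv_mult_group m_assoc inv_cancel_left)
    ultimately have "m \<in> D"
      using cosD[of "inv x1"] xy1(1) aD DG subgroup.m_inv_closed[OF DG] by auto
    have c_eq: "c = a * (s * b' * t)" by (simp add: c_def mult.assoc)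
    have sbt: "support (s * b' * t) \<subseteq> H" using supp_m cosH[OF mH'] by blast
    have "annihilating_pair H I c b"
      unfolding annihilating_pair_def
    proof (intro conjI allI impI c0 b0 bR)
      show "c \<in> reduced H I" unfolding c_eq by (rule reduced_mult_right[OF adm sbt aR])
      have "support c \<subseteq> D"
        unfolding c_eq using support_mult_subgroup[OF DG aD, of "s * b' * t"] supp_m cosD[OF \<open>m \<in> D\<close>] by blast
      then show "support c \<subseteq> finite_conj H" by (simp add: D_def)
      show "support b \<subseteq> finite_conj H" using bD by (simp add: D_def)
      fix r assume "support r \<subseteq> H"
      then have "a * (s * b' * t * r) * b = 0" using support_mult_subgroup[OF H sbt] by (intro zero)
      then show "c * r * b = 0" by (simp add: c_def mult.assoc)
    qed
    then have le: "n a \<le> n c" using min by fastforce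
    define Y where "Y = support a - (x <# T)"
    have finY: "finite Y" by (simp add: Y_def)
    have YH: "Y \<subseteq> H" using aH by (auto simp: Y_def)
    have "a = proj (x <# T) a + proj (- (x <# T)) a" by (rule component_ext) auto
    then have "c = (proj (x <# T) a + proj (- (x <# T)) a) * (s * b' * t)" by (simp add: c_eq)
    also have "\<dots> = proj (x <# T) a * s * b' * t + proj (- (x <# T)) a * (s * b' * t)"
      by (simp add: distrib_right mult.assoc)
    finally have c1: "c = proj (- (x <# T)) a * (s * b' * t)" using van by simp
    have "(\<lambda>v. v <# T) ` support c \<subseteq> (\<lambda>u. (u \<otimes> m) <# T) ` Y"
    proof
      fix C assume "C \<in> (\<lambda>v. v <# T) ` support c"
      then obtain v where v: "v \<in> support c" "C = v <# T" by blast
      have "support (proj (- (x <# T)) a) \<subseteq> Y" by (auto simp: Y_def)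
      from support_mult[OF this supp_m, of v] v(1) c1 obtain u w
        where uw: "u \<in> Y" "w \<in> m <# T" "v = u \<otimes> w" by metis
      have uH: "u \<in> H" using uw YH by auto
      have "v \<in> (u \<otimes> m) <# T" unfolding uw(3) by (rule coset_mult[OF H T uH mH' self[OF uH] uw(2)])
      then have "(u \<otimes> m) <# T = v <# T"
        using coset_eq[OF mH[OF uH mH']] cosH[OF mH[OF uH mH']] by blast
      then show "C \<in> (\<lambda>u. (u \<otimes> m) <# T) ` Y" using v uw by blast
    qed
    then have "n c \<le> card ((\<lambda>u. (u \<otimes> m) <# T) ` Y)"
      unfolding n_def using finY by (intro card_mono) auto
    also have "\<dots> \<le> card ((\<lambda>u. u <# T) ` Y)"
    proof (rule card_image_factor[OF finY])
      fix u v assume uv: "u \<in> Y" "v \<in> Y" "u <# T = v <# T"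
      then have H': "u \<in> H" "v \<in> H" using YH by auto
      then have "v \<in> u <# T" using uv coset_eq by simp
      then have "v \<otimes> m \<in> (u \<otimes> m) <# T" using coset_mult[OF H T H'(1) mH' _ self[OF mH']] by blast
      then show "(u \<otimes> m) <# T = (v \<otimes> m) <# T" using coset_eq[OF mH mH] H' mH' by blast
    qed
    also have "\<dots> < n a"
      unfolding n_def
    proof (rule psubset_card_mono)
      have "x <# T \<notin> (\<lambda>u. u <# T) ` Y"
      proof
        assume "x <# T \<in> (\<lambda>u. u <# T) ` Y"
        then obtain u where "u \<in> Y" "x <# T = u <# T" by blast
        then show False using self[of u] YH by (auto simp: Y_def)
      qed
      moreover have "x <# T \<in> (\<lambda>u. u <# T) ` support a" using x by blast
      ultimately show "(\<lambda>u. u <# T) ` Y \<subset> (\<lambda>u. u <# T) ` support a" by (auto simp: Y_def)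
    qed simp
    finally show False using le by simp
  qed

  \<comment> \<open>Mirror image of \<open>left\<close>: here \<open>b\<close> is multiplied from
    the left and loses a coset.\<close>
  have right: "a' * s * b = 0"
    if h: "h \<in> H" and s: "s \<in> S h" and x: "x \<in> D" and a': "support a' \<subseteq> x <# T"
      and y: "y \<in> support b" and van: "a' * s * proj (y <# T) b = 0" for h s x a' y
  proof (rule ccontr)
    assume ne: "a' * s * b \<noteq> 0"
    have xH: "x \<in> H" using x DH by auto
    have yH: "y \<in> H" using y bH by auto
    obtain z where z: "z \<in> carrier G" "component (a' * s * b) z \<noteq> 0" using nonzero_support[OF ne] by blast
    then have "z \<in> support (a' * s * b)" by (simp add: support_def)
    then obtain x1 y1 where xy1: "x1 \<in> support a'" "y1 \<in> support b" "z = x1 \<otimes> h \<otimes> y1"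
      using support_mult_homogeneous[OF A(6)[OF h] s] by blast
    have y1H: "y1 \<in> H" using xy1 bH by auto
    have x1: "x1 \<in> x <# T" using xy1 a' by auto
    have zH: "z \<in> H" using xy1 y1H h x1 cosH[OF xH] by (auto intro!: mH)
    have izH: "inv z \<in> H" using A(7)[OF zH] .
    obtain t where t: "t \<in> S (inv z)" "t * component (a' * s * b) z \<noteq> 0"
      using nondegD(2)[OF z(1) component_in[OF z(1)] z(2)] by blast
    define c where "c = t * (a' * s * b)"
    have "component c \<one> = t * component (a' * s * b) z"
      unfolding c_def using component_homogeneous_mult[OF _ t(1), of \<one>] z(1) by simp
    then have c0: "c \<noteq> 0" using t by auto
    define m where "m = inv z \<otimes> x \<otimes> h"
    have mH': "m \<in> H" unfolding m_def using h xH izH by (intro mH)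
    have supp_m: "support (t * a' * s) \<subseteq> m <# T"
      unfolding m_def using h xH izH
      by (intro support_mult_coset[OF H T] hom a' t s mH)
    have "z \<in> (x \<otimes> h \<otimes> y1) <# T"
      unfolding xy1(3) using y1H h xH by (intro coset_mult[OF H T] self x1 mH)
    then have "inv z \<in> inv (x \<otimes> h \<otimes> y1) <# T"
      using y1H h xH by (intro inv_mem_l_coset[OF H T] mH)
    then have "m \<in> (inv (x \<otimes> h \<otimes> y1) \<otimes> x \<otimes> h) <# T"
      unfolding m_def using y1H h xH by (intro coset_mult[OF H T] self mH A(7))
    moreover have "inv (x \<otimes> h \<otimes> y1) \<otimes> x \<otimes> h = inv y1"
      using A(6)[OF y1H] A(6)[OF h] A(6)[OF xH]
      by (simp add: inv_mult_group m_assoc inv_cancel_left)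
    ultimately have "m \<in> D"
      using cosD[of "inv y1"] xy1(2) bD DG subgroup.m_inv_closed[OF DG] by auto
    have c_eq: "c = (t * a' * s) * b" by (simp add: c_def mult.assoc)
    have tas: "support (t * a' * s) \<subseteq> H" using supp_m cosH[OF mH'] by blast
    have "annihilating_pair H I a c"
      unfolding annihilating_pair_def
    proof (intro conjI allI impI c0 a0 aR)
      show "c \<in> reduced H I" unfolding c_eq by (rule reduced_mult_left[OF adm tas bR])
      have "support c \<subseteq> D"
        unfolding c_eq using support_mult_subgroup[OF DG _ bD, of "t * a' * s"] supp_m cosD[OF \<open>m \<in> D\<close>] by blast
      then show "support c \<subseteq> finite_conj H" by (simp add: D_def)
      show "support a \<subseteq> finite_conj H" using aD by (simp add: D_def)
      fix r assume "support r \<subseteq> H"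
      then have "a * (r * (t * a' * s)) * b = 0" using support_mult_subgroup[OF H _ tas] by (intro zero)
      then show "a * r * c = 0" by (simp add: c_def mult.assoc)
    qed
    then have le: "n b \<le> n c" using min by fastforce
    define Y where "Y = support b - (y <# T)"
    have finY: "finite Y" by (simp add: Y_def)
    have YH: "Y \<subseteq> H" using bH by (auto simp: Y_def)
    have "b = proj (y <# T) b + proj (- (y <# T)) b" by (rule component_ext) auto
    then have "c = (t * a' * s) * (proj (y <# T) b + proj (- (y <# T)) b)" by (simp add: c_eq)
    also have "\<dots> = t * (a' * s * proj (y <# T) b) + (t * a' * s) * proj (- (y <# T)) b"
      by (simp add: distrib_left mult.assoc)
    finally have c1: "c = (t * a' * s) * proj (- (y <# T)) b" using van by simp
    have "(\<lambda>v. v <# T) ` support c \<subseteq> (\<lambda>u. (m \<otimes> u) <# T) ` Y"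
    proof
      fix C assume "C \<in> (\<lambda>v. v <# T) ` support c"
      then obtain v where v: "v \<in> support c" "C = v <# T" by blast
      have "support (proj (- (y <# T)) b) \<subseteq> Y" by (auto simp: Y_def)
      from support_mult[OF supp_m this, of v] v(1) c1 obtain w u
        where uw: "u \<in> Y" "w \<in> m <# T" "v = w \<otimes> u" by metis
      have uH: "u \<in> H" using uw YH by auto
      have "v \<in> (m \<otimes> u) <# T" unfolding uw(3) by (rule coset_mult[OF H T mH' uH uw(2) self[OF uH]])
      then have "(m \<otimes> u) <# T = v <# T"
        using coset_eq[OF mH[OF mH' uH]] cosH[OF mH[OF mH' uH]] by blast
      then show "C \<in> (\<lambda>u. (m \<otimes> u) <# T) ` Y" using v uw by blast
    qed
    then have "n c \<le> card ((\<lambda>u. (m \<otimes> u) <# T) ` Y)"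
      unfolding n_def using finY by (intro card_mono) auto
    also have "\<dots> \<le> card ((\<lambda>u. u <# T) ` Y)"
    proof (rule card_image_factor[OF finY])
      fix u v assume uv: "u \<in> Y" "v \<in> Y" "u <# T = v <# T"
      then have H': "u \<in> H" "v \<in> H" using YH by auto
      then have "v \<in> u <# T" using uv coset_eq by simp
      then have "m \<otimes> v \<in> (m \<otimes> u) <# T" using coset_mult[OF H T mH' H'(1) self[OF mH']] by blast
      then show "(m \<otimes> u) <# T = (m \<otimes> v) <# T" using coset_eq[OF mH mH] H' mH' by blast
    qed
    also have "\<dots> < n b"
      unfolding n_def
    proof (rule psubset_card_mono)
      have "y <# T \<notin> (\<lambda>u. u <# T) ` Y"
      proof
        assume "y <# T \<in> (\<lambda>u. u <# T) ` Y"
        then obtain u where "u \<in> Y" "y <# T = u <# T" by blast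
        then show False using self[of u] YH by (auto simp: Y_def)
      qed
      moreover have "y <# T \<in> (\<lambda>u. u <# T) ` support b" using y by blast
      ultimately show "(\<lambda>u. u <# T) ` Y \<subset> (\<lambda>u. u <# T) ` support b" by (auto simp: Y_def)
    qed simp
    finally show False using le by simp
  qed

  have parts: "proj (x <# T) a * s * proj (y <# T) b = 0"
    if x: "x \<in> support a" and y: "y \<in> support b" and h: "h \<in> H" and s: "s \<in> S h" for x y h s
  proof -
    have hc: "h \<in> carrier G" using A(6)[OF h] .
    \<comment> \<open>A degree \<open>u \<otimes> h \<otimes> v\<close> becomes, after right
      multiplication by \<open>inv h\<close>, the product of \<open>u\<close> with a conjugate of
      \<open>v\<close>. Both factors are in \<open>D\<close>, so unique products apply for every
      \<open>h\<close> in \<open>H\<close>.\<close>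
    define Y where "Y = conj_by (inv h) ` support b"
    have "Y \<subseteq> D"
    proof
      fix w assume "w \<in> Y"
      then obtain v where v: "v \<in> support b" "w = conj_by (inv h) v" by (auto simp: Y_def)
      then have "w \<in> finite_conj H" using finite_conj_conj_by[OF H, of v "inv h"] bD A(7)[OF h] by (auto simp: D_def)
      moreover have "w \<in> H"
        unfolding v(2) conj_by_def using v(1) bH h by (intro mH A(7)) auto
      ultimately show "w \<in> D" by (simp add: D_def)
    qed
    moreover have "finite Y" "Y \<noteq> {}" using y by (auto simp: Y_def)
    ultimately obtain x0 w0 where x0: "x0 \<in> support a" and w0: "w0 \<in> Y"
      and uni: "\<And>u w. u \<in> support a \<Longrightarrow> w \<in> Y \<Longrightarrow> u \<otimes> w \<in> (x0 \<otimes> w0) <# T \<Longrightarrow> u \<in> x0 <# T \<and> w \<in> w0 <# T"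
      using unique_product_mod_torsion[OF H D_def T_def _ _ aD, of Y] x finite_support[of a] by blast
    obtain y0 where y0: "y0 \<in> support b" "w0 = conj_by (inv h) y0" using w0 by (auto simp: Y_def)
    have x0H: "x0 \<in> H" and y0H: "y0 \<in> H" using x0 y0 aH bH by auto
    define c where "c = (x0 \<otimes> h \<otimes> y0) <# T"
    have uni': "u \<in> x0 <# T \<and> v \<in> y0 <# T" if u: "u \<in> support a" and v: "v \<in> support b" and uv: "u \<otimes> h \<otimes> v \<in> c" for u v
    proof -
      have uH: "u \<in> H" and vH: "v \<in> H" using u v aH bH by auto
      have car: "u \<in> carrier G" "v \<in> carrier G" "x0 \<in> carrier G" "y0 \<in> carrier G"
        using uH vH x0H y0H Hc by auto
      have ih: "inv h \<in> H" using A(7)[OF h] .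
      have "(u \<otimes> h \<otimes> v) \<otimes> inv h \<in> (x0 \<otimes> h \<otimes> y0 \<otimes> inv h) <# T"
        using coset_mult[OF H T mH[OF mH[OF x0H h] y0H] ih _ self[OF ih]] uv unfolding c_def by blast
      moreover have "(u \<otimes> h \<otimes> v) \<otimes> inv h = u \<otimes> conj_by (inv h) v"
        "x0 \<otimes> h \<otimes> y0 \<otimes> inv h = x0 \<otimes> w0"
        using car hc by (simp_all add: conj_by_def m_assoc y0)
      moreover have vY: "conj_by (inv h) v \<in> Y" using v by (simp add: Y_def)
      ultimately have *: "u \<in> x0 <# T" "conj_by (inv h) v \<in> w0 <# T" using uni[OF u vY] by auto
      have w0H: "w0 \<in> H" using \<open>Y \<subseteq> D\<close> w0 DH by auto
      have "inv h \<otimes> conj_by (inv h) v \<otimes> h \<in> (inv h \<otimes> w0 \<otimes> h) <# T"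
        using coset_mult[OF H T mH[OF ih w0H] h coset_mult[OF H T ih w0H self[OF ih] *(2)] self[OF h]] .
      moreover have "inv h \<otimes> conj_by (inv h) v \<otimes> h = v" "inv h \<otimes> w0 \<otimes> h = y0"
        using conj_by_eq_iff[of y0 w0 "inv h"] conj_by_eq_iff[of v "conj_by (inv h) v" "inv h"] car hc y0
        by (simp_all add: conj_by_def[symmetric])
      ultimately show ?thesis using * by simp
    qed
    let ?a0 = "proj (x0 <# T) a" and ?a1 = "proj (- (x0 <# T)) a"
    let ?b0 = "proj (y0 <# T) b" and ?b1 = "proj (- (y0 <# T)) b"
    have "?a0 * s * ?b0 = 0"
    proof (rule component_ext)
      fix z assume z: "z \<in> carrier G"
      have split: "a = ?a0 + ?a1" "b = ?b0 + ?b1" by (rule component_ext, simp)+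
      have "a * s * b = ?a0 * s * b + ?a1 * s * b" by (subst split(1)) (simp only: distrib_right)
      also have "?a0 * s * b = ?a0 * s * ?b0 + ?a0 * s * ?b1" by (subst split(2)) (simp only: distrib_left)
      finally have sum: "?a0 * s * ?b0 + ?a0 * s * ?b1 + ?a1 * s * b = 0"
        using zero[of s] homogeneous_support[OF hc s] h by auto
      show "component (?a0 * s * ?b0) z = component 0 z"
      proof (cases "z \<in> c")
        case True
        have "z \<notin> support (?a0 * s * ?b1)"
        proof
          assume "z \<in> support (?a0 * s * ?b1)"
          then obtain u v where "u \<in> support ?a0" "v \<in> support ?b1" "z = u \<otimes> h \<otimes> v"
            using support_mult_homogeneous[OF hc s] by blast
          then show False using uni'[of u v] True by auto
        qed
        moreover have "z \<notin> support (?a1 * s * b)"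
        proof
          assume "z \<in> support (?a1 * s * b)"
          then obtain u v where "u \<in> support ?a1" "v \<in> support b" "z = u \<otimes> h \<otimes> v"
            using support_mult_homogeneous[OF hc s] by blast
          then show False using uni'[of u v] True by auto
        qed
        ultimately show ?thesis
          using arg_cong[OF sum, of "\<lambda>r. component r z"] by (simp add: not_in_support)
      next
        case False
        have "support (?a0 * s * ?b0) \<subseteq> c"
          unfolding c_def using x0H h y0H hom[OF h s] by (intro support_mult_coset[OF H T] mH) auto
        then have "z \<notin> support (?a0 * s * ?b0)" using False by blast
        then show ?thesis by (simp add: not_in_support)
      qed
    qed
    \<comment> \<open>The one vanishing product is spread in four moves: from a part of
      \<open>a\<close> to all of \<open>a\<close>, down to the part at \<open>x\<close>, from a part
      of \<open>b\<close> to all of \<open>b\<close>, and down to the part at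
      \<open>y\<close>.\<close>
    then have 1: "a * s * ?b0 = 0"
      using left[OF h s _ _ x0, of y0 ?b0] y0 bD by auto
    have xH: "x \<in> H" and yH: "y \<in> H" using x y aH bH by auto
    have "proj (x <# T) a * s * ?b0 = 0"
      using proj_left_coset[OF H T xH h y0H aH s, of ?b0] 1 by simp
    then have "proj (x <# T) a * s * b = 0"
      using right[OF h s _ _ y0(1), of x "proj (x <# T) a"] x aD by auto
    then show ?thesis
      using proj_right_coset[OF H T xH h yH bH s, of "proj (x <# T) a"] by simp
  qed

  obtain x where x: "x \<in> support a" using nonzero_support[OF a0] by (auto simp: support_def)
  obtain y where y: "y \<in> support b" using nonzero_support[OF b0] by (auto simp: support_def)
  have xH: "x \<in> H" and yH: "y \<in> H" using x y aH bH by auto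
  have xc: "x \<in> carrier G" and yc: "y \<in> carrier G" using xH yH A(6) by auto
  have shift: "\<exists>t\<in>S (inv x). proj (x <# T) a * t \<noteq> 0 \<and> support (proj (x <# T) a * t) \<subseteq> T"
    if xH: "x \<in> H" and x: "x \<in> support a" for x a
  proof -
    have xc: "x \<in> carrier G" using A(6)[OF xH] .
    obtain t where t: "t \<in> S (inv x)" "component a x * t \<noteq> 0"
      using nondegD(1)[OF xc component_in[OF xc]] x by (auto simp: support_def)
    have "component (proj (x <# T) a * t) \<one> = component a x * t"
      using component_mult_homogeneous[OF _ t(1), of \<one> "proj (x <# T) a"] self[OF xH] xc by simp
    then have "proj (x <# T) a * t \<noteq> 0" using t by auto
    moreover have "support (proj (x <# T) a * t) \<subseteq> (x \<otimes> inv x) <# T"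
      using xH hom[OF A(7)[OF xH] t(1)] by (intro support_mult_coset[OF H T] A(7)) auto
    ultimately show ?thesis using t xc l_coset_one[OF subgroup.subset[OF TG]] by auto
  qed
  obtain p where p: "p \<in> S (inv x)" "proj (x <# T) a * p \<noteq> 0" "support (proj (x <# T) a * p) \<subseteq> T"
    using shift[OF xH x] by blast
  obtain q where q: "q \<in> S (inv y)" "proj (y <# T) b * q \<noteq> 0" "support (proj (y <# T) b * q) \<subseteq> T"
    using shift[OF yH y] by blast
  let ?a = "proj (x <# T) a * p" and ?b = "proj (y <# T) b * q"
  obtain N where N: "finite N" "subgroup N G" "support ?a \<union> support ?b \<subseteq> N" "N \<subseteq> H"
    "\<And>x h. x \<in> N \<Longrightarrow> h \<in> H \<Longrightarrow> conj_by h x \<in> N"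
    using finite_normal_closure[OF H, of "support ?a \<union> support ?b"] p(3) q(3)
    by (metis D_def T_def Un_least finite_UnI finite_support)
  have "normal_in N H" using N by (auto simp: normal_in_def)
  moreover have "?a \<in> reduced H I" "?b \<in> reduced H I"
    using reduced_mult_right1[OF adm A(7)[OF xH] p(1) reduced_proj[OF aR]]
      reduced_mult_right1[OF adm A(7)[OF yH] q(1) reduced_proj[OF bR]] by auto
  moreover have "?a * s * ?b = 0" if s: "support s \<subseteq> H" for s
  proof (rule mult_vanish_homogeneous)
    fix h assume "h \<in> support s"
    then have h: "h \<in> H" using s by auto
    have "p * component s h \<in> S (inv x \<otimes> h)" using p(1) xc A(6)[OF h] by (intro S_mult) auto
    then have "proj (x <# T) a * (p * component s h) * proj (y <# T) b = 0"
      using parts[OF x y] mH[OF A(7)[OF xH] h] by blast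
    then show "?a * component s h * ?b = 0" by (simp add: mult.assoc[symmetric])
  qed
  ultimately show ?thesis
    using finite_normal_imp_assertion_e[OF adm _ N(1), of ?a ?b] N(3) p(2) q(2) by blast
qed

end

section \<open>Ideals with zero product\<close>

locale zero_product_ideals = nearly_epsilon_strong G S
  for G (structure) and S :: "'a \<Rightarrow> 'r::ring set" +
  fixes A B :: "'r set"
  assumes A: "ideal_of UNIV A" and B: "ideal_of UNIV B"
    and AB: "a \<in> A \<Longrightarrow> b \<in> B \<Longrightarrow> a * b = 0"
    and not_e: "\<not> assertion_e G S"
begin

text \<open>The only use of \<open>not_e\<close>: on elements supported in
  \<open>finite_conj H\<close>, the ideal \<open>I S\<^sub>H\<close> behaves as in a prime
  ring.\<close>

lemma no_annihilating_pair:
  assumes adm: "admissible H I" and a: "a \<in> reduced H I" "support a \<subseteq> finite_conj H" "a \<noteq> 0"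
    and b: "b \<in> reduced H I" "support b \<subseteq> finite_conj H" "b \<noteq> 0"
  obtains h s where "h \<in> H" "s \<in> S h" "a * s * b \<noteq> 0"
proof (rule ccontr)
  note obtained = that
  assume "\<not> thesis"
  then have z: "a * s * b = 0" if "h \<in> H" "s \<in> S h" for h s using obtained that by blast
  have "a * s * b = 0" if "support s \<subseteq> H" for s
  proof (rule mult_vanish_homogeneous)
    fix x assume "x \<in> support s"
    then have "x \<in> H" "x \<in> carrier G" using that support_carrier by auto
    then show "a * component s x * b = 0" using z component_in by blast
  qed
  then have "annihilating_pair H I a b" using a b by (simp add: annihilating_pair_def)
  then show False using annihilating_pair_imp_assertion_e[OF adm] not_e by blast
qed

lemma ideal_reduced:
  assumes adm: "admissible H I" and i: "i \<in> I"
  shows "i \<in> reduced H I" "support i \<subseteq> finite_conj H"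
proof -
  note M = admissibleD[OF adm]
  have one: "\<one> \<in> H" using M(1) by (rule subgroup.one_closed)
  have iS: "i \<in> S \<one>" using M(5)[OF i] .
  have si: "support i \<subseteq> {\<one>}" using homogeneous_support[OF one_closed iS] .
  obtain u where u: "u \<in> S \<one>" "i * u = i" using unit_right[OF one_closed iS] by blast
  have "component i x \<in> I \<star> S x" for x
  proof (cases "x = \<one>")
    case True
    have "i * u \<in> I \<star> S \<one>" using i u(1) by (rule mult_in_sum_mult)
    then show ?thesis using True component_homogeneous[OF one_closed iS] u by simp
  next
    case False
    then show ?thesis using component_homogeneous[OF one_closed iS] by (simp add: sum_mult_zero)
  qed
  then show "i \<in> reduced H I" using si one by (auto simp: reduced_def)
  have "\<one> \<in> finite_conj H"
    using finite_conj_subgroup[OF subgroup.subset[OF M(1)]] by (rule subgroup.one_closed)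
  then show "support i \<subseteq> finite_conj H" using si by auto
qed

text \<open>Elements of \<open>I\<close> have degree \<open>\<one>\<close>, which is its only
  conjugate, so such an element can be paired with itself.\<close>

lemma ideal_not_nilpotent:
  assumes adm: "admissible H I" and j: "j \<in> I" "j \<noteq> 0"
  obtains h s where "h \<in> H" "s \<in> S h" "j * s * j \<noteq> 0"
  using no_annihilating_pair[OF adm ideal_reduced[OF adm j(1)] j(2) ideal_reduced[OF adm j(1)] j(2)] .

section \<open>Linked degrees and localisation to a subgroup\<close>

text \<open>\<open>K\<close> is the span of \<open>S (inv u) J S u J\<close>. It is contained in
  \<open>J\<close> and starts with a factor of degree \<open>inv u\<close>, so a nonzero element of
  \<open>K S y K\<close> exhibits a nonzero product with elements of \<open>J\<close> on both sides
  of degree \<open>y \<otimes> inv u\<close>. Passing to \<open>K\<close> thus keeps only linked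
  degrees whose translate is linked as well.\<close>

lemma linked_conjugate_ideal:
  assumes J: "ideal_of (S \<one>) J" and u: "u \<in> carrier G" and lu: "linked J u"
  obtains K where "ideal_of (S \<one>) K" "K \<subseteq> J" "K \<noteq> {0}"
    "\<And>y. y \<in> carrier G \<Longrightarrow> linked K y \<Longrightarrow> linked J (y \<otimes> inv u)"
proof -
  note M = ideal_ofD[OF J]
  define X where "X = {q * a * s * b | q a s b. q \<in> S (inv u) \<and> a \<in> J \<and> s \<in> S u \<and> b \<in> J}"
  have iu: "inv u \<in> carrier G" using u by simp
  have JS: "j \<in> S \<one>" if "j \<in> J" for j using M(1) that by blast
  have XJ: "X \<subseteq> J"
  proof
    fix x assume "x \<in> X"
    then obtain q a s b where x: "x = q * a * s * b" "q \<in> S (inv u)" "a \<in> J" "s \<in> S u" "b \<in> J"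
      unfolding X_def by blast
    have "q * a \<in> S (inv u)" using S_one_mult(2)[OF iu x(2) JS[OF x(3)]] .
    then have "q * a * s \<in> S \<one>" using S_inv_mult_S(2)[OF u x(4)] by blast
    then show "x \<in> J" unfolding x(1) using M(3) x(5) by blast
  qed
  have idl: "ideal_of (S \<one>) (additive_hull X)"
  proof (rule hull_ideal[OF _ S_additive[OF one_closed]])
    show "X \<subseteq> S \<one>" using XJ M(1) by blast
    fix x assume "x \<in> X"
    then obtain q a s b where x: "x = q * a * s * b" "q \<in> S (inv u)" "a \<in> J" "s \<in> S u" "b \<in> J"
      unfolding X_def by blast
    have "- x = (- q) * a * s * b" "- q \<in> S (inv u)" using x S_minus[OF iu] by auto
    then show "- x \<in> X" unfolding X_def using x by blast
    fix r assume r: "r \<in> S \<one>"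
    have "r * x = (r * q) * a * s * b" "r * q \<in> S (inv u)"
      using x S_one_mult(1)[OF iu x(2) r] by (auto simp: mult.assoc)
    then show "r * x \<in> X" unfolding X_def using x by blast
    have "x * r = q * a * s * (b * r)" "b * r \<in> J"
      using x M(4)[OF r x(5)] by (auto simp: mult.assoc)
    then show "x * r \<in> X" unfolding X_def using x by blast
  qed
  have sub: "additive_hull X \<subseteq> J"
    by (rule hull_subset[OF _ _ XJ]) (use additive_subgroupD[OF M(2)] in auto)
  have ne: "additive_hull X \<noteq> {0}"
  proof -
    obtain a s b where asb: "a \<in> J" "s \<in> S u" "b \<in> J" "a * s * b \<noteq> 0" using lu unfolding linked_def by blast
    have "a * s \<in> S u" using S_one_mult(1)[OF u asb(2) JS[OF asb(1)]] .
    then obtain q where q: "q \<in> S (inv u)" "q * (a * s * b) \<noteq> 0"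
      using left_cancel[OF u, of "a * s" b] asb(4) by blast
    have "q * (a * s * b) = q * a * s * b" by (simp add: mult.assoc)
    then have "q * (a * s * b) \<in> X" unfolding X_def using q(1) asb by blast
    then show ?thesis using q(2) hull_base by blast
  qed
  have link: "linked J (y \<otimes> inv u)" if y: "y \<in> carrier G" and lk: "linked (additive_hull X) y" for y
  proof (rule ccontr)
    assume no: "\<not> linked J (y \<otimes> inv u)"
    obtain k s k' where k: "k \<in> additive_hull X" "s \<in> S y" "k' \<in> additive_hull X" "k * s * k' \<noteq> 0"
      using lk unfolding linked_def by blast
    have "k * s * k' = 0"
    proof (rule hull_vanish[of "\<lambda>x. k * s * x", OF _ _ _ k(3)])
      fix x assume "x \<in> X"
      then obtain q a r b where x: "x = q * a * r * b" "q \<in> S (inv u)" "a \<in> J" "r \<in> S u" "b \<in> J"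
        unfolding X_def by blast
      have "s * q \<in> S (y \<otimes> inv u)" using S_mult[OF y iu k(2) x(2)] .
      then have "k * (s * q) * a = 0" using no sub k(1) x(3) linkedI by blast
      then have "k * (s * q) * a * (r * b) = 0" by simp
      then show "k * s * x = 0" by (simp add: x(1) mult.assoc)
    qed (auto simp: distrib_left)
    then show False using k(4) by simp
  qed
  show ?thesis using that[OF idl sub ne link] by blast
qed

text \<open>A finite set \<open>p\<close> of pairs stands for the coset \<open>{y. conj_by y g = f for all (g, f) \<in> p}\<close>
  of the centraliser of its domain, and \<open>translate u p\<close> for the right translate of this coset by \<open>u\<close>.\<close>

definition solves :: "'a \<Rightarrow> ('a \<times> 'a) set \<Rightarrow> bool" where
  "solves y p \<longleftrightarrow> (\<forall>(g, f)\<in>p. conj_by y g = f)"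

definition translate :: "'a \<Rightarrow> ('a \<times> 'a) set \<Rightarrow> ('a \<times> 'a) set" where
  "translate u p = (\<lambda>(g, f). (g, conj_by u f)) ` p"

lemma solves_translate:
  assumes "p \<subseteq> carrier G \<times> carrier G" "u \<in> carrier G" "y \<in> carrier G"
  shows "solves y (translate u p) \<longleftrightarrow> solves (y \<otimes> inv u) p"
proof -
  have "conj_by y g = conj_by u f \<longleftrightarrow> conj_by (y \<otimes> inv u) g = f" if "(g, f) \<in> p" for g f
  proof -
    have c: "g \<in> carrier G" "f \<in> carrier G" using that assms by auto
    have "conj_by (y \<otimes> inv u) g = conj_by (inv u) (conj_by y g)"
      using c assms by (simp add: conj_by_conj_by)
    then show ?thesis using conj_by_eq_iff[of f "conj_by y g" u] c assms by auto
  qed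
  then show ?thesis unfolding solves_def translate_def by fastforce
qed

lemma translate_one: "p \<subseteq> carrier G \<times> carrier G \<Longrightarrow> translate \<one> p = p"
  unfolding translate_def by force

lemma translate_mult:
  assumes "p \<subseteq> carrier G \<times> carrier G" "u \<in> carrier G" "v \<in> carrier G"
  shows "translate (u \<otimes> v) p = translate v (translate u p)"
  unfolding translate_def image_image
  using assms by (intro image_cong) (auto simp: conj_by_conj_by)

lemma translate_carrier: "p \<subseteq> X \<times> carrier G \<Longrightarrow> u \<in> carrier G \<Longrightarrow> translate u p \<subseteq> X \<times> carrier G"
  unfolding translate_def by auto

lemma card_translate:
  assumes "p \<subseteq> carrier G \<times> carrier G" "u \<in> carrier G"
  shows "card (translate u p) = card p"
  unfolding translate_def
proof (rule card_image, rule inj_onI)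
  fix a b assume "a \<in> p" "b \<in> p" and eq: "(\<lambda>(g, f). (g, conj_by u f)) a = (\<lambda>(g, f). (g, conj_by u f)) b"
  then have c: "snd a \<in> carrier G" "snd b \<in> carrier G" using assms by auto
  have "fst a = fst b" "conj_by u (snd a) = conj_by u (snd b)" using eq by (auto split: prod.splits)
  then have "snd a = snd b" using c assms(2) by (metis conj_by_closed conj_by_eq_iff)
  then show "a = b" using \<open>fst a = fst b\<close> by (simp add: prod_eq_iff)
qed

text \<open>Among the nonzero ideals below \<open>J0\<close> and the covers of their linked elements, one first maximises
  the least size \<open>i\<close> of a member of the cover and then minimises the number of members of size \<open>i\<close>.
  Passing to a conjugate ideal intersects the cover with its translates, so linked elements permute
  the members of size \<open>i\<close>, and \<open>L\<close> is the stabiliser of these members.\<close>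

lemma localising_subgroup:
  assumes adm: "admissible H I" and J0: "ideal_of (S \<one>) J0" "J0 \<subseteq> I" "J0 \<noteq> {0}"
    and X: "finite X" "X \<subseteq> carrier G" and F: "finite F"
    and cover: "\<And>y. y \<in> H \<Longrightarrow> linked J0 y \<Longrightarrow> \<exists>g\<in>X. conj_by y g \<in> F"
  obtains J L g where "ideal_of (S \<one>) J" "J \<subseteq> J0" "J \<noteq> {0}" "subgroup L G" "L \<subseteq> H"
    "g \<in> X" "g \<in> finite_conj L" "\<And>y. y \<in> H \<Longrightarrow> linked J y \<Longrightarrow> y \<in> L"
proof -
  note M = admissibleD[OF adm]
  have H: "subgroup H G" by (rule M(1))
  have Hc: "h \<in> carrier G" if "h \<in> H" for h using M(6)[OF that] .
  have some_linked: "\<exists>y\<in>H. linked J y" if J: "ideal_of (S \<one>) J" "J \<subseteq> J0" "J \<noteq> {0}" for J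
  proof -
    have "0 \<in> J" using ideal_ofD(2)[OF J(1)] by (rule additive_subgroupD(1))
    then obtain j where j: "j \<in> J" "j \<noteq> 0" using J(3) by blast
    obtain h s where "h \<in> H" "s \<in> S h" "j * s * j \<noteq> 0"
      by (rule ideal_not_nilpotent[OF adm _ j(2)]) (use j J J0 in auto)
    then show ?thesis using linkedI j by blast
  qed
  \<comment> \<open>Requiring each member to be solved by a linked degree discards cosets that cover
    nothing; at the end such a degree is needed for a member of smallest size.\<close>
  define covers where "covers J (i::nat) P \<longleftrightarrow> ideal_of (S \<one>) J \<and> J \<subseteq> J0 \<and> J \<noteq> {0} \<and> finite P \<and>
    (\<forall>p\<in>P. p \<subseteq> X \<times> carrier G \<and> finite p \<and> i \<le> card p \<and> (\<exists>y\<in>H. linked J y \<and> solves y p)) \<and>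
    (\<forall>y\<in>H. linked J y \<longrightarrow> (\<exists>p\<in>P. solves y p))" for J i P
  have coversD: "ideal_of (S \<one>) J" "J \<subseteq> J0" "J \<noteq> {0}" "finite P"
    "\<forall>p\<in>P. p \<subseteq> X \<times> carrier G \<and> finite p \<and> i \<le> card p \<and> (\<exists>y\<in>H. linked J y \<and> solves y p)"
    "\<forall>y\<in>H. linked J y \<longrightarrow> (\<exists>p\<in>P. solves y p)" if c: "covers J i P" for J i P
  proof -
    note c' = c[unfolded covers_def]
    show "ideal_of (S \<one>) J" by (rule c'[THEN conjunct1])
    show "J \<subseteq> J0" by (rule c'[THEN conjunct2, THEN conjunct1])
    show "J \<noteq> {0}" by (rule c'[THEN conjunct2, THEN conjunct2, THEN conjunct1])
    show "finite P" by (rule c'[THEN conjunct2, THEN conjunct2, THEN conjunct2, THEN conjunct1])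
    show "\<forall>p\<in>P. p \<subseteq> X \<times> carrier G \<and> finite p \<and> i \<le> card p \<and> (\<exists>y\<in>H. linked J y \<and> solves y p)"
      by (rule c'[THEN conjunct2, THEN conjunct2, THEN conjunct2, THEN conjunct2, THEN conjunct1])
    show "\<forall>y\<in>H. linked J y \<longrightarrow> (\<exists>p\<in>P. solves y p)"
      by (rule c'[THEN conjunct2, THEN conjunct2, THEN conjunct2, THEN conjunct2, THEN conjunct2])
  qed
  \<comment> \<open>A member solved by \<open>y\<close> is part of the graph of conjugation by
    \<open>y\<close> on \<open>X\<close>, so its size is at most that of \<open>X\<close> and the
    greatest \<open>i\<close> exists.\<close>
  have bound: "i < Suc (card X)" if c: "covers J i P" for J i P
  proof -
    obtain y where "y \<in> H" "linked J y" using some_linked[OF coversD(1-3)[OF c]] by blast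
    then obtain p where p: "p \<in> P" "solves y p" using coversD(6)[OF c] by blast
    then have y: "p \<subseteq> X \<times> carrier G" "i \<le> card p" "solves y p" using coversD(5)[OF c] by auto
    then have "p \<subseteq> (\<lambda>g. (g, conj_by y g)) ` X" by (auto simp: solves_def)
    then have "card p \<le> card X" using X by (meson card_image_le card_mono finite_imageI le_trans)
    then show ?thesis using y by simp
  qed
  have "covers J0 1 {p. (\<exists>g\<in>X. \<exists>f\<in>F. p = {(g, f)}) \<and> (\<exists>y\<in>H. linked J0 y \<and> solves y p)}" (is "covers J0 1 ?P")
  proof -
    have "?P \<subseteq> (\<lambda>(g, f). {(g, f)}) ` (X \<times> F)" by auto
    then have "finite ?P" using X(1) F by (meson finite_SigmaI finite_imageI finite_subset)
    moreover have "p \<subseteq> X \<times> carrier G \<and> finite p \<and> 1 \<le> card p \<and> (\<exists>y\<in>H. linked J0 y \<and> solves y p)"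
      if p: "p \<in> ?P" for p
    proof -
      obtain g f y where "g \<in> X" "f \<in> F" "p = {(g, f)}" "y \<in> H" "linked J0 y" "solves y p" using p by blast
      moreover from this have "f \<in> carrier G" using X(2) Hc by (auto simp: solves_def)
      ultimately show ?thesis by auto
    qed
    moreover have "\<exists>p\<in>?P. solves y p" if y: "y \<in> H" "linked J0 y" for y
    proof -
      obtain g where "g \<in> X" "conj_by y g \<in> F" using cover[OF y] by blast
      then show ?thesis using y by (intro bexI[of _ "{(g, conj_by y g)}"]) (auto simp: solves_def)
    qed
    ultimately show ?thesis unfolding covers_def using J0 by blast
  qed
  then have ex1: "\<exists>J P. covers J 1 P" by blast
  obtain i where i: "\<exists>J P. covers J i P" and max: "\<And>k. \<exists>J P. covers J k P \<Longrightarrow> k \<le> i"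
    using ex_has_greatest_nat[of "\<lambda>i. \<exists>J P. covers J i P" 1 "\<lambda>i. i" "Suc (card X)"] ex1 bound by blast
  have i1: "1 \<le> i" using max[OF ex1] .
  define low where "low P = {p \<in> P. card p = i}" for P :: "('a \<times> 'a) set set"
  obtain J P where JP: "covers J i P" and min: "\<And>J' P'. covers J' i P' \<Longrightarrow> card (low P) \<le> card (low P')"
    using ex_has_least_nat[of "\<lambda>(J, P). covers J i P" _ "\<lambda>(J, P). card (low P)"] i by fastforce
  note J = coversD(1-3)[OF JP] and finP = coversD(4)[OF JP]
  have Pp: "p \<subseteq> X \<times> carrier G \<and> finite p \<and> i \<le> card p" if "p \<in> P" for p
    using coversD(5)[OF JP] that by simp
  have Py: "\<exists>y\<in>H. linked J y \<and> solves y p" if "p \<in> P" for p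
    using coversD(5)[OF JP] that by simp
  have Pc: "\<exists>p\<in>P. solves y p" if "y \<in> H" "linked J y" for y
    using coversD(6)[OF JP] that by simp
  have Pcc: "p \<subseteq> carrier G \<times> carrier G" if "p \<in> P" for p using Pp[OF that] X(2) by blast
  have finlow: "finite (low P)" using finP by (simp add: low_def)
  have lowP: "p \<in> P" if "p \<in> low P" for p using that by (simp add: low_def)
  \<comment> \<open>Otherwise all members would have size at least \<open>Suc i\<close>, against the
    choice of \<open>i\<close>.\<close>
  have "low P \<noteq> {}"
  proof
    assume "low P = {}"
    then have "Suc i \<le> card p" if "p \<in> P" for p using Pp[OF that] that by (auto simp: low_def le_less)
    then have "covers J (Suc i) P" using JP unfolding covers_def by blast
    then show False using max[of "Suc i"] by auto
  qed
  then obtain p0 where p0: "p0 \<in> low P" by blast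
  have "p0 \<noteq> {}" using p0 i1 by (auto simp: low_def)
  then obtain g f where gf: "(g, f) \<in> p0" by auto
  have gX: "g \<in> X" using gf Pp[OF lowP[OF p0]] by auto
  have stable: "translate u ` low P = low P" if u: "u \<in> H" "linked J u" for u
  proof -
    have uc: "u \<in> carrier G" using Hc u by simp
    obtain K where K: "ideal_of (S \<one>) K" "K \<subseteq> J" "K \<noteq> {0}"
      "\<And>y. y \<in> carrier G \<Longrightarrow> linked K y \<Longrightarrow> linked J (y \<otimes> inv u)"
      using linked_conjugate_ideal[OF J(1) uc u(2)] by blast
    \<comment> \<open>A degree linked for \<open>K\<close> solves some member of \<open>P\<close>,
      and so does its translate by \<open>inv u\<close>. The union
      \<open>p \<union> translate u q\<close> describes the intersection of the two cosets.\<close>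
    define R where "R = {r. (\<exists>p\<in>P. \<exists>q\<in>P. r = p \<union> translate u q) \<and> (\<exists>y\<in>H. linked K y \<and> solves y r)}"
    have "R \<subseteq> (\<lambda>(p, q). p \<union> translate u q) ` (P \<times> P)" by (auto simp: R_def)
    then have finR: "finite R" using finP by (meson finite_SigmaI finite_imageI finite_subset)
    have R: "r \<subseteq> X \<times> carrier G \<and> finite r \<and> i \<le> card r" if r: "r \<in> R" for r
    proof -
      obtain p q where pq: "p \<in> P" "q \<in> P" "r = p \<union> translate u q" using r by (auto simp: R_def)
      have fr: "finite r" using pq Pp by (auto simp: translate_def)
      then have "card p \<le> card r" using pq by (intro card_mono) auto
      moreover have "r \<subseteq> X \<times> carrier G" using pq Pp translate_carrier[OF _ uc] by auto
      ultimately show ?thesis using fr Pp[OF pq(1)] by auto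
    qed
    have "\<exists>r\<in>R. solves y r" if y: "y \<in> H" "linked K y" for y
    proof -
      have yc: "y \<in> carrier G" using Hc y by simp
      obtain p where p: "p \<in> P" "solves y p" using Pc[OF y(1) linked_mono[OF K(2) y(2)]] by blast
      have "y \<otimes> inv u \<in> H" using H y u M(7) by (auto intro: subgroup.m_closed)
      then obtain q where q: "q \<in> P" "solves (y \<otimes> inv u) q" using Pc K(4)[OF yc y(2)] by blast
      then have "solves y (p \<union> translate u q)"
        using p solves_translate[OF Pcc[OF q(1)] uc yc] by (auto simp: solves_def)
      then show ?thesis using p q y by (auto simp: R_def)
    qed
    then have "covers K i R"
      unfolding covers_def using K J finR R by (auto simp: R_def)
    then have le: "card (low P) \<le> card (low R)" by (rule min)
    \<comment> \<open>Both parts of such a union have at least \<open>i\<close> elements, so a union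
      of size \<open>i\<close> coincides with each of them.\<close>
    have "low R \<subseteq> low P \<inter> translate u ` low P"
    proof
      fix r assume r: "r \<in> low R"
      then obtain p q where pq: "p \<in> P" "q \<in> P" "r = p \<union> translate u q" by (auto simp: low_def R_def)
      have fr: "finite r" "card r = i" using r R by (auto simp: low_def)
      have sub: "p \<subseteq> r" "translate u q \<subseteq> r" unfolding pq(3) by simp_all
      have ct: "card (translate u q) = card q" using card_translate[OF Pcc[OF pq(2)] uc] .
      have "i \<le> card p" "i \<le> card q" using Pp pq by blast+
      then have "p = r" and tq: "translate u q = r"
        using card_seteq[OF fr(1) sub(1)] card_seteq[OF fr(1) sub(2)] fr(2) ct by simp_all
      then have "card p = i" "card q = i" using fr(2) ct by simp_all
      then have "p \<in> low P" "q \<in> low P" using pq(1,2) by (simp_all add: low_def)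
      then show "r \<in> low P \<inter> translate u ` low P" using \<open>p = r\<close> tq by blast
    qed
    then have "card (low P) \<le> card (low P \<inter> translate u ` low P)"
      using le finlow by (meson card_mono finite_Int le_trans)
    then have "low P \<inter> translate u ` low P = low P" using finlow by (intro card_seteq) auto
    then have "low P \<subseteq> translate u ` low P" by blast
    then show ?thesis using card_image_le[OF finlow, of "translate u"] finlow by (metis card_seteq finite_imageI)
  qed
  define L where "L = {u \<in> H. translate u ` low P = low P}"
  have LH: "L \<subseteq> H" by (auto simp: L_def)
  have tr: "translate v ` translate u ` low P = translate (u \<otimes> v) ` low P" if "u \<in> H" "v \<in> H" for u v
    unfolding image_image
    using translate_mult[OF Pcc[OF lowP] Hc[OF that(1)] Hc[OF that(2)]] by (intro image_cong) auto
  have one: "translate \<one> ` low P = low P"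
    using translate_one[OF Pcc[OF lowP]] by force
  have L: "subgroup L G"
  proof
    show "L \<subseteq> carrier G" using LH Hc by blast
    show "\<one> \<in> L" using one H by (simp add: L_def subgroup.one_closed)
    show "u \<otimes> v \<in> L" if "u \<in> L" "v \<in> L" for u v
      using that tr[of u v] H by (auto simp: L_def intro: subgroup.m_closed)
    show "inv u \<in> L" if u: "u \<in> L" for u
    proof -
      have uH: "u \<in> H" "translate u ` low P = low P" using u by (auto simp: L_def)
      then have "translate (inv u) ` low P = translate (inv u) ` translate u ` low P" by simp
      also have "\<dots> = low P" using tr[OF uH(1) M(7)[OF uH(1)]] one Hc[OF uH(1)] by simp
      finally show ?thesis using M(7)[OF uH(1)] by (simp add: L_def)
    qed
  qed
  have linkedL: "y \<in> L" if "y \<in> H" "linked J y" for y using stable[OF that] that by (simp add: L_def)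
  obtain y where y: "y \<in> H" "linked J y" "solves y p0" using Py[OF lowP[OF p0]] by blast
  have f: "f = conj_by y g" using y(3) gf by (auto simp: solves_def)
  \<comment> \<open>\<open>L\<close> permutes the finitely many members of size \<open>i\<close>, so
    the values attached to \<open>g\<close> in them are finite in number. As \<open>y\<close> itself
    lies in \<open>L\<close>, every \<open>L\<close>-conjugate of \<open>g\<close> is an
    \<open>L\<close>-conjugate of \<open>f\<close> and occurs as such a value.\<close>
  have "(\<lambda>h. conj_by h g) ` L \<subseteq> snd ` \<Union> (low P)"
  proof
    fix w assume "w \<in> (\<lambda>h. conj_by h g) ` L"
    then obtain l where l: "l \<in> L" "w = conj_by l g" by blast
    have yL: "y \<in> L" using linkedL y by blast
    define u where "u = inv y \<otimes> l"
    have uL: "u \<in> L" unfolding u_def using L yL l by (simp add: subgroup.m_closed subgroup.m_inv_closed)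
    have c: "g \<in> carrier G" "y \<in> carrier G" "l \<in> carrier G" using gX X Hc LH l y by auto
    have "conj_by u f = w"
      unfolding f u_def l(2) using c by (simp add: conj_by_conj_by inv_cancel_left)
    then have "(g, w) \<in> translate u p0" using gf by (force simp: translate_def)
    moreover have "translate u p0 \<in> low P" using uL p0 by (auto simp: L_def)
    ultimately show "w \<in> snd ` \<Union> (low P)" by force
  qed
  moreover have "finite (\<Union> (low P))" using finlow Pp lowP by blast
  ultimately have "finite ((\<lambda>h. conj_by h g) ` L)" by (meson finite_imageI finite_subset)
  then have "g \<in> finite_conj L" using gX X by (auto simp: finite_conj_def)
  then show ?thesis using that[OF J L LH gX] linkedL by blast
qed

text \<open>The \<open>L\<close>-conjugates of \<open>J\<close> span an invariant ideal. For a
  degree \<open>x\<close> of \<open>H\<close> outside \<open>L\<close>, a product of two conjugates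
  contains \<open>J\<close> twice with a factor of degree
  \<open>l \<otimes> x \<otimes> inv l'\<close> in between; this degree is outside \<open>L\<close>,
  so \<open>J\<close> is not linked there. Outside \<open>H\<close> the product vanishes already for
  \<open>I\<close>.\<close>

lemma admissible_hull:
  assumes adm: "admissible H I" and J: "ideal_of (S \<one>) J" "J \<subseteq> I" and L: "subgroup L G" "L \<subseteq> H"
    and link: "\<And>y. y \<in> H \<Longrightarrow> linked J y \<Longrightarrow> y \<in> L"
  obtains K where "admissible L K" "J \<subseteq> K"
proof -
  note M = admissibleD[OF adm]
  have Lc: "l \<in> carrier G" "inv l \<in> L" "l \<in> H" if "l \<in> L" for l
    using L that by (auto simp: subgroup.mem_carrier subgroup.m_inv_closed)
  define X where "X = {q * j * s | l q j s. l \<in> L \<and> q \<in> S (inv l) \<and> j \<in> J \<and> s \<in> S l}"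
  have JS: "j \<in> S \<one>" if "j \<in> J" for j using ideal_ofD(1)[OF J(1)] that by blast
  have XI: "X \<subseteq> I" unfolding X_def using M(3) Lc(3) J(2) by blast
  have addI: "additive_subgroup_set I" using M(2) by (rule ideal_ofD(2))
  have KI: "additive_hull X \<subseteq> I"
    by (rule hull_subset[OF _ _ XI]) (use additive_subgroupD[OF addI] in auto)
  have JX: "J \<subseteq> X"
  proof
    fix j assume j: "j \<in> J"
    obtain u where u: "u \<in> S \<one>" "u * j = j" using unit_left[OF one_closed JS[OF j]] by blast
    obtain v where v: "v \<in> S \<one>" "j * v = j" using unit_right[OF one_closed JS[OF j]] by blast
    have "j = u * j * v" "u \<in> S (inv \<one>)" using u v by auto
    then show "j \<in> X" unfolding X_def using j v(1) subgroup.one_closed[OF L(1)] by blast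
  qed
  have XS: "X \<subseteq> S \<one>" using XI M(5) by blast
  have "ideal_of (S \<one>) (additive_hull X)"
  proof (rule hull_ideal[OF XS S_additive[OF one_closed]])
    fix x assume "x \<in> X"
    then obtain l q j s where x: "x = q * j * s" "l \<in> L" "q \<in> S (inv l)" "j \<in> J" "s \<in> S l"
      unfolding X_def by blast
    have lc: "l \<in> carrier G" "inv l \<in> carrier G" using Lc x by auto
    have "- x = (- q) * j * s" "- q \<in> S (inv l)" using x S_minus[OF lc(2)] by auto
    then show "- x \<in> X" unfolding X_def using x by blast
    fix r assume r: "r \<in> S \<one>"
    have "r * x = (r * q) * j * s" "r * q \<in> S (inv l)"
      using x S_one_mult(1)[OF lc(2) x(3) r] by (auto simp: mult.assoc)
    then show "r * x \<in> X" unfolding X_def using x by blast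
    have "x * r = q * j * (s * r)" "s * r \<in> S l"
      using x S_one_mult(2)[OF lc(1) x(5) r] by (auto simp: mult.assoc)
    then show "x * r \<in> X" unfolding X_def using x by blast
  qed
  moreover have "s * i * t \<in> additive_hull X"
    if x: "x \<in> L" and s: "s \<in> S (inv x)" and i: "i \<in> additive_hull X" and t: "t \<in> S x" for x s i t
    using i
  proof (rule hull_map[rotated -1])
    fix k assume "k \<in> X"
    then obtain l q j p where k: "k = q * j * p" "l \<in> L" "q \<in> S (inv l)" "j \<in> J" "p \<in> S l"
      unfolding X_def by blast
    have c: "l \<in> carrier G" "x \<in> carrier G" using Lc k x by auto
    have "s * q \<in> S (inv (l \<otimes> x))"
      using S_mult[OF _ _ s k(3)] c by (simp add: inv_mult_group)
    moreover have "p * t \<in> S (l \<otimes> x)" using S_mult[OF c k(5) t] .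
    moreover have "l \<otimes> x \<in> L" using L(1) k(2) x by (rule subgroup.m_closed)
    moreover have "s * k * t = (s * q) * j * (p * t)" by (simp add: k(1) mult.assoc)
    ultimately have "s * k * t \<in> X" unfolding X_def using k(4) by blast
    then show "s * k * t \<in> additive_hull X" by (rule hull_base)
  qed (auto simp: distrib_left distrib_right)
  moreover have "i * s * j = 0"
    if x: "x \<in> carrier G" "x \<notin> L" and i: "i \<in> additive_hull X" and s: "s \<in> S x" and j: "j \<in> additive_hull X" for x i s j
  proof (cases "x \<in> H")
    case False
    then show ?thesis using M(4) x(1) KI i s j by blast
  next
    case True
    have XX: "a * s * b = 0" if a: "a \<in> X" and b: "b \<in> X" for a b
    proof -
      obtain l q j p where a: "a = q * j * p" "l \<in> L" "q \<in> S (inv l)" "j \<in> J" "p \<in> S l"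
        using a unfolding X_def by blast
      obtain l' q' j' p' where b: "b = q' * j' * p'" "l' \<in> L" "q' \<in> S (inv l')" "j' \<in> J" "p' \<in> S l'"
        using b unfolding X_def by blast
      have c: "l \<in> carrier G" "l' \<in> carrier G" using Lc a b by auto
      have H': "l \<otimes> x \<otimes> inv l' \<in> H"
        using M(1,7) Lc(3)[OF a(2)] Lc(3)[OF b(2)] True by (auto intro!: subgroup.m_closed[OF M(1)])
      have "l \<otimes> x \<otimes> inv l' \<notin> L"
      proof
        assume "l \<otimes> x \<otimes> inv l' \<in> L"
        then have "inv l \<otimes> (l \<otimes> x \<otimes> inv l') \<otimes> l' \<in> L"
          using L(1) a(2) b(2) by (auto intro!: subgroup.m_closed[OF L(1)] simp: subgroup.m_inv_closed)
        moreover have "inv l \<otimes> (l \<otimes> x \<otimes> inv l') \<otimes> l' = x"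
          using c x(1) by (simp add: m_assoc inv_cancel_left)
        ultimately show False using x(2) by simp
      qed
      then have nl: "\<not> linked J (l \<otimes> x \<otimes> inv l')" using link H' by blast
      have "p * s * q' \<in> S (l \<otimes> x \<otimes> inv l')"
        using S_mult[OF _ _ S_mult[OF c(1) x(1) a(5) s] b(3)] c x(1) by simp
      then have "j * (p * s * q') * j' = 0" using nl a(4) b(4) linkedI by blast
      then have "q * (j * (p * s * q') * j') * p' = 0" by simp
      then show ?thesis by (simp add: a(1) b(1) mult.assoc)
    qed
    have "a * s * j = 0" if "a \<in> X" for a
      using hull_vanish[of "\<lambda>b. a * s * b" X j] XX[OF that] j by (simp add: distrib_left)
    then show ?thesis
      using hull_vanish[of "\<lambda>a. a * s * j" X i] i by (simp add: distrib_right)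
  qed
  ultimately have "admissible L (additive_hull X)" using L(1) by (auto simp: admissible_def)
  moreover have "J \<subseteq> additive_hull X" using JX hull_base by blast
  ultimately show ?thesis by (rule that)
qed

text \<open>Sandwiching \<open>c\<close> between elements of \<open>J\<close> removes all degrees
  outside \<open>L\<close> and puts the other coefficients into \<open>J S x\<close>. The span
  condition keeps the sandwich nonzero: \<open>j p j\<close> is nonzero for some homogeneous
  \<open>p\<close>, hence so is \<open>j p\<close> times some generator
  \<open>s (component c d) z\<close>, and this selects the component that survives.\<close>

lemma transfer_element:
  assumes adm: "admissible L J" and C: "ideal_of UNIV C" and c: "c \<in> C"
    and YD: "Y \<subseteq> carrier G" "D \<subseteq> carrier G" and j: "j \<in> J" "j \<noteq> 0"
    and hull: "j \<in> additive_hull {s * component c d * z | y s d z. y \<in> Y \<and> s \<in> S y \<and> d \<in> D}"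
  obtains y d c' where "y \<in> Y" "d \<in> D" "c' \<in> C" "c' \<in> reduced L J" "component c' \<one> \<noteq> 0"
    "support c' \<subseteq> (\<lambda>g. y \<otimes> g \<otimes> inv (y \<otimes> d)) ` support c"
proof -
  note M = admissibleD[OF adm]
  note JI = ideal_ofD[OF M(2)]
  obtain l p where l: "l \<in> L" "p \<in> S l" "j * p * j \<noteq> 0" using ideal_not_nilpotent[OF adm j] by blast
  have lc: "l \<in> carrier G" using M(6)[OF l(1)] .
  have "\<exists>y s d z. y \<in> Y \<and> s \<in> S y \<and> d \<in> D \<and> j * p * (s * component c d * z) \<noteq> 0"
  proof (rule ccontr)
    assume no: "\<not> ?thesis"
    have "j * p * j = 0"
      by (rule hull_vanish[of "\<lambda>x. j * p * x", OF _ _ _ hull]) (use no in \<open>auto simp: distrib_left\<close>)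
    then show False using l by simp
  qed
  then obtain y s d z where ys: "y \<in> Y" "s \<in> S y" "d \<in> D" "j * p * (s * component c d * z) \<noteq> 0" by blast
  have yc: "y \<in> carrier G" and dc: "d \<in> carrier G" using ys YD by auto
  have jp: "j * p \<in> S l" using S_one_mult(1)[OF lc l(2) M(5)[OF j(1)]] .
  have "j * p * (s * component c d) \<noteq> 0" using ys(4) by (auto simp: mult.assoc[symmetric])
  then obtain q where q: "q \<in> S (inv l)" "q * (j * p * (s * component c d)) \<noteq> 0"
    using left_cancel[OF lc jp] by blast
  \<comment> \<open>The factor \<open>q\<close> of inverse degree brings \<open>j * p\<close> back
    to degree \<open>\<one>\<close>, and invariance of \<open>J\<close> puts the result into
    \<open>J\<close>.\<close>
  define j1 where "j1 = q * j * p"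
  have j1: "j1 \<in> J" unfolding j1_def using M(3)[OF l(1) q(1) j(1) l(2)] .
  define w where "w = j1 * s * component c d"
  have w0: "w \<noteq> 0" using q(2) by (simp add: w_def j1_def mult.assoc)
  have j1s: "j1 * s \<in> S y" using S_one_mult(1)[OF yc ys(2) M(5)[OF j1]] .
  have wS: "w \<in> S (y \<otimes> d)" unfolding w_def using S_mult[OF yc dc j1s component_in[OF dc]] .
  have ydc: "y \<otimes> d \<in> carrier G" using yc dc by simp
  obtain z' where z': "z' \<in> S (inv (y \<otimes> d))" "w * z' \<noteq> 0" using nondegD(1)[OF ydc wS w0] by blast
  \<comment> \<open>The part built so far has been moved to degree \<open>\<one>\<close>, and it
    lies in \<open>J\<close>. Applying non-nilpotence to it yields a right factor \<open>j2\<close>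
    in \<open>J\<close> with \<open>k * j2 \<noteq> 0\<close>; this product becomes the coefficient
    of \<open>c'\<close> at \<open>\<one>\<close>.\<close>
  define k where "k = w * z'"
  have "s * component c d \<in> S (y \<otimes> d)" using S_mult[OF yc dc ys(2) component_in[OF dc]] .
  then have "s * component c d * z' \<in> S \<one>" using S_inv_mult_S(1)[OF ydc _ z'(1)] by blast
  then have "j1 * (s * component c d * z') \<in> J" using JI(4) j1 by blast
  then have kJ: "k \<in> J" by (simp add: k_def w_def mult.assoc)
  have k0: "k \<noteq> 0" using z' by (simp add: k_def)
  obtain l' p' where l': "l' \<in> L" "p' \<in> S l'" "k * p' * k \<noteq> 0" using ideal_not_nilpotent[OF adm kJ k0] by blast
  have lc': "l' \<in> carrier G" using M(6)[OF l'(1)] .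
  have pk: "p' * k \<in> S l'" using S_one_mult(2)[OF lc' l'(2) M(5)[OF kJ]] .
  have "k * (p' * k) \<noteq> 0" using l' by (simp add: mult.assoc)
  then obtain q' where q': "q' \<in> S (inv l')" "k * (p' * k) * q' \<noteq> 0"
    using right_cancel[OF lc' pk] by blast
  define j2 where "j2 = p' * k * q'"
  have j2: "j2 \<in> J" unfolding j2_def
    using M(3)[of "inv l'" p' k q'] M(7)[OF l'(1)] l'(2) kJ q'(1) lc' by simp
  have zj: "z' * j2 \<in> S (inv (y \<otimes> d))" using S_one_mult(2)[OF _ z'(1) M(5)[OF j2]] ydc by simp
  define c' where "c' = (j1 * s) * c * (z' * j2)"
  have comp: "component c' x = (j1 * s) * component c (inv y \<otimes> (x \<otimes> (y \<otimes> d))) * (z' * j2)"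
    if "x \<in> carrier G" for x
    unfolding c'_def using component_mult_homogeneous[OF _ zj that, of "(j1 * s) * c"]
      component_homogeneous_mult[OF yc j1s, of "x \<otimes> (y \<otimes> d)" c] ydc that by simp
  have mid: "s * component c (inv y \<otimes> (x \<otimes> (y \<otimes> d))) * z' \<in> S x" if x: "x \<in> carrier G" for x
  proof -
    have i: "inv y \<otimes> (x \<otimes> (y \<otimes> d)) \<in> carrier G" using x yc dc by simp
    have "s * component c (inv y \<otimes> (x \<otimes> (y \<otimes> d))) * z' \<in> S (y \<otimes> (inv y \<otimes> (x \<otimes> (y \<otimes> d))) \<otimes> inv (y \<otimes> d))"
      using S_mult[OF _ _ S_mult[OF yc i ys(2) component_in[OF i]] z'(1)] yc i ydc by simp
    moreover have "y \<otimes> (inv y \<otimes> (x \<otimes> (y \<otimes> d))) \<otimes> inv (y \<otimes> d) = x"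
      using x yc dc ydc by (simp add: inv_cancel_left m_assoc[of x "y \<otimes> d" "inv (y \<otimes> d)"] del: m_assoc)
    ultimately show ?thesis by simp
  qed
  show ?thesis
  proof (rule that[OF ys(1) ys(3), of c'])
    show "c' \<in> C" unfolding c'_def using ideal_ofD(3,4)[OF C] c by blast
    have "component c' \<one> = w * z' * j2"
      using comp[of \<one>] yc dc by (simp add: inv_cancel_left w_def mult.assoc)
    also have "\<dots> = k * (p' * k) * q'" by (simp add: k_def j2_def mult.assoc)
    finally show "component c' \<one> \<noteq> 0" using q' by simp
    show "support c' \<subseteq> (\<lambda>g. y \<otimes> g \<otimes> inv (y \<otimes> d)) ` support c"
    proof
      fix x assume x: "x \<in> support c'"
      then have xc: "x \<in> carrier G" using support_carrier by blast
      let ?g = "inv y \<otimes> (x \<otimes> (y \<otimes> d))"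
      have "?g \<in> support c" using x comp[OF xc] by (auto simp: support_def)
      moreover have "x = y \<otimes> ?g \<otimes> inv (y \<otimes> d)"
        using xc yc dc ydc by (simp add: inv_cancel_left m_assoc[of x "y \<otimes> d" "inv (y \<otimes> d)"] del: m_assoc)
      ultimately show "x \<in> (\<lambda>g. y \<otimes> g \<otimes> inv (y \<otimes> d)) ` support c" by blast
    qed
    have split: "component c' x = j1 * (s * component c (inv y \<otimes> (x \<otimes> (y \<otimes> d))) * z') * j2" if "x \<in> carrier G" for x
      using comp[OF that] by (simp add: mult.assoc)
    have "component c' x = 0" if "x \<in> carrier G" "x \<notin> L" for x
      unfolding split[OF that(1)] using M(4)[OF that j1 mid[OF that(1)] j2] .
    then have "support c' \<subseteq> L" using support_carrier[of c'] by (auto simp: support_def)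
    moreover have "component c' x \<in> J \<star> S x" if "x \<in> L" for x
    proof -
      have xc: "x \<in> carrier G" using M(6)[OF that] .
      have "s * component c (inv y \<otimes> (x \<otimes> (y \<otimes> d))) * z' * j2 \<in> S x"
        using S_one_mult(2)[OF xc mid[OF xc] M(5)[OF j2]] .
      then have "j1 * (s * component c (inv y \<otimes> (x \<otimes> (y \<otimes> d))) * z' * j2) \<in> J \<star> S x"
        using j1 by (intro mult_in_sum_mult)
      then show ?thesis unfolding split[OF xc] by (simp add: mult.assoc)
    qed
    ultimately show "c' \<in> reduced L J" by (simp add: reduced_def)
  qed
qed

section \<open>Elements derived from \<alpha> and minimal finite-conjugacy parts\<close>

text \<open>Records from which coefficients of \<alpha> an element is built, and by which degree
  these were moved from the left, up to a factor in \<open>E\<close>. Right factors are left free,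
  so that all right multiplications preserve the record.\<close>

definition orbit_span :: "'a set \<Rightarrow> 'r \<Rightarrow> 'a \<Rightarrow> 'r set" where
  "orbit_span E \<alpha> v = additive_hull {s * component \<alpha> d * z | \<delta> s d z. \<delta> \<in> E \<and> s \<in> S (\<delta> \<otimes> v) \<and> d \<in> E}"

lemma orbit_span_zero: "0 \<in> orbit_span E \<alpha> v"
  unfolding orbit_span_def by (rule additive_hull.zero)

lemma orbit_span_mult_right: "c \<in> orbit_span E \<alpha> v \<Longrightarrow> c * r \<in> orbit_span E \<alpha> v"
  unfolding orbit_span_def
proof (erule hull_map[rotated -1])
  fix x assume "x \<in> {s * component \<alpha> d * z | \<delta> s d z. \<delta> \<in> E \<and> s \<in> S (\<delta> \<otimes> v) \<and> d \<in> E}"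
  then obtain \<delta> s d z where "x = s * component \<alpha> d * z" "\<delta> \<in> E" "s \<in> S (\<delta> \<otimes> v)" "d \<in> E" by blast
  moreover then have "x * r = s * component \<alpha> d * (z * r)" by (simp add: mult.assoc)
  ultimately show "x * r \<in> additive_hull {s * component \<alpha> d * z | \<delta> s d z. \<delta> \<in> E \<and> s \<in> S (\<delta> \<otimes> v) \<and> d \<in> E}"
    by (intro hull_base) blast
qed (auto simp: distrib_right)

lemma orbit_span_mult_left:
  assumes c: "c \<in> orbit_span E \<alpha> v" and r: "r \<in> S x" and x: "x \<in> carrier G" and v: "v \<in> carrier G"
    and E: "E \<subseteq> carrier G" and shift: "\<And>\<delta>. \<delta> \<in> E \<Longrightarrow> \<exists>\<delta>'\<in>E. x \<otimes> (\<delta> \<otimes> v) = \<delta>' \<otimes> w"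
  shows "r * c \<in> orbit_span E \<alpha> w"
  using c unfolding orbit_span_def
proof (rule hull_map[rotated -1])
  fix y assume "y \<in> {s * component \<alpha> d * z | \<delta> s d z. \<delta> \<in> E \<and> s \<in> S (\<delta> \<otimes> v) \<and> d \<in> E}"
  then obtain \<delta> s d z where y: "y = s * component \<alpha> d * z" "\<delta> \<in> E" "s \<in> S (\<delta> \<otimes> v)" "d \<in> E" by blast
  obtain \<delta>' where \<delta>': "\<delta>' \<in> E" "x \<otimes> (\<delta> \<otimes> v) = \<delta>' \<otimes> w" using shift[OF y(2)] by blast
  have "\<delta> \<in> carrier G" using y E by blast
  then have "r * s \<in> S (x \<otimes> (\<delta> \<otimes> v))" using S_mult[OF x _ r y(3)] v by simp
  then have "r * s \<in> S (\<delta>' \<otimes> w)" using \<delta>' by simp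
  moreover have "r * y = (r * s) * component \<alpha> d * z" by (simp add: y(1) mult.assoc)
  ultimately show "r * y \<in> additive_hull {s * component \<alpha> d * z | \<delta> s d z. \<delta> \<in> E \<and> s \<in> S (\<delta> \<otimes> w) \<and> d \<in> E}"
    using \<delta>'(1) y(4) by (intro hull_base) blast
qed (auto simp: distrib_left)

lemma orbit_span_diff:
  assumes v: "v \<in> carrier G" and E: "E \<subseteq> carrier G"
    and a: "a \<in> orbit_span E \<alpha> v" and b: "b \<in> orbit_span E \<alpha> v"
  shows "a - b \<in> orbit_span E \<alpha> v"
proof -
  have "- b \<in> orbit_span E \<alpha> v"
    using b unfolding orbit_span_def
  proof (rule hull_minus[rotated -1])
    fix x assume "x \<in> {s * component \<alpha> d * z | \<delta> s d z. \<delta> \<in> E \<and> s \<in> S (\<delta> \<otimes> v) \<and> d \<in> E}"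
    then obtain \<delta> s d z where x: "x = s * component \<alpha> d * z" "\<delta> \<in> E" "s \<in> S (\<delta> \<otimes> v)" "d \<in> E" by blast
    have "- x = s * component \<alpha> d * (- z)" by (simp add: x(1))
    then show "- x \<in> {s * component \<alpha> d * z | \<delta> s d z. \<delta> \<in> E \<and> s \<in> S (\<delta> \<otimes> v) \<and> d \<in> E}" using x by blast
  qed
  then have "a + - b \<in> orbit_span E \<alpha> v" using a unfolding orbit_span_def by (intro hull_add)
  then show ?thesis by simp
qed

text \<open>The elements obtained from \<open>\<alpha>\<close> by the commutator operations of the linking argument below;
  the second clause records where the part of the support with infinite conjugacy classes and the
  coefficients come from.\<close>

definition derived :: "'a set \<Rightarrow> 'r set \<Rightarrow> 'r \<Rightarrow> 'r \<Rightarrow> bool" where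
  "derived H I \<alpha> \<gamma> \<longleftrightarrow> \<gamma> \<in> A \<and> \<gamma> \<in> reduced H I \<and>
    (\<forall>g\<in>support \<gamma> - finite_conj H. \<exists>w\<in>H. \<exists>g\<^sub>0\<in>support \<alpha> - finite_conj H. \<exists>\<delta>\<in>finite_conj H \<inter> H.
      g = w \<otimes> g\<^sub>0 \<otimes> inv w \<otimes> \<delta> \<and>
      (\<forall>d\<in>finite_conj H \<inter> H. component \<gamma> d \<in> orbit_span (finite_conj H \<inter> H) \<alpha> w))"

text \<open>The \<Delta>-part is shortest among derived elements for which it is nonzero. The
  condition at \<open>\<one>\<close> is a normalisation by translation; it singles out the
  coefficient with which all others are compared.\<close>

definition minimal_derived :: "'a set \<Rightarrow> 'r set \<Rightarrow> 'r \<Rightarrow> 'r \<Rightarrow> bool" where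
  "minimal_derived H I \<alpha> \<gamma> \<longleftrightarrow> derived H I \<alpha> \<gamma> \<and> component \<gamma> \<one> \<noteq> 0 \<and>
    (\<forall>\<gamma>'. derived H I \<alpha> \<gamma>' \<longrightarrow> support \<gamma>' \<inter> finite_conj H \<noteq> {} \<longrightarrow>
      card (support \<gamma> \<inter> finite_conj H) \<le> card (support \<gamma>' \<inter> finite_conj H))"

lemma finite_conj_Int_subgroup: "subgroup H G \<Longrightarrow> subgroup (finite_conj H \<inter> H) G"
  using finite_conj_subgroup[OF subgroup.subset] by (rule subgroups_Inter_pair)

lemma conj_by_finite_conj_Int:
  assumes "subgroup H G" "x \<in> finite_conj H \<inter> H" "h \<in> H"
  shows "conj_by h x \<in> finite_conj H \<inter> H"
  using assms finite_conj_conj_by[of H x h]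
  by (auto simp: conj_by_def intro!: subgroup.m_closed subgroup.m_inv_closed)

lemma derived_refl:
  assumes adm: "admissible H I" and \<alpha>: "\<alpha> \<in> A" "\<alpha> \<in> reduced H I"
  shows "derived H I \<alpha> \<alpha>"
proof -
  note M = admissibleD[OF adm]
  have D: "subgroup (finite_conj H \<inter> H) G" using M(1) by (rule finite_conj_Int_subgroup)
  have one: "\<one> \<in> finite_conj H \<inter> H" using D by (rule subgroup.one_closed)
  have "component \<alpha> d \<in> orbit_span (finite_conj H \<inter> H) \<alpha> \<one>" if d: "d \<in> finite_conj H \<inter> H" for d
  proof -
    have dc: "d \<in> carrier G" using d M(6) by blast
    obtain u where u: "u \<in> S \<one>" "u * component \<alpha> d = component \<alpha> d"
      using unit_left[OF dc component_in[OF dc]] by blast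
    obtain v where v: "component \<alpha> d * v = component \<alpha> d"
      using unit_right[OF dc component_in[OF dc]] by blast
    have "component \<alpha> d = u * component \<alpha> d * v" "u \<in> S (\<one> \<otimes> \<one>)" using u v by auto
    then show ?thesis unfolding orbit_span_def using one d by (intro hull_base) blast
  qed
  moreover have "g = \<one> \<otimes> g \<otimes> inv \<one> \<otimes> \<one>" if "g \<in> support \<alpha>" for g
    using that support_carrier[of \<alpha>] by auto
  ultimately show ?thesis
    unfolding derived_def using \<alpha> one by blast
qed

text \<open>A right translation by a degree in \<Delta> only changes the factor \<delta> in the
  record; the conjugating element \<open>w\<close> and the orbit span remain.\<close>

lemma derived_translate:
  assumes adm: "admissible H I" and \<gamma>: "derived H I \<alpha> \<gamma>"
    and d: "d \<in> finite_conj H \<inter> H" and t: "t \<in> S d"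
  shows "derived H I \<alpha> (\<gamma> * t)"
proof -
  note M = admissibleD[OF adm]
  let ?D = "finite_conj H \<inter> H"
  have D: "subgroup ?D G" using M(1) by (rule finite_conj_Int_subgroup)
  have dc: "d \<in> carrier G" using d M(6) by blast
  have "\<gamma> * t \<in> A" using ideal_ofD(4)[OF A] \<gamma> by (simp add: derived_def)
  moreover have \<gamma>R: "\<gamma> \<in> reduced H I" using \<gamma> by (simp add: derived_def)
  then have "\<gamma> * t \<in> reduced H I" using reduced_mult_right1[OF adm _ t] d by blast
  moreover have "\<exists>w\<in>H. \<exists>g\<^sub>0\<in>support \<alpha> - finite_conj H. \<exists>\<delta>\<in>?D. g = w \<otimes> g\<^sub>0 \<otimes> inv w \<otimes> \<delta> \<and>
      (\<forall>d\<in>?D. component (\<gamma> * t) d \<in> orbit_span ?D \<alpha> w)" if g: "g \<in> support (\<gamma> * t) - finite_conj H" for g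
  proof -
    have gc: "g \<in> carrier G" using g support_carrier by blast
    let ?g = "g \<otimes> inv d"
    have gs: "?g \<in> support \<gamma>"
      using g component_mult_homogeneous[OF dc t gc, of \<gamma>] by (auto simp: support_def)
    have geq: "?g \<otimes> d = g" using gc dc by (simp add: m_assoc)
    have "?g \<notin> finite_conj H"
    proof
      assume "?g \<in> finite_conj H"
      then have "?g \<otimes> d \<in> finite_conj H"
        using finite_conj_subgroup[OF subgroup.subset[OF M(1)]] d by (auto intro: subgroup.m_closed)
      then show False using geq g by simp
    qed
    then obtain w g\<^sub>0 \<delta> where w: "w \<in> H" "g\<^sub>0 \<in> support \<alpha> - finite_conj H" "\<delta> \<in> ?D" "?g = w \<otimes> g\<^sub>0 \<otimes> inv w \<otimes> \<delta>"
      "\<forall>d\<in>?D. component \<gamma> d \<in> orbit_span ?D \<alpha> w" using \<gamma> gs unfolding derived_def by blast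
    have c: "w \<in> carrier G" "g\<^sub>0 \<in> carrier G" "\<delta> \<in> carrier G"
      using w support_carrier[of \<alpha>] M(6) by auto
    have "g = w \<otimes> g\<^sub>0 \<otimes> inv w \<otimes> (\<delta> \<otimes> d)" using geq w(4) c dc by (simp add: m_assoc)
    moreover have "\<delta> \<otimes> d \<in> ?D" using D w(3) d by (rule subgroup.m_closed)
    moreover have "component (\<gamma> * t) d' \<in> orbit_span ?D \<alpha> w" if d': "d' \<in> ?D" for d'
    proof -
      have d'c: "d' \<in> carrier G" using d' M(6) by blast
      have "d' \<otimes> inv d \<in> ?D" using D d' d by (simp only: subgroup.m_closed subgroup.m_inv_closed)
      then have "component \<gamma> (d' \<otimes> inv d) * t \<in> orbit_span ?D \<alpha> w"
        using w(5) by (intro orbit_span_mult_right) blast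
      then show ?thesis using component_mult_homogeneous[OF dc t d'c, of \<gamma>] by simp
    qed
    ultimately show ?thesis using w(1,2) by blast
  qed
  ultimately show ?thesis by (simp add: derived_def)
qed

lemma support_translate_subset:
  assumes "d \<in> carrier G" "t \<in> S d"
  shows "support (\<gamma> * t) \<subseteq> (\<lambda>g. g \<otimes> d) ` support \<gamma>"
  using support_mult[OF subset_refl homogeneous_support[OF assms]] by fastforce

lemma minimal_derived_exists:
  assumes adm: "admissible H I" and \<alpha>: "\<alpha> \<in> A" "\<alpha> \<in> reduced H I" "support \<alpha> \<inter> finite_conj H \<noteq> {}"
  obtains \<gamma> where "minimal_derived H I \<alpha> \<gamma>"
proof -
  note M = admissibleD[OF adm]
  let ?D = "finite_conj H \<inter> H"
  have D: "subgroup ?D G" using M(1) by (rule finite_conj_Int_subgroup)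
  have D': "subgroup (finite_conj H) G" using finite_conj_subgroup[OF subgroup.subset[OF M(1)]] .
  let ?size = "\<lambda>\<gamma>. card (support \<gamma> \<inter> finite_conj H)"
  obtain \<gamma> where \<gamma>: "derived H I \<alpha> \<gamma>" "support \<gamma> \<inter> finite_conj H \<noteq> {}"
    and min: "\<And>\<gamma>'. derived H I \<alpha> \<gamma>' \<Longrightarrow> support \<gamma>' \<inter> finite_conj H \<noteq> {} \<Longrightarrow> ?size \<gamma> \<le> ?size \<gamma>'"
    using ex_has_least_nat[of "\<lambda>\<gamma>. derived H I \<alpha> \<gamma> \<and> support \<gamma> \<inter> finite_conj H \<noteq> {}" \<alpha> ?size]
      derived_refl[OF adm \<alpha>(1,2)] \<alpha>(3) by blast
  obtain d where d: "d \<in> support \<gamma>" "d \<in> finite_conj H" using \<gamma>(2) by blast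
  have dD: "d \<in> ?D" using d \<gamma>(1) by (auto simp: derived_def reduced_def)
  have dc: "d \<in> carrier G" using d support_carrier by blast
  obtain t where t: "t \<in> S (inv d)" "component \<gamma> d * t \<noteq> 0"
    using nondegD(1)[OF dc component_in[OF dc]] d by (auto simp: support_def)
  have idD: "inv d \<in> ?D" using D dD by (rule subgroup.m_inv_closed)
  have "derived H I \<alpha> (\<gamma> * t)" using derived_translate[OF adm \<gamma>(1) idD t(1)] .
  moreover have "component (\<gamma> * t) \<one> \<noteq> 0"
    using component_mult_homogeneous[OF _ t(1), of \<one> \<gamma>] dc t(2) by simp
  moreover have "?size (\<gamma> * t) \<le> ?size \<gamma>"
  proof -
    have "support (\<gamma> * t) \<inter> finite_conj H \<subseteq> (\<lambda>g. g \<otimes> inv d) ` (support \<gamma> \<inter> finite_conj H)"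
    proof
      fix x assume x: "x \<in> support (\<gamma> * t) \<inter> finite_conj H"
      then obtain g where g: "g \<in> support \<gamma>" "x = g \<otimes> inv d"
        using support_translate_subset[OF _ t(1), of \<gamma>] dc by blast
      have gc: "g \<in> carrier G" using g support_carrier by blast
      have "x \<otimes> d \<in> finite_conj H" using D' x d by (auto intro: subgroup.m_closed)
      then have "g \<in> finite_conj H" using g gc dc by (simp add: m_assoc)
      then show "x \<in> (\<lambda>g. g \<otimes> inv d) ` (support \<gamma> \<inter> finite_conj H)" using g by blast
    qed
    then show ?thesis by (meson card_image_le card_mono finite_Int finite_imageI finite_support le_trans)
  qed
  ultimately have "minimal_derived H I \<alpha> (\<gamma> * t)"
    unfolding minimal_derived_def using min le_trans by blast
  then show ?thesis by (rule that)
qed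

lemma minimal_derivedD:
  assumes "minimal_derived H I \<alpha> \<gamma>"
  shows "derived H I \<alpha> \<gamma>" "component \<gamma> \<one> \<noteq> 0" "\<gamma> \<in> A" "\<gamma> \<in> reduced H I" "support \<gamma> \<subseteq> H"
  using assms by (auto simp: minimal_derived_def derived_def reduced_def)

lemma minimal_derived_smaller:
  assumes "minimal_derived H I \<alpha> \<gamma>" "derived H I \<alpha> \<gamma>'"
    and "card (support \<gamma>' \<inter> finite_conj H) < card (support \<gamma> \<inter> finite_conj H)"
  shows "support \<gamma>' \<inter> finite_conj H = {}"
  using assms unfolding minimal_derived_def by (meson not_le)

text \<open>If the coefficient at some \<open>d\<close> in \<Delta> did not annihilate
  \<open>t\<close>, a suitable \<open>t * r\<close> of degree \<open>inv d\<close> would move it to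
  a nonzero coefficient at \<open>\<one>\<close>. The coefficient of \<gamma> at
  \<open>\<one>\<close> would be moved to degree \<open>inv d\<close> and be killed there, leaving a
  derived element with a shorter, still nonzero \<Delta>-part.\<close>

lemma minimal_derived_annihilator:
  assumes adm: "admissible H I" and \<gamma>: "minimal_derived H I \<alpha> \<gamma>"
    and h: "h \<in> H" and t: "t \<in> S h" and zero: "component \<gamma> \<one> * t = 0"
  shows "proj (finite_conj H) \<gamma> * t = 0"
proof -
  note M = admissibleD[OF adm]
  let ?D = "finite_conj H \<inter> H"
  have D: "subgroup ?D G" using M(1) by (rule finite_conj_Int_subgroup)
  have D': "subgroup (finite_conj H) G" using finite_conj_subgroup[OF subgroup.subset[OF M(1)]] .
  have hc: "h \<in> carrier G" using M(6)[OF h] .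
  have "component \<gamma> d * t = 0" if d: "d \<in> support \<gamma> \<inter> finite_conj H" for d
  proof (rule ccontr)
    assume ne: "component \<gamma> d * t \<noteq> 0"
    have dD: "d \<in> ?D" using d minimal_derivedD(5)[OF \<gamma>] by blast
    have dc: "d \<in> carrier G" using dD M(6) by blast
    have dhc: "d \<otimes> h \<in> carrier G" using dc hc by simp
    have "component \<gamma> d * t \<in> S (d \<otimes> h)" using dc hc t by (intro S_mult) auto
    then obtain r where r: "r \<in> S (inv (d \<otimes> h))" "component \<gamma> d * t * r \<noteq> 0"
      using nondegD(1)[OF dhc _ ne] by blast
    have "t * r \<in> S (h \<otimes> inv (d \<otimes> h))" using S_mult[OF hc _ t r(1)] dhc by simp
    then have tr: "t * r \<in> S (inv d)" using dc hc by (simp add: inv_mult_group inv_cancel_left)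
    have idD: "inv d \<in> ?D" using D dD by (rule subgroup.m_inv_closed)
    have idc: "inv d \<in> carrier G" using dc by simp
    have der: "derived H I \<alpha> (\<gamma> * (t * r))" using derived_translate[OF adm minimal_derivedD(1)[OF \<gamma>] idD tr] .
    have comp: "component (\<gamma> * (t * r)) z = component \<gamma> (z \<otimes> d) * (t * r)" if "z \<in> carrier G" for z
      using component_mult_homogeneous[OF idc tr that] dc by simp
    have one: "component (\<gamma> * (t * r)) \<one> \<noteq> 0" using comp[of \<one>] r(2) dc by (simp add: mult.assoc)
    have "component (\<gamma> * (t * r)) (inv d) = 0"
      using comp[OF idc] zero dc by (simp add: mult.assoc[symmetric])
    have "support (\<gamma> * (t * r)) \<inter> finite_conj H \<subseteq> (\<lambda>g. g \<otimes> inv d) ` (support \<gamma> \<inter> finite_conj H - {\<one>})"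
    proof
      fix x assume x: "x \<in> support (\<gamma> * (t * r)) \<inter> finite_conj H"
      then obtain g where g: "g \<in> support \<gamma>" "x = g \<otimes> inv d"
        using support_translate_subset[OF idc tr, of \<gamma>] by blast
      have gc: "g \<in> carrier G" using g support_carrier by blast
      have "x \<otimes> d \<in> finite_conj H" using D' x d by (auto intro: subgroup.m_closed)
      then have "g \<in> finite_conj H" using g gc dc by (simp add: m_assoc)
      moreover have "g \<noteq> \<one>"
      proof
        assume "g = \<one>"
        then have "x = inv d" using g dc by simp
        then show False using x \<open>component (\<gamma> * (t * r)) (inv d) = 0\<close> by (simp add: support_def)
      qed
      ultimately show "x \<in> (\<lambda>g. g \<otimes> inv d) ` (support \<gamma> \<inter> finite_conj H - {\<one>})" using g by blast
    qed
    then have "card (support (\<gamma> * (t * r)) \<inter> finite_conj H) \<le> card (support \<gamma> \<inter> finite_conj H - {\<one>})"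
      by (meson card_image_le card_mono finite_Diff finite_Int finite_imageI finite_support le_trans)
    also have "\<dots> < card (support \<gamma> \<inter> finite_conj H)"
      using minimal_derivedD(2)[OF \<gamma>] subgroup.one_closed[OF D']
      by (intro card_Diff1_less) (simp_all add: in_support_iff)
    finally have "support (\<gamma> * (t * r)) \<inter> finite_conj H = {}" by (rule minimal_derived_smaller[OF \<gamma> der])
    then show False using one subgroup.one_closed[OF D'] by (auto simp: support_def)
  qed
  then show ?thesis unfolding proj_def by (simp add: sum_distrib_right)
qed

text \<open>The coefficient \<open>e\<close> of \<gamma> at \<open>\<one>\<close> is inserted on the
  other side of \<open>t\<close> in each term, so the two terms cancel in degree
  \<open>\<one>\<close>. A support element outside \<Delta> comes either from the first term, where
  conjugation turns \<open>w\<close> into \<open>x \<otimes> w\<close>, or from \<gamma> itself,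
  where \<open>w\<close> stays. In each case the coefficients of both terms must lie in one orbit
  span, and this works because \<open>e\<close> is in the span for \<open>w\<close> too.\<close>

lemma derived_commutator:
  assumes adm: "admissible H I" and \<gamma>: "derived H I \<alpha> \<gamma>" and x: "x \<in> H"
    and t: "t \<in> S x" and t': "t' \<in> S (inv x)"
  shows "derived H I \<alpha> (component \<gamma> \<one> * t * \<gamma> * t' - \<gamma> * (t * component \<gamma> \<one> * t'))" (is "derived H I \<alpha> ?c")
    and "\<And>g. g \<in> carrier G \<Longrightarrow> component (component \<gamma> \<one> * t * \<gamma> * t' - \<gamma> * (t * component \<gamma> \<one> * t')) g =
      component \<gamma> \<one> * t * component \<gamma> (conj_by x g) * t' - component \<gamma> g * (t * component \<gamma> \<one> * t')"
proof -
  note M = admissibleD[OF adm]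
  let ?D = "finite_conj H \<inter> H" and ?e = "component \<gamma> \<one>"
  have D: "subgroup ?D G" using M(1) by (rule finite_conj_Int_subgroup)
  have Dc: "?D \<subseteq> carrier G" using D by (rule subgroup.subset)
  have xc: "x \<in> carrier G" "inv x \<in> carrier G" using M(6)[OF x] by auto
  have et: "?e * t \<in> S x" using S_one_mult(1)[OF xc(1) t] by simp
  have te: "t * ?e \<in> S x" using S_one_mult(2)[OF xc(1) t] by simp
  have tet: "t * ?e * t' \<in> S \<one>" using S_inv_mult_S(1)[OF xc(1) te t'] .
  show comp: "component ?c g = ?e * t * component \<gamma> (conj_by x g) * t' - component \<gamma> g * (t * ?e * t')"
    if g: "g \<in> carrier G" for g
    using component_mult_homogeneous[OF xc(2) t' g, of "?e * t * \<gamma>"]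
      component_homogeneous_mult[OF xc(1) et, of "g \<otimes> x" \<gamma>]
      component_mult_homogeneous[OF one_closed tet g, of \<gamma>] xc g
    by (simp add: conj_by_def m_assoc)
  have \<gamma>A: "\<gamma> \<in> A" and \<gamma>R: "\<gamma> \<in> reduced H I" using \<gamma> by (auto simp: derived_def)
  have "?c \<in> A" using \<gamma>A ideal_ofD(3,4)[OF A] by (intro ideal_diff[OF A]) auto
  moreover have "?c \<in> reduced H I"
  proof -
    have "?e * t * \<gamma> * t' \<in> reduced H I"
      using reduced_mult_right1[OF adm M(7)[OF x] t' reduced_mult_left1[OF adm x et \<gamma>R]] .
    moreover have "\<gamma> * (t * ?e * t') \<in> reduced H I"
      using reduced_mult_right1[OF adm subgroup.one_closed[OF M(1)] tet \<gamma>R] .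
    ultimately have "?e * t * \<gamma> * t' + - (\<gamma> * (t * ?e * t')) \<in> reduced H I"
      by (intro reduced_add reduced_minus[OF adm])
    then show ?thesis by simp
  qed
  moreover have "\<exists>w\<in>H. \<exists>g\<^sub>0\<in>support \<alpha> - finite_conj H. \<exists>\<delta>\<in>?D. g = w \<otimes> g\<^sub>0 \<otimes> inv w \<otimes> \<delta> \<and>
      (\<forall>d\<in>?D. component ?c d \<in> orbit_span ?D \<alpha> w)" if g: "g \<in> support ?c - finite_conj H" for g
  proof -
    have gc: "g \<in> carrier G" using g support_carrier by blast
    have one: "\<one> \<in> ?D" using D by (rule subgroup.one_closed)
    have "component ?c g \<noteq> 0" using g in_support_iff[of g ?c] by blast
    then have "?e * t * component \<gamma> (conj_by x g) * t' - component \<gamma> g * (t * ?e * t') \<noteq> 0"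
      unfolding comp[OF gc] .
    then consider "conj_by x g \<in> support \<gamma>" | "g \<in> support \<gamma>"
      by (cases "component \<gamma> g = 0"; cases "component \<gamma> (conj_by x g) = 0") (auto simp: in_support_iff)
    then show ?thesis
    proof cases
      case 1
      have "conj_by x g \<notin> finite_conj H"
      proof
        assume "conj_by x g \<in> finite_conj H"
        then have "conj_by (inv x) (conj_by x g) \<in> finite_conj H"
          using finite_conj_conj_by[OF M(1) _ M(7)[OF x]] by blast
        then show False using g gc xc by (simp add: conj_by_conj_by)
      qed
      then obtain w g\<^sub>0 \<delta> where w: "w \<in> H" "g\<^sub>0 \<in> support \<alpha> - finite_conj H" "\<delta> \<in> ?D"
        "conj_by x g = w \<otimes> g\<^sub>0 \<otimes> inv w \<otimes> \<delta>" "\<And>d. d \<in> ?D \<Longrightarrow> component \<gamma> d \<in> orbit_span ?D \<alpha> w"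
        using \<gamma> 1 unfolding derived_def by blast
      have c: "w \<in> carrier G" "g\<^sub>0 \<in> carrier G" "\<delta> \<in> carrier G"
        using w support_carrier[of \<alpha>] M(6) by auto
      have xw: "x \<otimes> w \<in> H" using M(1) x w(1) by (rule subgroup.m_closed)
      have "g = conj_by (inv x) (conj_by x g)" using gc xc by (simp add: conj_by_conj_by)
      also have "\<dots> = (x \<otimes> w) \<otimes> g\<^sub>0 \<otimes> inv (x \<otimes> w) \<otimes> conj_by (inv x) \<delta>"
        unfolding w(4) using c xc by (simp add: conj_by_def m_assoc inv_mult_group inv_cancel_left)
      finally have geq: "g = (x \<otimes> w) \<otimes> g\<^sub>0 \<otimes> inv (x \<otimes> w) \<otimes> conj_by (inv x) \<delta>" .
      have \<delta>': "conj_by (inv x) \<delta> \<in> ?D" by (rule conj_by_finite_conj_Int[OF M(1) w(3) M(7)[OF x]])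
      have shift: "\<exists>\<delta>'\<in>?D. x \<otimes> (\<delta> \<otimes> w) = \<delta>' \<otimes> (x \<otimes> w)" if \<delta>: "\<delta> \<in> ?D" for \<delta>
      proof (rule bexI)
        show "conj_by (inv x) \<delta> \<in> ?D" by (rule conj_by_finite_conj_Int[OF M(1) \<delta> M(7)[OF x]])
        show "x \<otimes> (\<delta> \<otimes> w) = conj_by (inv x) \<delta> \<otimes> (x \<otimes> w)"
          using Dc \<delta> xc c by (auto simp: conj_by_def m_assoc inv_cancel_left)
      qed
      have "component ?c d \<in> orbit_span ?D \<alpha> (x \<otimes> w)" if d: "d \<in> ?D" for d
      proof -
        have dc: "d \<in> carrier G" using d Dc by auto
        have "?e * t * component \<gamma> (conj_by x d) \<in> orbit_span ?D \<alpha> (x \<otimes> w)"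
          by (rule orbit_span_mult_left[OF w(5) et xc(1) c(1) Dc shift])
            (use conj_by_finite_conj_Int[OF M(1) d x] in auto)
        then have 1: "?e * t * component \<gamma> (conj_by x d) * t' \<in> orbit_span ?D \<alpha> (x \<otimes> w)"
          by (rule orbit_span_mult_right)
        have 2: "t * ?e \<in> orbit_span ?D \<alpha> (x \<otimes> w)"
          by (rule orbit_span_mult_left[OF w(5)[OF one] t xc(1) c(1) Dc shift])
        \<comment> \<open>The left factor has degree \<open>d\<close> in \<open>?D\<close>, which
          the factor \<delta> of the span absorbs.\<close>
        have "component \<gamma> d * (t * ?e) \<in> orbit_span ?D \<alpha> (x \<otimes> w)"
        proof (rule orbit_span_mult_left[OF 2 component_in[OF dc] dc _ Dc])
          show "x \<otimes> w \<in> carrier G" using xc c by simp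
          fix \<delta> assume \<delta>: "\<delta> \<in> ?D"
          show "\<exists>\<delta>'\<in>?D. d \<otimes> (\<delta> \<otimes> (x \<otimes> w)) = \<delta>' \<otimes> (x \<otimes> w)"
          proof (rule bexI)
            show "d \<otimes> \<delta> \<in> ?D" using D d \<delta> by (rule subgroup.m_closed)
            show "d \<otimes> (\<delta> \<otimes> (x \<otimes> w)) = d \<otimes> \<delta> \<otimes> (x \<otimes> w)"
              using dc \<delta> Dc xc c by (auto simp: m_assoc)
          qed
        qed
        then have "component \<gamma> d * (t * ?e) * t' \<in> orbit_span ?D \<alpha> (x \<otimes> w)"
          by (rule orbit_span_mult_right)
        then have "component \<gamma> d * (t * ?e * t') \<in> orbit_span ?D \<alpha> (x \<otimes> w)" by (simp add: mult.assoc)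
        then show ?thesis
          unfolding comp[OF dc] using 1 xc c by (intro orbit_span_diff[OF _ Dc]) auto
      qed
      then show ?thesis using xw w(2) \<delta>' geq by blast
    next
      case 2
      then obtain w g\<^sub>0 \<delta> where w: "w \<in> H" "g\<^sub>0 \<in> support \<alpha> - finite_conj H" "\<delta> \<in> ?D"
        "g = w \<otimes> g\<^sub>0 \<otimes> inv w \<otimes> \<delta>" "\<And>d. d \<in> ?D \<Longrightarrow> component \<gamma> d \<in> orbit_span ?D \<alpha> w"
        using \<gamma> g unfolding derived_def by blast
      have "component ?c d \<in> orbit_span ?D \<alpha> w" if d: "d \<in> ?D" for d
      proof -
        have dc: "d \<in> carrier G" using d Dc by auto
        have "?e * (t * component \<gamma> (conj_by x d) * t') \<in> orbit_span ?D \<alpha> w"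
          using w(5)[OF one] by (rule orbit_span_mult_right)
        then have "?e * t * component \<gamma> (conj_by x d) * t' \<in> orbit_span ?D \<alpha> w" by (simp add: mult.assoc)
        moreover have "component \<gamma> d * (t * ?e * t') \<in> orbit_span ?D \<alpha> w"
          using w(5)[OF d] by (rule orbit_span_mult_right)
        ultimately show ?thesis
          unfolding comp[OF dc] using M(6)[OF w(1)] by (intro orbit_span_diff[OF _ Dc]) auto
      qed
      then show ?thesis using w by blast
    qed
  qed
  ultimately show "derived H I \<alpha> ?c" by (simp add: derived_def)
qed

text \<open>For \<open>x\<close> centralising the \<open>\<Delta>\<close>-part of the support, the commutator lies in \<open>derived\<close> and its
  \<open>\<Delta>\<close>-part misses the degree \<open>\<one>\<close>, so it vanishes by minimality.\<close>

lemma minimal_derived_linking: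
  assumes adm: "admissible H I" and \<gamma>: "minimal_derived H I \<alpha> \<gamma>" and x: "x \<in> H"
    and centralises: "\<And>c. c \<in> support \<gamma> \<inter> finite_conj H \<Longrightarrow> conj_by x c = c"
    and t: "t \<in> S x" and t': "t' \<in> S (inv x)"
  shows "component \<gamma> \<one> * t * proj (finite_conj H) \<gamma> * t' = proj (finite_conj H) \<gamma> * t * component \<gamma> \<one> * t'"
proof -
  note M = admissibleD[OF adm]
  let ?C = "support \<gamma> \<inter> finite_conj H" and ?e = "component \<gamma> \<one>"
  have D': "subgroup (finite_conj H) G" using finite_conj_subgroup[OF subgroup.subset[OF M(1)]] .
  have xc: "x \<in> carrier G" using M(6)[OF x] .
  let ?c = "?e * t * \<gamma> * t' - \<gamma> * (t * ?e * t')"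
  note der = derived_commutator[OF adm minimal_derivedD(1)[OF \<gamma>] x t t']
  have "support ?c \<inter> finite_conj H \<subseteq> ?C - {\<one>}"
  proof
    fix g assume g: "g \<in> support ?c \<inter> finite_conj H"
    then have gc: "g \<in> carrier G" using support_carrier by blast
    have "component ?c g \<noteq> 0" using g in_support_iff[of g ?c] by blast
    then have ne: "?e * t * component \<gamma> (conj_by x g) * t' - component \<gamma> g * (t * ?e * t') \<noteq> 0"
      unfolding der(2)[OF gc] .
    have "g \<in> ?C"
    proof (cases "g \<in> support \<gamma>")
      case False
      then have cs: "conj_by x g \<in> support \<gamma>" using ne by (auto simp: support_def)
      then have "conj_by x g \<in> ?C" using finite_conj_conj_by[OF M(1) _ x] g by blast
      then have "conj_by x (conj_by x g) = conj_by x g" by (rule centralises)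
      then have "conj_by x g = g" using gc xc by (metis conj_by_closed conj_by_eq_iff)
      then show ?thesis using cs g by simp
    qed (use g in blast)
    moreover have "g \<noteq> \<one>" using ne xc by (auto simp: mult.assoc)
    ultimately show "g \<in> ?C - {\<one>}" by blast
  qed
  then have "card (support ?c \<inter> finite_conj H) \<le> card (?C - {\<one>})" by (intro card_mono) auto
  also have "\<dots> < card ?C"
    using minimal_derivedD(2)[OF \<gamma>] subgroup.one_closed[OF D']
    by (intro card_Diff1_less) (simp_all add: in_support_iff)
  finally have empty: "support ?c \<inter> finite_conj H = {}" by (rule minimal_derived_smaller[OF \<gamma> der(1)])
  have "?e * t * component \<gamma> c * t' = component \<gamma> c * t * ?e * t'" if c: "c \<in> ?C" for c
  proof -
    have cc: "c \<in> carrier G" using c support_carrier by blast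
    have "component ?c c = 0" using empty c in_support_iff[of c ?c] by blast
    then have "?e * t * component \<gamma> (conj_by x c) * t' - component \<gamma> c * (t * ?e * t') = 0"
      unfolding der(2)[OF cc] .
    then show ?thesis using centralises[OF c] by (simp add: mult.assoc)
  qed
  then have "(\<Sum>c\<in>?C. ?e * t * component \<gamma> c * t') = (\<Sum>c\<in>?C. component \<gamma> c * t * ?e * t')"
    by (rule sum.cong[OF refl])
  then show ?thesis
    unfolding proj_def by (simp add: sum_distrib_left sum_distrib_right)
qed

section \<open>Generic degrees and separating ideals\<close>

text \<open>If \<open>g \<otimes> y \<otimes> k\<close> equals
  \<open>c \<otimes> y \<otimes> b\<close> with \<open>c\<close> and \<open>b\<close> in \<Delta>,
  then the conjugate of \<open>g\<close> by \<open>y\<close> is a conjugate of \<open>c\<close>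
  times \<open>b \<otimes> inv k\<close>, hence in the finite set \<open>F\<close>. For
  \<open>y\<close> avoiding \<open>F\<close> this forces \<open>g\<close>, and then
  \<open>k\<close>, into \<Delta>. So the \<Delta>-parts account for the whole component of the
  vanishing product in that degree.\<close>

lemma generic_vanishing:
  assumes adm: "admissible H I" and \<gamma>: "\<gamma> \<in> A" "\<gamma> \<in> reduced H I" and \<beta>: "\<beta> \<in> B" "\<beta> \<in> reduced H I"
  obtains F where "finite F" "F \<subseteq> carrier G"
    "\<And>y s. y \<in> H \<Longrightarrow> (\<And>g. g \<in> support \<gamma> - finite_conj H \<Longrightarrow> conj_by y g \<notin> F) \<Longrightarrow> s \<in> S y \<Longrightarrow>
      proj (finite_conj H) \<gamma> * s * proj (finite_conj H) \<beta> = 0"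
proof -
  note M = admissibleD[OF adm]
  let ?D = "finite_conj H"
  have D': "subgroup ?D G" using finite_conj_subgroup[OF subgroup.subset[OF M(1)]] .
  have \<gamma>H: "support \<gamma> \<subseteq> H" and \<beta>H: "support \<beta> \<subseteq> H" using \<gamma> \<beta> by (auto simp: reduced_def)
  define E where "E = (\<Union>c\<in>support \<gamma> \<inter> ?D. (\<lambda>h. conj_by h c) ` H)"
  define F where "F = (\<lambda>(u, b, k). u \<otimes> b \<otimes> inv k) ` (E \<times> support \<beta> \<times> support \<beta>)"
  have "finite E" unfolding E_def by (auto simp: finite_conj_def)
  then have finF: "finite F" by (simp add: F_def)
  have "E \<subseteq> carrier G" unfolding E_def using M(6) by (auto dest: finite_conj_carrier)
  then have Fc: "F \<subseteq> carrier G" unfolding F_def using support_carrier[of \<beta>] by auto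
  have "proj ?D \<gamma> * s * proj ?D \<beta> = 0"
    if y: "y \<in> H" and gen: "\<And>g. g \<in> support \<gamma> - ?D \<Longrightarrow> conj_by y g \<notin> F" and s: "s \<in> S y" for y s
  proof (rule ccontr)
    let ?g0 = "proj ?D \<gamma>" and ?g1 = "proj (- ?D) \<gamma>" and ?b0 = "proj ?D \<beta>" and ?b1 = "proj (- ?D) \<beta>"
    assume "?g0 * s * ?b0 \<noteq> 0"
    then obtain z where z: "z \<in> carrier G" "component (?g0 * s * ?b0) z \<noteq> 0" using nonzero_support by blast
    have yc: "y \<in> carrier G" using M(6)[OF y] .
    obtain c b where cb: "c \<in> support ?g0" "b \<in> support ?b0" "z = c \<otimes> y \<otimes> b"
      using support_mult_homogeneous[OF yc s, of z ?g0 ?b0] z by (auto simp: support_def)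
    have c: "c \<in> support \<gamma>" "c \<in> ?D" and b: "b \<in> support \<beta>" "b \<in> ?D" using cb by auto
    have cc: "c \<in> carrier G" "b \<in> carrier G" using c b support_carrier by blast+
    have key: "g \<in> ?D \<and> k \<in> ?D" if g: "g \<in> support \<gamma>" and k: "k \<in> support \<beta>" and eq: "z = g \<otimes> y \<otimes> k" for g k
    proof -
      have car: "g \<in> carrier G" "k \<in> carrier G" using g k support_carrier by blast+
      have eq': "g \<otimes> y \<otimes> k = c \<otimes> y \<otimes> b" using eq cb(3) by simp
      have "conj_by y g = inv y \<otimes> (g \<otimes> y \<otimes> k) \<otimes> inv k"
        using car yc by (simp add: conj_by_def m_assoc)
      also have "\<dots> = conj_by y c \<otimes> b \<otimes> inv k"
        unfolding eq' using car cc yc by (simp add: conj_by_def m_assoc)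
      finally have cy: "conj_by y g = conj_by y c \<otimes> b \<otimes> inv k" .
      have "conj_by y c \<in> E" unfolding E_def using c y by blast
      then have "conj_by y g \<in> F" unfolding F_def cy using b k by (intro image_eqI[of _ _ "(conj_by y c, b, k)"]) auto
      then have gD: "g \<in> ?D" using gen g by blast
      have "k = inv (conj_by y g) \<otimes> conj_by y c \<otimes> b"
        unfolding cy using car cc yc by (simp add: inv_mult_group m_assoc inv_cancel_left)
      moreover have "conj_by y g \<in> ?D" "conj_by y c \<in> ?D"
        using finite_conj_conj_by[OF M(1) _ y] gD c by auto
      ultimately have "k \<in> ?D" using D' b by (simp only: subgroup.m_closed subgroup.m_inv_closed)
      then show ?thesis using gD by blast
    qed
    have split: "\<gamma> = ?g0 + ?g1" "\<beta> = ?b0 + ?b1" by (rule component_ext, simp)+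
    have "\<gamma> * s \<in> A" using ideal_ofD(4)[OF A] \<gamma> by blast
    then have "0 = \<gamma> * s * \<beta>" using AB \<beta> by simp
    also have "\<dots> = ?g0 * s * \<beta> + ?g1 * s * \<beta>" by (subst split(1)) (simp only: distrib_right)
    also have "?g0 * s * \<beta> = ?g0 * s * ?b0 + ?g0 * s * ?b1" by (subst split(2)) (simp only: distrib_left)
    finally have sum: "?g0 * s * ?b0 + ?g0 * s * ?b1 + ?g1 * s * \<beta> = 0" by simp
    have "z \<notin> support (?g0 * s * ?b1)"
    proof
      assume "z \<in> support (?g0 * s * ?b1)"
      then obtain u v where "u \<in> support ?g0" "v \<in> support ?b1" "z = u \<otimes> y \<otimes> v"
        using support_mult_homogeneous[OF yc s] by blast
      then show False using key[of u v] by auto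
    qed
    moreover have "z \<notin> support (?g1 * s * \<beta>)"
    proof
      assume "z \<in> support (?g1 * s * \<beta>)"
      then obtain u v where "u \<in> support ?g1" "v \<in> support \<beta>" "z = u \<otimes> y \<otimes> v"
        using support_mult_homogeneous[OF yc s] by blast
      then show False using key[of u v] by auto
    qed
    ultimately show False
      using arg_cong[OF sum, of "\<lambda>r. component r z"] z(2) by (simp add: not_in_support)
  qed
  then show ?thesis using that[OF finF Fc] by blast
qed

definition conjugate_span :: "'r \<Rightarrow> 'a \<Rightarrow> 'r set" where
  "conjugate_span e u = additive_hull {q * (e * s) | q s. q \<in> S (inv u) \<and> s \<in> S u}"

text \<open>Conjugation restricted to \<open>C\<close> takes finitely many values on
  \<open>H\<close>. \<open>E\<close> is a largest set of elements with distinct values such that a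
  nonzero ideal lies in \<open>S (inv u) e S u\<close> for every \<open>u\<close> in
  \<open>E\<close>. If \<open>h\<close> has a new value and \<open>e S h J \<noteq> 0\<close>, then
  \<open>S (inv h) e S h J\<close> is a nonzero ideal inside \<open>J\<close> and inside
  \<open>S (inv h) e S h\<close>, against maximality.\<close>

lemma separating_ideal:
  assumes adm: "admissible H I" and e: "e \<in> I" "e \<noteq> 0" and C: "finite C" "C \<subseteq> finite_conj H"
  obtains E J where "finite E" "E \<subseteq> H" "ideal_of (S \<one>) J" "J \<subseteq> I" "J \<noteq> {0}"
    "\<And>u. u \<in> E \<Longrightarrow> J \<subseteq> conjugate_span e u"
    "\<And>h s j. h \<in> H \<Longrightarrow> s \<in> S h \<Longrightarrow> j \<in> J \<Longrightarrow>
      (\<exists>u\<in>E. \<forall>c\<in>C. conj_by h c = conj_by u c) \<or> e * s * j = 0"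
proof -
  note M = admissibleD[OF adm]
  have eS: "e \<in> S \<one>" using M(5)[OF e(1)] .
  define \<psi> where "\<psi> h = restrict (conj_by h) C" for h
  have "\<psi> ` H \<subseteq> PiE C (\<lambda>c. (\<lambda>h. conj_by h c) ` H)" by (auto simp: \<psi>_def)
  moreover have "finite (PiE C (\<lambda>c. (\<lambda>h. conj_by h c) ` H))"
    using C by (intro finite_PiE) (auto simp: finite_conj_def)
  ultimately have fin\<psi>: "finite (\<psi> ` H)" by (rule finite_subset)
  define ok where "ok E \<longleftrightarrow> E \<subseteq> H \<and> inj_on \<psi> E \<and> finite E \<and> (\<exists>J. ideal_of (S \<one>) J \<and> J \<subseteq> I \<and> J \<noteq> {0} \<and>
    (\<forall>u\<in>E. J \<subseteq> conjugate_span e u))" for E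
  have "ok {\<one>}"
  proof -
    have idl: "ideal_of (S \<one>) (conjugate_span e \<one>)"
    proof -
      have "{q * (e * s) | q s. q \<in> S (inv \<one>) \<and> s \<in> S \<one>} =
          {p * q | p q. p \<in> S \<one> \<and> q \<in> {e * s | s. s \<in> S \<one>}}" by auto
      then show ?thesis
        unfolding conjugate_span_def
      proof (simp only:, intro product_hull_ideal)
        fix p q assume "p \<in> S \<one>" "q \<in> {e * s | s. s \<in> S \<one>}"
        then show "p * q \<in> S \<one>" using eS S_one_mult(1)[OF one_closed] by blast
      next
        fix q r assume "q \<in> {e * s | s. s \<in> S \<one>}" "r \<in> S \<one>"
        then show "q * r \<in> {e * s | s. s \<in> S \<one>}"
          using S_one_mult(1)[OF one_closed] by (auto simp: mult.assoc)
      qed (use S_one_mult(1)[OF one_closed] S_minus in auto)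
    qed
    have "conjugate_span e \<one> \<subseteq> I"
      unfolding conjugate_span_def
    proof (rule hull_subset)
      show "{q * (e * s) | q s. q \<in> S (inv \<one>) \<and> s \<in> S \<one>} \<subseteq> I"
        using ideal_ofD(3,4)[OF M(2)] e(1) by auto
    qed (use additive_subgroupD[OF ideal_ofD(2)[OF M(2)]] in auto)
    moreover have "conjugate_span e \<one> \<noteq> {0}"
    proof -
      obtain u where u: "u \<in> S \<one>" "u * e = e" using unit_left[OF one_closed eS] by blast
      obtain v where v: "v \<in> S \<one>" "e * v = e" using unit_right[OF one_closed eS] by blast
      have "u * (e * v) \<in> conjugate_span e \<one>"
        unfolding conjugate_span_def using u(1) v(1) by (intro hull_base CollectI exI[of _ u] exI[of _ v]) simp
      then show ?thesis using u v e(2) by auto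
    qed
    ultimately show ?thesis unfolding ok_def using idl subgroup.one_closed[OF M(1)] by auto
  qed
  moreover have "card E < Suc (card (\<psi> ` H))" if "ok E" for E
  proof -
    have "card E = card (\<psi> ` E)" using that by (simp add: ok_def card_image)
    also have "\<dots> \<le> card (\<psi> ` H)" using that fin\<psi> by (intro card_mono) (auto simp: ok_def)
    finally show ?thesis by simp
  qed
  ultimately obtain E where E: "ok E" and max: "\<And>E'. ok E' \<Longrightarrow> card E' \<le> card E"
    using ex_has_greatest_nat[of ok "{\<one>}" card "Suc (card (\<psi> ` H))"] by blast
  then obtain J where J: "ideal_of (S \<one>) J" "J \<subseteq> I" "J \<noteq> {0}" "\<And>u. u \<in> E \<Longrightarrow> J \<subseteq> conjugate_span e u"
    unfolding ok_def by blast
  have EH: "E \<subseteq> H" "finite E" "inj_on \<psi> E" using E by (simp_all add: ok_def)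
  have "(\<exists>u\<in>E. \<forall>c\<in>C. conj_by h c = conj_by u c) \<or> e * s * j = 0"
    if h: "h \<in> H" and s: "s \<in> S h" and j: "j \<in> J" for h s j
  proof (rule ccontr)
    assume neg: "\<not> ?thesis"
    have hc: "h \<in> carrier G" "inv h \<in> carrier G" using M(6)[OF h] by auto
    have new: "\<psi> h \<notin> \<psi> ` E"
    proof
      assume "\<psi> h \<in> \<psi> ` E"
      then obtain u where "u \<in> E" "\<psi> h = \<psi> u" by blast
      then have "\<forall>c\<in>C. conj_by h c = conj_by u c" unfolding \<psi>_def by (metis restrict_apply')
      then show False using neg \<open>u \<in> E\<close> by blast
    qed
    define Q where "Q = {e * (s * j) | s j. s \<in> S h \<and> j \<in> J}"
    define J' where "J' = additive_hull {p * q | p q. p \<in> S (inv h) \<and> q \<in> Q}"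
    have jS: "j \<in> S \<one>" if "j \<in> J" for j using that J(2) M(5) by blast
    have sj: "s * j \<in> S h" if "s \<in> S h" "j \<in> J" for s j using S_one_mult(2)[OF hc(1) that(1) jS[OF that(2)]] .
    have es: "e * s \<in> S h" if "s \<in> S h" for s using S_one_mult(1)[OF hc(1) that eS] .
    have QP: "p * q \<in> S \<one>" if "p \<in> S (inv h)" "q \<in> Q" for p q
      using that es sj S_inv_mult_S(2)[OF hc(1)] unfolding Q_def by blast
    have "ideal_of (S \<one>) J'"
      unfolding J'_def
    proof (rule product_hull_ideal[OF _ _ _ QP])
      fix q r assume q: "q \<in> Q" and r: "r \<in> S \<one>"
      then obtain s j where sj: "q = e * (s * j)" "s \<in> S h" "j \<in> J" unfolding Q_def by blast
      then have "q * r = e * (s * (j * r))" "j * r \<in> J"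
        using ideal_ofD(4)[OF J(1) r] by (auto simp: mult.assoc)
      then show "q * r \<in> Q" unfolding Q_def using sj by blast
    qed (use S_one_mult(1)[OF hc(2)] S_minus[OF hc(2)] in auto)
    moreover have J'J: "J' \<subseteq> J"
      unfolding J'_def
    proof (rule hull_subset)
      show "{p * q | p q. p \<in> S (inv h) \<and> q \<in> Q} \<subseteq> J"
      proof
        fix x assume "x \<in> {p * q | p q. p \<in> S (inv h) \<and> q \<in> Q}"
        then obtain p s j where x: "x = p * (e * (s * j))" "p \<in> S (inv h)" "s \<in> S h" "j \<in> J"
          unfolding Q_def by blast
        have "p * (e * s) \<in> S \<one>" using S_inv_mult_S(2)[OF hc(1) es[OF x(3)] x(2)] .
        then have "p * (e * s) * j \<in> J" using ideal_ofD(3)[OF J(1)] x(4) by blast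
        then show "x \<in> J" by (simp add: x(1) mult.assoc)
      qed
    qed (use additive_subgroupD[OF ideal_ofD(2)[OF J(1)]] in auto)
    moreover have "J' \<noteq> {0}"
    proof -
      have "e * s * j \<noteq> 0" using neg by blast
      then obtain q where q: "q \<in> S (inv h)" "q * (e * s * j) \<noteq> 0"
        using left_cancel[OF hc(1) es[OF s], of j] by blast
      have "q * (e * (s * j)) \<in> J'" unfolding J'_def Q_def using q(1) s j by (intro hull_base) blast
      then show ?thesis using q(2) by (auto simp: mult.assoc)
    qed
    moreover have "J' \<subseteq> conjugate_span e h"
      unfolding J'_def conjugate_span_def
    proof (rule hull_mono)
      show "{p * q | p q. p \<in> S (inv h) \<and> q \<in> Q} \<subseteq> {q * (e * s) | q s. q \<in> S (inv h) \<and> s \<in> S h}"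
        unfolding Q_def using sj by blast
    qed
    moreover have "\<And>u. u \<in> E \<Longrightarrow> J' \<subseteq> conjugate_span e u" using J'J J(4) by blast
    moreover have "J' \<subseteq> I" using J'J J(2) by blast
    ultimately have "\<exists>J. ideal_of (S \<one>) J \<and> J \<subseteq> I \<and> J \<noteq> {0} \<and> (\<forall>u\<in>insert h E. J \<subseteq> conjugate_span e u)"
      by (intro exI[of _ J'] conjI ballI) (assumption | elim insertE | simp)+
    then have "ok (insert h E)" unfolding ok_def using EH h new by auto
    then have "card (insert h E) \<le> card E" by (rule max)
    moreover have "h \<notin> E" using new by blast
    ultimately show False using EH(2) by simp
  qed
  then show ?thesis using that[OF EH(2,1) J(1-3) J(4)] by blast
qed

text \<open>Insert an element of \<open>S (inv x) \<star> S x\<close> to the right of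
  \<open>t e\<close>, where \<open>e\<close> is the coefficient of \<gamma> at
  \<open>\<one>\<close>. The commutator identity then exchanges \<open>e\<close> with the
  \<Delta>-part of \<gamma>, after which that part meets a factor \<open>q * r * s\<close> of degree
  \<open>y\<close>, to which \<open>zero\<close> applies.\<close>

lemma linking_vanishing:
  assumes adm: "admissible H I" and \<gamma>: "minimal_derived H I \<alpha> \<gamma>" and x: "x \<in> H"
    and centralises: "\<And>c. c \<in> support \<gamma> \<inter> finite_conj H \<Longrightarrow> conj_by x c = c"
    and t: "t \<in> S x" and y: "y \<in> carrier G" and s: "s \<in> S y"
    and zero: "\<And>s. s \<in> S y \<Longrightarrow> proj (finite_conj H) \<gamma> * s * b = 0"
  shows "proj (finite_conj H) \<gamma> * t * component \<gamma> \<one> * s * b = 0"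
proof -
  let ?p = "proj (finite_conj H) \<gamma>" and ?e = "component \<gamma> \<one>"
  have xc: "x \<in> carrier G" using admissibleD(6)[OF adm x] .
  have te: "t * ?e \<in> S x" using S_one_mult(2)[OF xc t] by simp
  obtain \<epsilon> where \<epsilon>: "\<epsilon> \<in> S (inv x) \<star> S x" "t * ?e * \<epsilon> = t * ?e" using epsilon_right[OF xc te] .
  have "S (inv x) \<star> S x \<subseteq> {\<epsilon>. ?p * (t * ?e) * \<epsilon> * (s * b) = 0}"
  proof (rule sum_mult_subset)
    fix q r assume q: "q \<in> S (inv x)" and r: "r \<in> S x"
    have "q * r * s \<in> S y" using S_one_mult(1)[OF y s S_inv_mult_S(2)[OF xc r q]] .
    then have z: "?p * (q * r * s) * b = 0" by (rule zero)
    have "?p * (t * ?e) * (q * r) * (s * b) = (?p * t * ?e * q) * (r * s * b)" by (simp add: mult.assoc)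
    also have "?p * t * ?e * q = ?e * t * ?p * q"
      using minimal_derived_linking[OF adm \<gamma> x centralises t q] by simp
    also have "(?e * t * ?p * q) * (r * s * b) = ?e * t * (?p * (q * r * s) * b)" by (simp add: mult.assoc)
    finally show "q * r \<in> {\<epsilon>. ?p * (t * ?e) * \<epsilon> * (s * b) = 0}" using z by simp
  qed (auto simp: distrib_left distrib_right)
  then have "?p * (t * ?e) * \<epsilon> * (s * b) = 0" using \<epsilon>(1) by blast
  then have "?p * (t * ?e * \<epsilon>) * (s * b) = 0" by (simp add: mult.assoc)
  then show ?thesis unfolding \<epsilon>(2) by (simp add: mult.assoc)
qed

lemma shifted_nonzero:
  assumes adm: "admissible H I" and C: "ideal_of UNIV C" and b: "b \<in> C" "b \<in> reduced H I" "b \<noteq> 0"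
  obtains b' where "b' \<in> C" "b' \<in> reduced H I" "component b' \<one> \<noteq> 0"
proof -
  note M = admissibleD[OF adm]
  obtain x where x: "x \<in> carrier G" "component b x \<noteq> 0" using nonzero_support[OF b(3)] by blast
  then have xH: "x \<in> H" using b(2) by (auto simp: reduced_def support_def)
  obtain t where t: "t \<in> S (inv x)" "component b x * t \<noteq> 0"
    using nondegD(1)[OF x(1) component_in[OF x(1)] x(2)] by blast
  have "component (b * t) \<one> \<noteq> 0"
    using component_mult_homogeneous[OF _ t(1), of \<one> b] t x by simp
  moreover have "b * t \<in> C" using ideal_ofD(4)[OF C] b by blast
  moreover have "b * t \<in> reduced H I" using reduced_mult_right1[OF adm M(7)[OF xH] t(1) b(2)] .
  ultimately show ?thesis using that by blast
qed

text \<open>If the product were nonzero, \<open>j s\<close> times the \<Delta>-part of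
  \<open>b\<close>, translated by a degree \<open>inv y\<close>, would be a nonzero element
  supported in \<Delta>, annihilated by the \<Delta>-part of \<gamma> through every degree
  \<open>h\<close> of \<open>H\<close>; this contradicts the failure of (e). The annihilation has
  two causes. Either the coefficient of \<gamma> at \<open>\<one>\<close> kills
  \<open>r * j\<close>, and then so does the whole \<Delta>-part; or \<open>h\<close> acts on the
  \<Delta>-support like some \<open>u\<close> in \<open>E\<close>, so
  \<open>h \<otimes> inv u\<close> centralises it, and \<open>j\<close> comes from the conjugate
  span at \<open>u\<close>.\<close>

lemma localised_annihilation:
  assumes adm: "admissible H I" and \<gamma>: "minimal_derived H I \<alpha> \<gamma>" and b: "b \<in> B" "b \<in> reduced H I"
    and F: "\<And>y s. y \<in> H \<Longrightarrow> (\<And>g. g \<in> support \<gamma> - finite_conj H \<Longrightarrow> conj_by y g \<notin> F) \<Longrightarrow> s \<in> S y \<Longrightarrow>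
      proj (finite_conj H) \<gamma> * s * proj (finite_conj H) b = 0"
    and E: "E \<subseteq> H" and J: "J \<subseteq> I" "\<And>u. u \<in> E \<Longrightarrow> J \<subseteq> conjugate_span (component \<gamma> \<one>) u"
      "\<And>h s j. h \<in> H \<Longrightarrow> s \<in> S h \<Longrightarrow> j \<in> J \<Longrightarrow>
        (\<exists>u\<in>E. \<forall>c\<in>support \<gamma> \<inter> finite_conj H. conj_by h c = conj_by u c) \<or> component \<gamma> \<one> * s * j = 0"
    and y: "y \<in> H" and generic: "\<And>u g. u \<in> E \<Longrightarrow> g \<in> support \<gamma> - finite_conj H \<Longrightarrow> conj_by (u \<otimes> y) g \<notin> F"
    and j: "j \<in> J" and s: "s \<in> S y"
  shows "j * s * component b \<one> = 0"
proof (rule ccontr)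
  assume ne: "j * s * component b \<one> \<noteq> 0"
  note M = admissibleD[OF adm]
  let ?p = "proj (finite_conj H) \<gamma>" and ?e = "component \<gamma> \<one>" and ?b = "proj (finite_conj H) b"
  have D': "subgroup (finite_conj H) G" using finite_conj_subgroup[OF subgroup.subset[OF M(1)]] .
  have D: "subgroup (finite_conj H \<inter> H) G" using M(1) by (rule finite_conj_Int_subgroup)
  have one: "\<one> \<in> finite_conj H" using D' by (rule subgroup.one_closed)
  have yc: "y \<in> carrier G" using M(6)[OF y] .
  have jI: "j \<in> I" and jS: "j \<in> S \<one>" using j J(1) M(5) by blast+
  have van: "?p * r * (j * s * ?b) = 0" if h: "h \<in> H" and r: "r \<in> S h" for h r
  proof -
    have hc: "h \<in> carrier G" using M(6)[OF h] .
    have rj: "r * j \<in> S h" using S_one_mult(2)[OF hc r jS] .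
    show ?thesis
    proof (cases "?e * r * j = 0")
      case True
      then have "?p * (r * j) = 0"
        using minimal_derived_annihilator[OF adm \<gamma> h rj] by (simp add: mult.assoc)
      then have "?p * (r * j) * (s * ?b) = 0" by simp
      then show ?thesis by (simp add: mult.assoc)
    next
      case False
      then obtain u where u: "u \<in> E" and eq: "\<forall>c\<in>support \<gamma> \<inter> finite_conj H. conj_by h c = conj_by u c"
        using J(3)[OF h r j] by blast
      have uH: "u \<in> H" using u E by blast
      have uc: "u \<in> carrier G" using M(6)[OF uH] .
      define x where "x = h \<otimes> inv u"
      have xH: "x \<in> H" unfolding x_def using M(1,7) h uH by (auto intro: subgroup.m_closed)
      have cen: "conj_by x c = c" if c: "c \<in> support \<gamma> \<inter> finite_conj H" for c
      proof -
        have cc: "c \<in> carrier G" using c support_carrier by blast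
        have "conj_by x c = conj_by (inv u) (conj_by h c)"
          unfolding x_def using cc hc uc by (simp add: conj_by_conj_by)
        also have "\<dots> = c" using eq c cc uc by (simp add: conj_by_conj_by)
        finally show ?thesis .
      qed
      have uy: "u \<otimes> y \<in> H" using M(1) uH y by (rule subgroup.m_closed)
      have zero: "?p * s' * ?b = 0" if "s' \<in> S (u \<otimes> y)" for s'
        using F[OF uy _ that] generic[OF u] by blast
      have "conjugate_span ?e u \<subseteq> {k. ?p * r * (k * s * ?b) = 0}"
        unfolding conjugate_span_def
      proof (rule hull_subset)
        show "{q * (?e * p) | q p. q \<in> S (inv u) \<and> p \<in> S u} \<subseteq> {k. ?p * r * (k * s * ?b) = 0}"
        proof
          fix k assume "k \<in> {q * (?e * p) | q p. q \<in> S (inv u) \<and> p \<in> S u}"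
          then obtain q p where k: "k = q * (?e * p)" "q \<in> S (inv u)" "p \<in> S u" by blast
          have rq: "r * q \<in> S x" unfolding x_def using S_mult[OF hc _ r k(2)] uc by simp
          have ps: "p * s \<in> S (u \<otimes> y)" using S_mult[OF uc yc k(3) s] .
          have "?p * (r * q) * ?e * (p * s) * ?b = 0"
            using linking_vanishing[OF adm \<gamma> xH cen rq _ ps zero] uc yc by simp
          then show "k \<in> {k. ?p * r * (k * s * ?b) = 0}" by (simp add: k(1) mult.assoc)
        qed
      qed (auto simp: distrib_left distrib_right)
      then show ?thesis using J(2)[OF u] j by blast
    qed
  qed
  have jsb: "j * s \<in> S y" using S_one_mult(1)[OF yc s jS] .
  have "j * s * component b \<one> \<in> S y" using S_one_mult(2)[OF yc jsb] by simp
  then obtain t where t: "t \<in> S (inv y)" "j * s * component b \<one> * t \<noteq> 0"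
    using nondegD(1)[OF yc _ ne] by blast
  let ?c = "j * s * ?b * t"
  have c1: "component ?c \<one> = j * s * component b \<one> * t"
    using component_mult_homogeneous[OF _ t(1), of \<one> "j * s * ?b"]
      component_homogeneous_mult[OF yc jsb yc, of ?b] yc one by simp
  have cR: "?c \<in> reduced H I"
    using reduced_mult_right1[OF adm M(7)[OF y] t(1) reduced_mult_left1[OF adm y jsb reduced_proj[OF b(2)]]] .
  have cD: "support ?c \<subseteq> finite_conj H"
  proof
    fix z assume z: "z \<in> support ?c"
    then obtain w where w: "w \<in> support (j * s * ?b)" "z = w \<otimes> inv y"
      using support_mult[OF subset_refl homogeneous_support[OF _ t(1)]] yc by blast
    then obtain d where d: "d \<in> support ?b" "w = y \<otimes> d"
      using support_mult[OF homogeneous_support[OF yc jsb] subset_refl] by blast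
    have dD: "d \<in> finite_conj H" using d by simp
    have "z = conj_by (inv y) d" unfolding w d using yc finite_conj_carrier[OF dD] by (simp add: conj_by_def)
    then show "z \<in> finite_conj H" using finite_conj_conj_by[OF M(1) dD M(7)[OF y]] by simp
  qed
  have p1: "component ?p \<one> \<noteq> 0" using minimal_derivedD(2)[OF \<gamma>] one by simp
  have p0: "?p \<noteq> 0"
  proof
    assume "?p = 0" then show False using p1 by simp
  qed
  have c0: "?c \<noteq> 0"
  proof
    assume "?c = 0" then show False using c1 t(2) by simp
  qed
  obtain h r where hr: "h \<in> H" "r \<in> S h" "?p * r * ?c \<noteq> 0"
    by (rule no_annihilating_pair[OF adm reduced_proj[OF minimal_derivedD(4)[OF \<gamma>]] _ p0 cR cD c0]) auto
  have "?p * r * (j * s * ?b) * t = 0" using van[OF hr(1,2)] by simp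
  then show False using hr(3) by (simp add: mult.assoc)
qed

section \<open>Descent on the support outside the finite-conjugacy part\<close>

text \<open>The ideal \<open>J0\<close> has generators that contain both elements of
  \<open>J1\<close>, which come from coefficients of \<alpha>, and the coefficient of
  \<open>b\<close> at \<open>\<one>\<close>. An element of a smaller ideal can therefore transfer
  \<alpha> and \<open>b\<close> alike to the new pair. Localisation gives some element of
  \<open>X\<close> finitely many \<open>L\<close>-conjugates; traced back to \<alpha>, it removes
  one support element from the count.\<close>

lemma descent_step:
  assumes adm: "admissible H I" and \<alpha>: "\<alpha> \<in> A" "\<alpha> \<in> reduced H I" "support \<alpha> \<inter> finite_conj H \<noteq> {}"
    and b0: "b\<^sub>0 \<in> B" "b\<^sub>0 \<in> reduced H I" "b\<^sub>0 \<noteq> 0"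
  obtains L K \<alpha>' b' where "admissible L K" "\<alpha>' \<in> A" "\<alpha>' \<in> reduced L K" "support \<alpha>' \<inter> finite_conj L \<noteq> {}"
    "b' \<in> B" "b' \<in> reduced L K" "b' \<noteq> 0"
    "card (support \<alpha>' - finite_conj L) < card (support \<alpha> - finite_conj H)"
proof -
  note M = admissibleD[OF adm]
  let ?D = "finite_conj H \<inter> H"
  have D': "subgroup (finite_conj H) G" using finite_conj_subgroup[OF subgroup.subset[OF M(1)]] .
  have D: "subgroup ?D G" using M(1) by (rule finite_conj_Int_subgroup)
  have Dc: "?D \<subseteq> carrier G" using D by (rule subgroup.subset)
  have oneH: "\<one> \<in> H" using M(1) by (rule subgroup.one_closed)
  obtain \<gamma> where \<gamma>: "minimal_derived H I \<alpha> \<gamma>" using minimal_derived_exists[OF adm \<alpha>] .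
  note G = minimal_derivedD[OF \<gamma>]
  obtain b where b: "b \<in> B" "b \<in> reduced H I" "component b \<one> \<noteq> 0"
    using shifted_nonzero[OF adm B b0] .
  obtain F where F: "finite F" "F \<subseteq> carrier G"
    "\<And>y s. y \<in> H \<Longrightarrow> (\<And>g. g \<in> support \<gamma> - finite_conj H \<Longrightarrow> conj_by y g \<notin> F) \<Longrightarrow> s \<in> S y \<Longrightarrow>
      proj (finite_conj H) \<gamma> * s * proj (finite_conj H) b = 0"
    using generic_vanishing[OF adm G(3,4) b(1,2)] by blast
  let ?e = "component \<gamma> \<one>" and ?b1 = "component b \<one>"
  have IS: "I \<star> S \<one> \<subseteq> I"
    using ideal_ofD(4)[OF M(2)] additive_subgroupD[OF ideal_ofD(2)[OF M(2)]] by (intro sum_mult_subset) auto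
  have eI: "?e \<in> I" and bI: "?b1 \<in> I"
    using G(4) b(2) oneH IS by (auto simp: reduced_def)
  obtain E J1 where E: "finite E" "E \<subseteq> H" and J1: "ideal_of (S \<one>) J1" "J1 \<subseteq> I" "J1 \<noteq> {0}"
    "\<And>u. u \<in> E \<Longrightarrow> J1 \<subseteq> conjugate_span ?e u"
    "\<And>h s j. h \<in> H \<Longrightarrow> s \<in> S h \<Longrightarrow> j \<in> J1 \<Longrightarrow>
      (\<exists>u\<in>E. \<forall>c\<in>support \<gamma> \<inter> finite_conj H. conj_by h c = conj_by u c) \<or> ?e * s * j = 0"
    by (rule separating_ideal[OF adm eI G(2), of "support \<gamma> \<inter> finite_conj H"]) auto
  have "0 \<in> J1" using additive_subgroupD(1)[OF ideal_ofD(2)[OF J1(1)]] .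
  then obtain j1 where j1: "j1 \<in> J1" "j1 \<noteq> 0" using J1(3) by blast
  have j1I: "j1 \<in> I" using j1 J1(2) by blast
  obtain h s where hs: "h \<in> H" "s \<in> S h" "j1 * s * ?b1 \<noteq> 0"
    using no_annihilating_pair[OF adm ideal_reduced[OF adm j1I] j1(2) ideal_reduced[OF adm bI] b(3)] .
  have hc: "h \<in> carrier G" "inv h \<in> carrier G" using M(6)[OF hs(1)] by auto
  have J1S: "j \<in> S \<one>" if "j \<in> J1" for j using that J1(2) M(5) by blast
  define P where "P = {j * s * ?b1 | j s. j \<in> J1 \<and> s \<in> S h}"
  define J0 where "J0 = additive_hull {p * q | p q. p \<in> P \<and> q \<in> S (inv h)}"
  have PS: "p \<in> S h" if "p \<in> P" for p
    using that S_one_mult(2)[OF hc(1) S_one_mult(1)[OF hc(1) _ J1S] component_in[OF one_closed]]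
    unfolding P_def by blast
  have J0: "ideal_of (S \<one>) J0"
    unfolding J0_def
  proof (rule product_hull_ideal)
    fix p r assume p: "p \<in> P" and r: "r \<in> S \<one>"
    then obtain j s where js: "p = j * s * ?b1" "j \<in> J1" "s \<in> S h" unfolding P_def by blast
    have "r * p = (r * j) * s * ?b1" "r * j \<in> J1"
      using ideal_ofD(3)[OF J1(1) r js(2)] by (auto simp: js(1) mult.assoc)
    then show "r * p \<in> P" unfolding P_def using js by blast
  next
    fix p assume p: "p \<in> P"
    then obtain j s where js: "p = j * s * ?b1" "j \<in> J1" "s \<in> S h" unfolding P_def by blast
    have "- p = j * (- s) * ?b1" "- s \<in> S h" using S_minus[OF hc(1) js(3)] by (auto simp: js(1))
    then show "- p \<in> P" unfolding P_def using js by blast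
  next
    fix p q assume "p \<in> P" "q \<in> S (inv h)"
    then show "p * q \<in> S \<one>" using S_inv_mult_S(1)[OF hc(1)] PS by blast
  next
    fix q r assume "q \<in> S (inv h)" "r \<in> S \<one>"
    then show "q * r \<in> S (inv h)" using S_one_mult(2)[OF hc(2)] by blast
  qed
  have J0J1: "J0 \<subseteq> J1"
    unfolding J0_def
  proof (rule hull_subset)
    show "{p * q | p q. p \<in> P \<and> q \<in> S (inv h)} \<subseteq> J1"
    proof
      fix x assume "x \<in> {p * q | p q. p \<in> P \<and> q \<in> S (inv h)}"
      then obtain j s q where x: "x = j * s * ?b1 * q" "j \<in> J1" "s \<in> S h" "q \<in> S (inv h)"
        unfolding P_def by blast
      have "s * ?b1 \<in> S h" using S_one_mult(2)[OF hc(1) x(3)] by simp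
      then have "s * ?b1 * q \<in> S \<one>" using S_inv_mult_S(1)[OF hc(1) _ x(4)] by blast
      then have "j * (s * ?b1 * q) \<in> J1" using ideal_ofD(4)[OF J1(1)] x(2) by blast
      then show "x \<in> J1" by (simp add: x(1) mult.assoc)
    qed
  qed (use additive_subgroupD[OF ideal_ofD(2)[OF J1(1)]] in auto)
  have J0ne: "J0 \<noteq> {0}"
  proof -
    have sb: "s * ?b1 \<in> S h" using S_one_mult(2)[OF hc(1) hs(2)] by simp
    have "j1 * (s * ?b1) \<noteq> 0" using hs(3) by (simp add: mult.assoc)
    then obtain q where q: "q \<in> S (inv h)" "j1 * (s * ?b1) * q \<noteq> 0"
      using right_cancel[OF hc(1) sb, of j1] by blast
    have "(j1 * s * ?b1) * q \<in> J0"
      unfolding J0_def P_def using j1 hs(2) q(1) by (intro hull_base) blast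
    then show ?thesis using q(2) by (auto simp: mult.assoc)
  qed
  \<comment> \<open>\<open>X\<close> contains everything that can spoil genericity for some
    \<open>u\<close> in \<open>E\<close>. In a product over \<open>J0\<close>, the factor of degree
    \<open>h\<close> before the coefficient of \<open>b\<close> shifts the relevant degree from
    \<open>y\<close> to \<open>y \<otimes> h\<close>; conjugating \<open>F\<close> by
    \<open>inv h\<close> undoes this.\<close>
  define X where "X = (\<Union>u\<in>E. conj_by u ` (support \<gamma> - finite_conj H))"
  define F' where "F' = conj_by (inv h) ` F"
  have finX: "finite X" and finF': "finite F'" using E(1) F(1) by (auto simp: X_def F'_def)
  have Xc: "X \<subseteq> carrier G" unfolding X_def using E(2) M(6) support_carrier[of \<gamma>] by auto
  have cover: "\<exists>g\<in>X. conj_by y g \<in> F'" if y: "y \<in> H" and lk: "linked J0 y" for y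
  proof (rule ccontr)
    assume no: "\<not> ?thesis"
    have yc: "y \<in> carrier G" using M(6)[OF y] .
    have yh: "y \<otimes> h \<in> H" using M(1) y hs(1) by (rule subgroup.m_closed)
    have generic: "conj_by (u \<otimes> (y \<otimes> h)) g \<notin> F" if u: "u \<in> E" and g: "g \<in> support \<gamma> - finite_conj H" for u g
    proof
      assume gF: "conj_by (u \<otimes> (y \<otimes> h)) g \<in> F"
      have c: "u \<in> carrier G" "g \<in> carrier G" using u E(2) M(6) g support_carrier by blast+
      have "conj_by (inv h) (conj_by (u \<otimes> (y \<otimes> h)) g) = conj_by y (conj_by u g)"
        using c yc hc by (simp add: conj_by_conj_by m_assoc)
      then have "conj_by y (conj_by u g) \<in> F'" unfolding F'_def using gF by (metis imageI)
      moreover have "conj_by u g \<in> X" unfolding X_def using u g by blast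
      ultimately show False using no by blast
    qed
    obtain a r k where ark: "a \<in> J0" "r \<in> S y" "k \<in> J0" "a * r * k \<noteq> 0" using lk unfolding linked_def by blast
    have "a * r * k = 0"
    proof (rule hull_vanish[of "\<lambda>k. a * r * k", OF _ _ _ ark(3)[unfolded J0_def]])
      fix x assume "x \<in> {p * q | p q. p \<in> P \<and> q \<in> S (inv h)}"
      then obtain j s q where x: "x = j * s * ?b1 * q" "j \<in> J1" "s \<in> S h" "q \<in> S (inv h)"
        unfolding P_def by blast
      have js: "j * s \<in> S h" using S_one_mult(1)[OF hc(1) x(3) J1S[OF x(2)]] .
      have "r * (j * s) \<in> S (y \<otimes> h)" using S_mult[OF yc hc(1) ark(2) js] .
      then have "a * (r * (j * s)) * ?b1 = 0"
        using J0J1 ark(1)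
        by (intro localised_annihilation[OF adm \<gamma> b(1,2) F(3) E(2) J1(2,4,5) yh generic]) auto
      then have "a * (r * (j * s)) * ?b1 * q = 0" by simp
      then show "a * r * x = 0" by (simp add: x(1) mult.assoc)
    qed (auto simp: distrib_left)
    then show False using ark(4) by simp
  qed
  have J0I: "J0 \<subseteq> I" using J0J1 J1(2) by blast
  obtain J L g where J: "ideal_of (S \<one>) J" "J \<subseteq> J0" "J \<noteq> {0}" and L: "subgroup L G" "L \<subseteq> H"
    and g: "g \<in> X" "g \<in> finite_conj L" and link: "\<And>y. y \<in> H \<Longrightarrow> linked J y \<Longrightarrow> y \<in> L"
    using localising_subgroup[OF adm J0 J0I J0ne finX Xc finF' cover] by blast
  have JI: "J \<subseteq> I" using J(2) J0I by blast
  obtain K where K: "admissible L K" "J \<subseteq> K" using admissible_hull[OF adm J(1) JI L link] .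
  have "0 \<in> J" using additive_subgroupD(1)[OF ideal_ofD(2)[OF J(1)]] .
  then obtain j where j: "j \<in> J" "j \<noteq> 0" using J(3) by blast
  have jK: "j \<in> K" using j K by blast
  have D'L: "finite_conj H \<subseteq> finite_conj L" using L(2) by (rule finite_conj_antimono)
  have DL: "subgroup (finite_conj L) G" using finite_conj_subgroup[OF subgroup.subset[OF L(1)]] .
  obtain u g1 where u: "u \<in> E" "g1 \<in> support \<gamma> - finite_conj H" "g = conj_by u g1" using g(1) by (auto simp: X_def)
  obtain w g\<^sub>0 \<delta> where w: "w \<in> H" "g\<^sub>0 \<in> support \<alpha> - finite_conj H" "\<delta> \<in> ?D" "g1 = w \<otimes> g\<^sub>0 \<otimes> inv w \<otimes> \<delta>"
    "\<And>d. d \<in> ?D \<Longrightarrow> component \<gamma> d \<in> orbit_span ?D \<alpha> w" using G(1) u(2) unfolding derived_def by blast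
  have uH: "u \<in> H" using u E by blast
  have uc: "u \<in> carrier G" "inv u \<in> carrier G" and wc: "w \<in> carrier G" using M(6) uH w(1) by auto
  have g0c: "g\<^sub>0 \<in> carrier G" using w(2) support_carrier by blast
  have \<delta>c: "\<delta> \<in> carrier G" using w(3) Dc by blast
  \<comment> \<open>Up to a factor in \<Delta>, \<open>g\<close> is the conjugate
    \<open>v \<otimes> g\<^sub>0 \<otimes> inv v\<close> of a support element of \<alpha>, so that
    this conjugate has finitely many \<open>L\<close>-conjugates too.\<close>
  define v where "v = inv u \<otimes> w"
  have vH: "v \<in> H" unfolding v_def using M(1) M(7)[OF uH] w(1) by (rule subgroup.m_closed)
  have vc: "v \<in> carrier G" using M(6)[OF vH] .
  have geq: "g = (v \<otimes> g\<^sub>0 \<otimes> inv v) \<otimes> conj_by u \<delta>"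
    unfolding u(3) w(4) v_def using uc wc g0c \<delta>c
    by (simp add: conj_by_def m_assoc inv_mult_group inv_cancel_left)
  have oneD: "\<one> \<in> ?D" using D by (rule subgroup.one_closed)
  have "conjugate_span ?e u \<subseteq> orbit_span ?D \<alpha> v"
    unfolding conjugate_span_def
  proof (rule hull_subset[OF orbit_span_zero])
    show "a + c \<in> orbit_span ?D \<alpha> v" if "a \<in> orbit_span ?D \<alpha> v" "c \<in> orbit_span ?D \<alpha> v" for a c
      using that unfolding orbit_span_def by (rule hull_add)
    show "{q * (?e * s) | q s. q \<in> S (inv u) \<and> s \<in> S u} \<subseteq> orbit_span ?D \<alpha> v"
    proof
      fix x assume "x \<in> {q * (?e * s) | q s. q \<in> S (inv u) \<and> s \<in> S u}"
      then obtain q s where x: "x = q * (?e * s)" "q \<in> S (inv u)" by blast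
      have "q * ?e \<in> orbit_span ?D \<alpha> v"
      proof (rule orbit_span_mult_left[OF w(5)[OF oneD] x(2) uc(2) wc Dc])
        fix \<delta> assume \<delta>: "\<delta> \<in> ?D"
        show "\<exists>\<delta>'\<in>?D. inv u \<otimes> (\<delta> \<otimes> w) = \<delta>' \<otimes> v"
        proof (rule bexI)
          show "conj_by u \<delta> \<in> ?D" by (rule conj_by_finite_conj_Int[OF M(1) \<delta> uH])
          show "inv u \<otimes> (\<delta> \<otimes> w) = conj_by u \<delta> \<otimes> v"
            unfolding v_def using Dc \<delta> uc wc by (auto simp: conj_by_def m_assoc inv_cancel_left)
        qed
      qed
      then have "q * ?e * s \<in> orbit_span ?D \<alpha> v" by (rule orbit_span_mult_right)
      then show "x \<in> orbit_span ?D \<alpha> v" by (simp add: x(1) mult.assoc)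
    qed
  qed
  \<comment> \<open>The purpose of the bookkeeping in \<open>derived\<close>: the coefficients of
    \<alpha> that make up \<open>j\<close> were moved by degrees in \<Delta> \<open>v\<close>, with
    the same \<open>v\<close> that conjugates \<open>g\<^sub>0\<close> into
    \<open>finite_conj L\<close>. Hence the surviving component and the lost support element belong
    to one sandwich.\<close>
  then have jspan: "j \<in> orbit_span ?D \<alpha> v" using j J(2) J0J1 J1(4)[OF u(1)] by blast
  let ?Y = "(\<lambda>\<delta>. \<delta> \<otimes> v) ` ?D"
  have Yc: "?Y \<subseteq> carrier G" using Dc vc by auto
  have "{s * component \<alpha> d * z | \<delta> s d z. \<delta> \<in> ?D \<and> s \<in> S (\<delta> \<otimes> v) \<and> d \<in> ?D} \<subseteq>
      {s * component \<alpha> d * z | y s d z. y \<in> ?Y \<and> s \<in> S y \<and> d \<in> ?D}" by blast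
  then have "j \<in> additive_hull {s * component \<alpha> d * z | y s d z. y \<in> ?Y \<and> s \<in> S y \<and> d \<in> ?D}"
    using jspan hull_mono unfolding orbit_span_def by blast
  then obtain y d \<alpha>' where \<alpha>': "y \<in> ?Y" "d \<in> ?D" "\<alpha>' \<in> A" "\<alpha>' \<in> reduced L K" "component \<alpha>' \<one> \<noteq> 0"
    "support \<alpha>' \<subseteq> (\<lambda>g. y \<otimes> g \<otimes> inv (y \<otimes> d)) ` support \<alpha>"
    using transfer_element[OF K(1) A \<alpha>(1) Yc Dc jK j(2)] by blast
  \<comment> \<open>The same \<open>j\<close> is a sum of multiples of the coefficient of
    \<open>b\<close> at \<open>\<one>\<close>, since each generator of \<open>J0\<close> contains
    it.\<close>
  have "j \<in> additive_hull {s * component b d * z | y s d z. y \<in> {h} \<and> s \<in> S y \<and> d \<in> {\<one>}}"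
  proof -
    have "{p * q | p q. p \<in> P \<and> q \<in> S (inv h)} \<subseteq>
        {s * component b d * z | y s d z. y \<in> {h} \<and> s \<in> S y \<and> d \<in> {\<one>}}"
    proof
      fix x assume "x \<in> {p * q | p q. p \<in> P \<and> q \<in> S (inv h)}"
      then obtain j s q where x: "x = (j * s) * ?b1 * q" "j \<in> J1" "s \<in> S h" unfolding P_def by blast
      moreover have "j * s \<in> S h" using S_one_mult(1)[OF hc(1) x(3) J1S[OF x(2)]] .
      ultimately show "x \<in> {s * component b d * z | y s d z. y \<in> {h} \<and> s \<in> S y \<and> d \<in> {\<one>}}" by blast
    qed
    then show ?thesis using hull_mono j(1) J(2) unfolding J0_def by blast
  qed
  then obtain b' where b': "b' \<in> B" "b' \<in> reduced L K" "component b' \<one> \<noteq> 0"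
    using transfer_element[OF K(1) B b(1) _ _ jK j(2), of "{h}" "{\<one>}"] hc by blast
  have b'0: "b' \<noteq> 0"
  proof
    assume "b' = 0" then show False using b'(3) by simp
  qed
  obtain \<delta>\<^sub>2 where \<delta>2: "\<delta>\<^sub>2 \<in> ?D" "y = \<delta>\<^sub>2 \<otimes> v" using \<alpha>'(1) by blast
  have \<delta>2c: "\<delta>\<^sub>2 \<in> carrier G" and dc: "d \<in> carrier G" using \<delta>2 \<alpha>'(2) Dc by auto
  \<comment> \<open>The map by which degrees of \<alpha> become degrees of \<open>\<alpha>'\<close>.
    It sends \<open>finite_conj H\<close> into \<open>finite_conj L\<close>, and
    \<open>g\<^sub>0\<close> as well; so the elements outside come from one fewer element.\<close>
  define \<kappa> where "\<kappa> g = y \<otimes> g \<otimes> inv (y \<otimes> d)" for g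
  have yH: "y \<in> H" using \<delta>2 vH M(1) by (auto intro: subgroup.m_closed)
  have yc: "y \<in> carrier G" using M(6)[OF yH] .
  have \<kappa>: "\<kappa> x = conj_by (inv y) x \<otimes> conj_by (inv y) (inv d)" if "x \<in> carrier G" for x
    unfolding \<kappa>_def using that yc dc by (simp add: conj_by_def m_assoc inv_mult_group inv_cancel_left)
  have cd: "conj_by (inv y) (inv d) \<in> finite_conj H"
    using conj_by_finite_conj_Int[OF M(1) _ M(7)[OF yH]] subgroup.m_inv_closed[OF D \<alpha>'(2)] by blast
  have \<kappa>D: "\<kappa> x \<in> finite_conj L" if x: "x \<in> finite_conj H" for x
  proof -
    have "conj_by (inv y) x \<in> finite_conj H" using finite_conj_conj_by[OF M(1) x M(7)[OF yH]] .
    then have "\<kappa> x \<in> finite_conj H"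
      using cd D' \<kappa>[OF finite_conj_carrier[OF x]] by (auto intro: subgroup.m_closed)
    then show ?thesis using D'L by blast
  qed
  have \<kappa>g0: "\<kappa> g\<^sub>0 \<in> finite_conj L"
  proof -
    have cu: "conj_by u \<delta> \<in> finite_conj L"
      using conj_by_finite_conj_Int[OF M(1) w(3) uH] D'L by blast
    have cuc: "conj_by u \<delta> \<in> carrier G" using uc \<delta>c by simp
    have "v \<otimes> g\<^sub>0 \<otimes> inv v = g \<otimes> inv (conj_by u \<delta>)"
      unfolding geq using vc g0c cuc by (simp add: m_assoc)
    then have vg: "v \<otimes> g\<^sub>0 \<otimes> inv v \<in> finite_conj L"
      using DL g(2) cu by (simp only: subgroup.m_closed subgroup.m_inv_closed)
    have \<delta>2L: "\<delta>\<^sub>2 \<in> finite_conj L" using \<delta>2(1) D'L by blast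
    have "conj_by (inv y) g\<^sub>0 = \<delta>\<^sub>2 \<otimes> (v \<otimes> g\<^sub>0 \<otimes> inv v) \<otimes> inv \<delta>\<^sub>2"
      unfolding \<delta>2(2) using vc g0c \<delta>2c by (simp add: conj_by_def m_assoc inv_mult_group)
    then have "conj_by (inv y) g\<^sub>0 \<in> finite_conj L"
      using DL vg \<delta>2L by (simp only: subgroup.m_closed subgroup.m_inv_closed)
    then show ?thesis using \<kappa>[OF g0c] DL cd D'L by (auto intro: subgroup.m_closed)
  qed
  have "support \<alpha>' - finite_conj L \<subseteq> \<kappa> ` (support \<alpha> - finite_conj H - {g\<^sub>0})"
  proof
    fix x assume x: "x \<in> support \<alpha>' - finite_conj L"
    then obtain g' where g': "g' \<in> support \<alpha>" "x = \<kappa> g'" using \<alpha>'(6) unfolding \<kappa>_def by blast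
    have "g' \<notin> finite_conj H" using \<kappa>D g' x by blast
    moreover have "g' \<noteq> g\<^sub>0" using \<kappa>g0 g' x by blast
    ultimately show "x \<in> \<kappa> ` (support \<alpha> - finite_conj H - {g\<^sub>0})" using g' by blast
  qed
  then have "card (support \<alpha>' - finite_conj L) \<le> card (support \<alpha> - finite_conj H - {g\<^sub>0})"
    by (meson card_image_le card_mono finite_Diff finite_imageI finite_support le_trans)
  also have "\<dots> < card (support \<alpha> - finite_conj H)" using w(2) by (intro card_Diff1_less) auto
  finally have less: "card (support \<alpha>' - finite_conj L) < card (support \<alpha> - finite_conj H)" .
  have "\<one> \<in> support \<alpha>' \<inter> finite_conj L"
    using \<alpha>'(5) subgroup.one_closed[OF DL] by (simp add: in_support_iff)
  then show ?thesis using that[OF K(1) \<alpha>'(3,4) _ b'(1,2) b'0 less] by blast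
qed

text \<open>Infinite descent without a base case: if the support had no elements outside \<Delta>,
  the step would still demand a smaller count.\<close>

lemma no_descent:
  assumes "admissible H I" "\<alpha> \<in> A" "\<alpha> \<in> reduced H I" "support \<alpha> \<inter> finite_conj H \<noteq> {}"
    and "b \<in> B" "b \<in> reduced H I" "b \<noteq> 0"
  shows False
  using assms
proof (induction "card (support \<alpha> - finite_conj H)" arbitrary: H I \<alpha> b rule: less_induct)
  case less
  obtain L K \<alpha>' b' where "admissible L K" "\<alpha>' \<in> A" "\<alpha>' \<in> reduced L K" "support \<alpha>' \<inter> finite_conj L \<noteq> {}"
    "b' \<in> B" "b' \<in> reduced L K" "b' \<noteq> 0"
    "card (support \<alpha>' - finite_conj L) < card (support \<alpha> - finite_conj H)"
    using descent_step[OF less.prems] .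
  then show False using less.hyps by blast
qed

text \<open>Local units write every coefficient as a product from \<open>S \<one>\<close> and
  \<open>S x\<close>, so the descent can start at the whole group with arbitrary elements of
  \<open>A\<close> and \<open>B\<close>.\<close>

lemma reduced_UNIV: "reduced (carrier G) (S \<one>) = UNIV"
proof -
  have "component a x \<in> S \<one> \<star> S x" if x: "x \<in> carrier G" for a x
  proof -
    obtain u where u: "u \<in> S \<one>" "u * component a x = component a x"
      using unit_left[OF x component_in[OF x]] by blast
    then show ?thesis using mult_in_sum_mult[OF u(1) component_in[OF x, of a]] by simp
  qed
  then show ?thesis using support_carrier by (auto simp: reduced_def)
qed

lemma admissible_whole: "admissible (carrier G) (S \<one>)"
proof -
  have "ideal_of (S \<one>) (S \<one>)"
    using S_additive S_one_mult[OF one_closed] by (auto simp: ideal_of_def)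
  moreover have "s * i * t \<in> S \<one>" if "x \<in> carrier G" "s \<in> S (inv x)" "i \<in> S \<one>" "t \<in> S x" for x s i t
    using S_inv_mult_S(2)[OF that(1,4)] S_one_mult(2)[of "inv x" s i] that by auto
  ultimately show ?thesis by (auto simp: admissible_def subgroup_self)
qed

lemma one_factor_zero: "A = {0} \<or> B = {0}"
proof (rule ccontr)
  assume ne: "\<not> ?thesis"
  have "0 \<in> A" "0 \<in> B"
    using additive_subgroupD(1)[OF ideal_ofD(2)[OF A]] additive_subgroupD(1)[OF ideal_ofD(2)[OF B]] by auto
  then obtain a b where ab: "a \<in> A" "a \<noteq> 0" "b \<in> B" "b \<noteq> 0" using ne by blast
  \<comment> \<open>Only the element of \<open>A\<close> has to be moved so that its support meets
    \<Delta>; the descent accepts any nonzero element of \<open>B\<close>.\<close>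
  obtain \<alpha> where \<alpha>: "\<alpha> \<in> A" "component \<alpha> \<one> \<noteq> 0"
    using shifted_nonzero[OF admissible_whole A ab(1) _ ab(2)] reduced_UNIV by blast
  have "\<one> \<in> finite_conj (carrier G)" using finite_conj_subgroup subgroup.one_closed by blast
  then have "support \<alpha> \<inter> finite_conj (carrier G) \<noteq> {}" using \<alpha> in_support_iff by blast
  then show False using no_descent[OF admissible_whole \<alpha>(1)] ab(3,4) reduced_UNIV by blast
qed

end

section \<open>Conclusion: the equivalence of (a) to (e)\<close>

lemma (in nearly_epsilon_strong) assertion_a_imp_e:
  assumes nz: "(UNIV :: 'r set) \<noteq> {0}" and a: "assertion_a G S"
  shows "assertion_e G S"
proof (rule ccontr)
  assume ne: "\<not> assertion_e G S"
  have "ideal_of UNIV ({0} :: 'r set)" by (simp add: ideal_of_def additive_subgroup_set_def)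
  then obtain A B :: "'r set" where ideals: "ideal_of UNIV A" "ideal_of UNIV B" "A \<star> B \<subseteq> {0}"
    "\<not> A \<subseteq> {0}" "\<not> B \<subseteq> {0}"
    using a nz unfolding assertion_a_def prime_ring_def prime_ideal_of_def by metis
  interpret zero_product_ideals G S A B
    by unfold_locales (use ideals ne mult_in_sum_mult in blast)+
  show False using one_factor_zero ideals(4,5) by blast
qed

theorem theorem1p3:
  fixes G :: "('g, 'm) monoid_scheme"
    and S :: "'g \<Rightarrow> 'a::ring set"
  assumes "group G"
    and "graded_ring G S"
    and "(UNIV :: 'a set) \<noteq> {0}"
  shows "(nondegenerately_graded G S \<longrightarrow>
            (assertion_e G S \<longrightarrow> assertion_d G S) \<and>
            (assertion_d G S \<longrightarrow> assertion_c G S) \<and>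
            (assertion_c G S \<longrightarrow> assertion_b G S) \<and>
            (assertion_b G S \<longrightarrow> assertion_a G S)) \<and>
         (nearly_epsilon_strongly_graded G S \<longrightarrow>
            (assertion_a G S \<longleftrightarrow> assertion_b G S) \<and>
            (assertion_b G S \<longleftrightarrow> assertion_c G S) \<and>
            (assertion_c G S \<longleftrightarrow> assertion_d G S) \<and>
            (assertion_d G S \<longleftrightarrow> assertion_e G S))"
proof -
  interpret graded G S
    using assms by (intro graded.intro graded_axioms.intro)
  have down: "(assertion_e G S \<longrightarrow> assertion_d G S) \<and> (assertion_d G S \<longrightarrow> assertion_c G S) \<and>
      (assertion_c G S \<longrightarrow> assertion_b G S) \<and> (assertion_b G S \<longrightarrow> assertion_a G S)"
    if "nondegenerately_graded G S"
    using assertion_e_imp_d[OF that] assertion_d_imp_c assertion_c_imp_b assertion_b_imp_a[OF that] by blast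
  have "nondegenerately_graded G S \<and> (assertion_a G S \<longrightarrow> assertion_e G S)"
    if "nearly_epsilon_strongly_graded G S"
  proof -
    interpret nearly_epsilon_strong G S
      using that by unfold_locales
    show ?thesis using nondegenerate assertion_a_imp_e[OF assms(3)] by blast
  qed
  then show ?thesis using down by blast
qed

end
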